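(* Let $1\le p_0<q_0\le\infty$ and $p_0<p,q<q_0$. Let $\mathcal S\subset\mathcal D$ be a sparse family, let $\{\lambda_Q\}_{Q\in\mathcal S}$ be a family of non-negative real numbers, and let $(w,\sigma)$ be a pair of weights. Put $$u:=w^{\frac{p_0}{p_0-p}},\qquad v:=\sigma^{\frac{q_0'}{q_0'-q'}},$$ which are assumed to be weights (locally integrable). Let $\mathcal N\in[0,\infty]$ be the best constant such that $$\sum_{Q\in\mathcal S}\langle |f|^{p_0}\rangle_Q^{\frac1{p_0}}\,\langle |g|^{q_0'}\rangle_Q^{\frac1{q_0'}}\,\lambda_Q\le \mathcal N\,\|f\|_{L^p(w)}\,\|g\|_{L^{q'}(\sigma)}$$ holds for all $f\in L^p(w)$ and $g\in L^{q'}(\sigma)$. Denote $$\tau_Q:=\langle u\rangle_Q^{-\frac1{p_0'}}\langle v\rangle_Q^{-\frac1{q_0}}\frac{\lambda_Q}{|Q|},\qquad T_F(f):=\sum_{\substack{Q\in\mathcal S\\ Q\subset F}}\tau_Q\langle f\rangle_Q\mathbf 1_Q .$$ Let $s\in(1,\infty]$ be determined by $$\frac1s=\Big(\frac1q-\frac1p\Big)_+:=\max\Big\{\frac1q-\frac1p,0\Big\},$$ and set $$\mathfrak T_s:=\sup_{\mathcal F}\Big\|\Big\{\frac{\|T_F(u)\|_{L^q(v)}}{u(F)^{1/p}}\Big\}_{F\in\mathcal F}\Big\|_{\ell^s},\qquad \mathfrak T_s^*:=\sup_{\mathcal G}\Big\|\Big\{\frac{\|T_G(v)\|_{L^{p'}(u)}}{v(G)^{1/q'}}\Big\}_{G\in\mathcal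 G}\Big\|_{\ell^s},$$ where the suprema are taken over all subcollections $\mathcal F$ and $\mathcal G$ of $\mathcal S$ that are sparse with respect to $u$ and $v$, respectively. Then $$\mathcal N\eqsim \mathfrak T_s+\mathfrak T_s^* .$$
   Context: Setting: $(X,d)$ is a locally compact separable metric space equipped with a doubling Borel measure $\mu$, finite on compact sets and strictly positive on nonempty open sets. Write $|E|:=\mu(E)$ and $dx$ for $d\mu$. $\mathcal D$ is a fixed dyadic system on $X$: $\mathcal D=\bigcup_{k\in\mathbb Z}\mathcal D_k$, where each $\mathcal D_k$ is a countable partition of $X$ into Borel sets ("cubes"), any two cubes are either disjoint or nested (with $\mathcal D_{k+1}$ refining $\mathcal D_k$), and, for some fixed $\delta\in(0,1)$ and $0<c\le C<\infty$, each $Q\in\mathcal D_k$ has a point $z_Q$ with $B(z_Q,c\delta^k)\subset Q\subset B(z_Q,C\delta^k)$. (On $\mathbb R^n$ with Lebesgue measure one may take the usual dyadic cubes.) A family $\mathcal S\subset\mathcal D$ is sparse if $\big|\bigcup_{Q'\in\mathcal S,\,Q'\subsetneq Q}Q'\big|\le\frac12|Q|$ for every $Q\in\mathcal S$. It is sparse with respect to a weight $u$ if the same condition holds with $|\cdot|$ replaced by $u(\cdot)$. A weight is a locally integrable, a.e. positive function; for a weight $w$, $w(E):=\int_E w\,dx$ and $\|f\|_{L^p(w)}=(\int|f|^p w\,dx)^{1/p}$. Averages: $\langle h\rangle_Q:=\frac1{|Q|}\int_Q h\,dx$. For an exponent $t$, $t'$ is its conjugate exponent, $1/t+1/t'=1$,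 with $1/\infty=0$. The notation $a\eqsim b$ means $C^{-1}b\le a\le Cb$ with a constant $C$ independent of $w,\sigma,\mathcal S$ and $\{\lambda_Q\}$ (it may depend on $p_0,q_0,p,q$ and the underlying space). *)

theory Defs
  imports "HOL-Analysis.Analysis"
begin

section \<open>Exponents\<close>

text \<open>
  For \<open>t \<ge> 1\<close> this is the solution of \<open>1/t + 1/t' = 1\<close> with \<open>1/\<infinity> = 0\<close>;
  division in \<^typ>\<open>ennreal\<close> already has \<open>inverse top = 0\<close> and \<open>inverse 0 = top\<close>.
\<close>

definition conj_exp :: "ennreal \<Rightarrow> ennreal" where
  "conj_exp t = inverse (1 - inverse t)"

text \<open>
  Real powers on \<open>[0,\<infinity>]\<close>, with \<open>0\<^sup>t = \<infinity>\<close> and \<open>\<infinity>\<^sup>t = 0\<close> for \<open>t < 0\<close>, and \<open>x\<^sup>0 = 1\<close> throughout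
  (unlike \<^term>\<open>(0::real) powr 0\<close>, which is \<open>0\<close>).
\<close>

definition ennpowr :: "ennreal \<Rightarrow> real \<Rightarrow> ennreal"  (infixr \<open>epowr\<close> 80) where
  "x epowr t =
    (if t = 0 then 1
     else if x = 0 then (if t > 0 then 0 else top)
     else if x = top then (if t > 0 then top else 0)
     else ennreal (enn2real x powr t))"

lemma inverse_conj_exp_add:
  assumes "1 \<le> t"
  shows "inverse t + inverse (conj_exp t) = 1"
proof -
  have "inverse t \<le> 1"
  proof (cases t)
    case (real r)
    then have "1 \<le> r" using assms by (simp flip: ennreal_1)
    then show ?thesis
      using real by (simp add: inverse_ennreal inverse_le_1_iff flip: ennreal_1)
  qed simp
  moreover have "inverse (inverse x) = x" for x :: ennreal
    using divide_ennreal_def one_divide_one_divide_ennreal by auto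
  ultimately show ?thesis
    by (simp add: conj_exp_def)
qed

lemma conj_exp_real:
  assumes "1 < t"
  shows "conj_exp (ennreal t) = ennreal (t / (t - 1))"
proof -
  have "1 - inverse (ennreal t) = ennreal (1 - inverse t)"
    using assms
    by (smt (verit, best) ennreal_1 ennreal_minus inverse_ennreal inverse_inverse_eq one_less_inverse_iff)
  also have "inverse \<dots> = ennreal (inverse (1 - inverse t))"
    using assms by (intro inverse_ennreal) (simp add: field_simps)
  also have "inverse (1 - inverse t) = t / (t - 1)"
    using assms by (simp add: field_simps)
  finally show ?thesis by (simp add: conj_exp_def)
qed

lemma conj_exp_1: "conj_exp 1 = top" and conj_exp_top: "conj_exp top = 1"
  by (simp_all add: conj_exp_def)

lemma ennpowr_ennreal: "0 < x \<Longrightarrow> ennreal x epowr t = ennreal (x powr t)"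
  by (simp add: ennpowr_def ennreal_eq_0_iff)


section \<open>The underlying space\<close>

definition doubling_space :: "'a::metric_space measure \<Rightarrow> bool" where
  "doubling_space M \<longleftrightarrow>
     locally_compact_space (euclidean :: 'a topology) \<and>
     separable_space (euclidean :: 'a topology) \<and>
     sets M = sets borel \<and>
     (\<forall>K. compact K \<longrightarrow> emeasure M K < top) \<and>
     (\<forall>U. open U \<longrightarrow> U \<noteq> {} \<longrightarrow> 0 < emeasure M U) \<and>
     (\<exists>B::real. \<forall>x r. 0 < r \<longrightarrow> emeasure M (ball x (2 * r)) \<le> ennreal B * emeasure M (ball x r))"

text \<open>\<open>D k\<close> is the generation \<open>k\<close> of cubes. Cubes are plain sets, so the same cube may belong to
  several generations.\<close>

definition dyadic_system :: "(int \<Rightarrow> 'a::metric_space set set) \<Rightarrow> bool" where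
  "dyadic_system D \<longleftrightarrow>
     (\<forall>k. countable (D k) \<and> D k \<subseteq> sets borel \<and> partition_on UNIV (D k)) \<and>
     (\<forall>k. refines UNIV (D (k + 1)) (D k)) \<and>
     (\<forall>Q\<in>(\<Union>k. D k). \<forall>R\<in>(\<Union>k. D k). Q \<inter> R = {} \<or> Q \<subseteq> R \<or> R \<subseteq> Q) \<and>
     (\<exists>\<delta> c C :: real. 0 < \<delta> \<and> \<delta> < 1 \<and> 0 < c \<and> c \<le> C \<and>
        (\<forall>k. \<forall>Q\<in>D k. \<exists>z. ball z (c * \<delta> powi k) \<subseteq> Q \<and> Q \<subseteq> ball z (C * \<delta> powi k)))"


section \<open>Weights, norms and averages\<close>

text \<open>
  Local integrability means integrability on every ball. Under \<^const>\<open>doubling_space\<close> balls have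
  finite measure, but they need not be relatively compact (the space need not be complete), and
  integrability on compact sets alone would not make the averages over cubes finite.
\<close>

definition weight :: "'a::metric_space measure \<Rightarrow> ('a \<Rightarrow> real) \<Rightarrow> bool" where
  "weight M w \<longleftrightarrow>
     w \<in> borel_measurable M \<and> (AE x in M. 0 < w x) \<and> (\<forall>x r. set_integrable M (ball x r) w)"

abbreviation wmeasure :: "'a measure \<Rightarrow> ('a \<Rightarrow> real) \<Rightarrow> 'a measure" where
  "wmeasure M w \<equiv> density M (\<lambda>x. ennreal (w x))"

text \<open>With \<open>N = wmeasure M w\<close> these give sparseness with respect to \<open>w\<close> and the norm of \<open>L\<^sup>t(w)\<close>.\<close>

definition sparse_family :: "'a measure \<Rightarrow> 'a set set \<Rightarrow> bool" where
  "sparse_family N S \<longleftrightarrow> (\<forall>Q\<in>S. emeasure N (\<Union>{Q'\<in>S. Q' \<subset> Q}) \<le> emeasure N Q / 2)"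

definition Lp_norm :: "'a measure \<Rightarrow> real \<Rightarrow> ('a \<Rightarrow> ennreal) \<Rightarrow> ennreal" where
  "Lp_norm N t h = (\<integral>\<^sup>+x. h x epowr t \<partial>N) epowr (1 / t)"

definition Lp_space :: "'a measure \<Rightarrow> real \<Rightarrow> ('a \<Rightarrow> real) set" where
  "Lp_space N t = {f \<in> borel_measurable N. Lp_norm N t (\<lambda>x. ennreal \<bar>f x\<bar>) < top}"

definition ell_norm :: "ennreal \<Rightarrow> 'i set \<Rightarrow> ('i \<Rightarrow> ennreal) \<Rightarrow> ennreal" where
  "ell_norm s I a = (if s = top then (SUP i\<in>I. a i) else Lp_norm (count_space I) (enn2real s) a)"

definition avg :: "'a measure \<Rightarrow> ('a \<Rightarrow> ennreal) \<Rightarrow> 'a set \<Rightarrow> ennreal" where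
  "avg M h Q = (\<integral>\<^sup>+x\<in>Q. h x \<partial>M) / emeasure M Q"


section \<open>The sparse form and the testing constants\<close>

text \<open>Sums of elements of \<open>[0,\<infinity>]\<close> over a family are integrals against its counting measure.\<close>

definition sparse_form ::
  "'a measure \<Rightarrow> real \<Rightarrow> ennreal \<Rightarrow> 'a set set \<Rightarrow> ('a set \<Rightarrow> real) \<Rightarrow> ('a \<Rightarrow> real) \<Rightarrow> ('a \<Rightarrow> real) \<Rightarrow> ennreal"
where
  "sparse_form M p0 q0 S lam f g =
    (let q0' = enn2real (conj_exp q0) in
     \<integral>\<^sup>+Q. avg M (\<lambda>x. ennreal (\<bar>f x\<bar> powr p0)) Q epowr (1 / p0)
          * avg M (\<lambda>x. ennreal (\<bar>g x\<bar> powr q0')) Q epowr (1 / q0')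
          * ennreal (lam Q) \<partial>count_space S)"

definition best_const ::
  "'a measure \<Rightarrow> real \<Rightarrow> ennreal \<Rightarrow> real \<Rightarrow> real \<Rightarrow> 'a set set \<Rightarrow> ('a set \<Rightarrow> real)
    \<Rightarrow> ('a \<Rightarrow> real) \<Rightarrow> ('a \<Rightarrow> real) \<Rightarrow> ennreal"
where
  "best_const M p0 q0 p q S lam w \<sigma> =
    (let q' = enn2real (conj_exp (ennreal q)) in
     Inf {N. \<forall>f\<in>Lp_space (wmeasure M w) p. \<forall>g\<in>Lp_space (wmeasure M \<sigma>) q'.
            sparse_form M p0 q0 S lam f g
              \<le> N * Lp_norm (wmeasure M w) p (\<lambda>x. ennreal \<bar>f x\<bar>)
                  * Lp_norm (wmeasure M \<sigma>) q' (\<lambda>x. ennreal \<bar>g x\<bar>)})"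

definition tau ::
  "'a measure \<Rightarrow> real \<Rightarrow> ennreal \<Rightarrow> ('a set \<Rightarrow> real) \<Rightarrow> ('a \<Rightarrow> real) \<Rightarrow> ('a \<Rightarrow> real) \<Rightarrow> 'a set \<Rightarrow> ennreal"
where
  "tau M p0 q0 lam u v Q =
     avg M (\<lambda>x. ennreal (u x)) Q epowr (- enn2real (inverse (conj_exp (ennreal p0))))
     * avg M (\<lambda>x. ennreal (v x)) Q epowr (- enn2real (inverse q0))
     * (ennreal (lam Q) / emeasure M Q)"

definition T_op ::
  "'a measure \<Rightarrow> 'a set set \<Rightarrow> ('a set \<Rightarrow> ennreal) \<Rightarrow> 'a set \<Rightarrow> ('a \<Rightarrow> real) \<Rightarrow> 'a \<Rightarrow> ennreal"
where
  "T_op M S t F f x =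
     (\<integral>\<^sup>+Q. t Q * avg M (\<lambda>y. ennreal (f y)) Q * indicator Q x \<partial>count_space {Q\<in>S. Q \<subseteq> F})"

text \<open>
  \<open>testing_const M S t s a b u v\<close> tests the operator with coefficients \<open>t\<close> from \<open>L\<^sup>a(u)\<close> to \<open>L\<^sup>b(v)\<close>:
  the direct constant has \<open>(a, b) = (p, q)\<close>, the dual one \<open>(a, b) = (q', p')\<close> with \<open>u\<close> and \<open>v\<close> exchanged.
\<close>

definition testing_const ::
  "'a measure \<Rightarrow> 'a set set \<Rightarrow> ('a set \<Rightarrow> ennreal) \<Rightarrow> ennreal \<Rightarrow> real \<Rightarrow> real
    \<Rightarrow> ('a \<Rightarrow> real) \<Rightarrow> ('a \<Rightarrow> real) \<Rightarrow> ennreal"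
where
  "testing_const M S t s a b u v =
    (SUP \<F>\<in>{\<F>. \<F> \<subseteq> S \<and> sparse_family (wmeasure M u) \<F>}.
       ell_norm s \<F> (\<lambda>F. Lp_norm (wmeasure M v) b (T_op M S t F u)
                          / emeasure (wmeasure M u) F epowr (1 / a)))"

end

theory Submission
  imports Defs
begin

text \<open>
  Write \<open>\<mu> = u dx\<close> and \<open>\<nu> = v dx\<close>. The exponents of \<open>u\<close> and \<open>v\<close> are those for which the substitution
  \<open>|f| = F u\<^bsup>1/p\<^sub>0\<^esup>\<close>, \<open>|g| = G v\<^bsup>1/q\<^sub>0'\<^esup>\<close> turns \<open>L\<^sup>p(w)\<close> into \<open>L\<^sup>p(\<mu>)\<close> and \<open>L\<^bsup>q'\<^esup>(\<sigma>)\<close> into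
  \<open>L\<^bsup>q'\<^esup>(\<nu>)\<close> isometrically (\<open>change_of_function\<close>). The sparse form becomes
  \<open>\<Sum>\<^sub>Q a\<^sub>Q \<mu>(Q) X\<^sub>Q \<nu>(Q) Y\<^sub>Q\<close> with \<open>a\<^sub>Q = \<tau>\<^sub>Q / |Q|\<close>, where \<open>X\<^sub>Q\<close> is the \<open>L\<^bsup>p\<^sub>0\<^esup>\<close>-average of \<open>F\<close> over \<open>Q\<close>
  with respect to \<open>\<mu>\<close> and \<open>Y\<^sub>Q\<close> is the \<open>L\<^bsup>q\<^sub>0'\<^esup>\<close>-average of \<open>G\<close> with respect to \<open>\<nu>\<close>
  (\<open>sparse_form_eq\<close>). These averages may be replaced by ordinary ones. Jensen's
  inequality gives one direction. For the other, \<open>X\<^sub>Q\<close> is at most the average over \<open>Q\<close> of the dyadic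
  maximal function \<open>(M\<^sub>\<mu>(F\<^bsup>p\<^sub>0\<^esup>))\<^bsup>1/p\<^sub>0\<^esup>\<close>, and this operator is bounded on \<open>L\<^sup>p(\<mu>)\<close> because
  \<open>p > p\<^sub>0\<close> (\<open>pavg_dominated\<close>); likewise for \<open>Y\<^sub>Q\<close>, because \<open>q' > q\<^sub>0'\<close>. So the claim is the two-weight
  testing theorem for the bilinear form \<open>\<Sum>\<^sub>Q a\<^sub>Q \<integral>\<^sub>Q F d\<mu> \<integral>\<^sub>Q G d\<nu>\<close>.

  For sufficiency of testing (\<open>testing_sufficient\<close>), choose stopping families \<open>\<F>\<close> for \<open>F, \<mu>\<close> and \<open>\<G>\<close> for \<open>G, \<nu>\<close>:
  averages double from one stopping cube to the next, and are at most doubled on the cubes in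
  between. A cube \<open>Q\<close> lies in a least member of each family; these two members are nested, and by symmetry
  one may assume that the one from \<open>\<G>\<close> is the smaller. Grouping such \<open>Q\<close> by their \<open>\<F>\<close>-parent \<open>R\<close> leaves
  the average of \<open>F\<close> over \<open>R\<close> times \<open>\<integral> T\<^sub>R(u) h\<^sub>R d\<nu>\<close>, where \<open>h\<^sub>R\<close> collects the averages of \<open>G\<close> over the members
  of \<open>\<G>\<close> whose \<open>\<F>\<close>-parent is \<open>R\<close>. Hoelder's inequality in the integral, then in the sum over \<open>R\<close> with the exponents
  \<open>p\<close>, \<open>s\<close>, \<open>q'\<close>, and Carleson embedding for both stopping families bound the sum
  (\<open>stopping_half\<close>). The family \<open>\<F>\<close> is sparse with respect to \<open>u\<close>, so that it may be used in \<open>T\<^sub>s\<close>.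

  For necessity (\<open>testing_necessary_finite\<close>), put \<open>A\<^sub>R = \<parallel>T\<^sub>R(u)\<parallel> / u(R)\<^bsup>1/p\<^esup>\<close>. Testing the form on the indicator of \<open>R\<close>
  bounds each \<open>A\<^sub>R\<close>, which settles \<open>s = \<infinity>\<close>. For \<open>s < \<infinity>\<close> one tests on \<open>\<phi> = \<Sum>\<^sub>R c\<^sub>R 1\<^sub>R\<close>.
  On the one hand \<open>T(\<phi>u) \<ge> \<Sum>\<^sub>R c\<^sub>R T\<^sub>R(u)\<close>, and the \<open>\<ell>\<^sup>1\<close>-sum dominates the \<open>\<ell>\<^sup>q\<close>-sum; on the other hand the dual
  of Carleson embedding gives \<open>\<parallel>\<phi>\<parallel>\<^sup>p \<lesssim> \<Sum>\<^sub>R c\<^sub>R\<^sup>p u(R)\<close> (\<open>sparse_sum_norm\<close>). With \<open>c\<^sub>R = A\<^sub>R\<^bsup>s/p\<^esup> u(R)\<^bsup>-1/p\<^esup>\<close> both sides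
  are powers of \<open>\<Sum>\<^sub>R A\<^sub>R\<^sup>s\<close>, and the estimate follows by dividing.

  All of this is done for finite families of cubes, where every quantity to be absorbed is finite;
  the constants do not depend on the family, and monotone convergence along an exhaustion by finite subfamilies gives the
  countable case.
\<close>

section \<open>Powers and Hoelder's inequality on the extended half line\<close>

lemma epowr_zero [simp]: "0 < t \<Longrightarrow> 0 epowr t = 0"
  by (simp add: ennpowr_def)

lemma epowr_top [simp]: "0 < t \<Longrightarrow> top epowr t = top"
  by (simp add: ennpowr_def)

lemma epowr_exponent_zero [simp]: "x epowr 0 = 1"
  by (simp add: ennpowr_def)

lemma epowr_one [simp]: "1 epowr t = 1"
  using ennpowr_ennreal[of 1 t] by simp

lemma epowr_exponent_one [simp]: "x epowr 1 = x"
  by (cases x) (auto simp: ennpowr_def)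

lemma epowr_ennreal: "0 < t \<Longrightarrow> 0 \<le> x \<Longrightarrow> ennreal x epowr t = ennreal (x powr t)"
  by (cases "x = 0") (simp_all add: ennpowr_ennreal)

lemma epowr_eq_0_iff [simp]: "0 < t \<Longrightarrow> x epowr t = 0 \<longleftrightarrow> x = 0"
  by (cases x) (auto simp: epowr_ennreal ennreal_eq_0_iff)

lemma epowr_eq_top_iff [simp]: "0 < t \<Longrightarrow> x epowr t = top \<longleftrightarrow> x = top"
  by (cases x) (auto simp: epowr_ennreal)

lemma epowr_less_top_iff [simp]: "0 < t \<Longrightarrow> x epowr t < top \<longleftrightarrow> x < top"
  using epowr_eq_top_iff[of t x] by (simp add: less_top[symmetric])

lemma epowr_mono: 
  assumes "0 \<le> t" "x \<le> y" shows "x epowr t \<le> y epowr t"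
proof (cases "t = 0")
  case False
  then show ?thesis using assms
    by (cases x; cases y) (auto simp: epowr_ennreal top_unique powr_mono2)
qed simp

lemma epowr_mult:
  assumes "0 \<le> t" shows "(x * y) epowr t = x epowr t * y epowr t"
proof (cases "t = 0")
  case False
  then have t: "0 < t" using assms by simp
  show ?thesis
  proof (cases "x = 0 \<or> y = 0 \<or> x = top \<or> y = top")
    case True
    then show ?thesis
      using t by (cases "x = 0 \<or> y = 0") (auto simp: ennreal_mult_eq_top_iff ennreal_top_mult ennreal_mult_top)
  next
    case False
    then show ?thesis using t
      by (cases x; cases y) (auto simp: epowr_ennreal powr_mult simp flip: ennreal_mult)
  qed
qed simp

lemma epowr_epowr:
  assumes "0 \<le> a" "0 \<le> b" shows "(x epowr a) epowr b = x epowr (a * b)"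
proof (cases "a = 0 \<or> b = 0")
  case False
  then show ?thesis using assms
    by (cases x) (auto simp: epowr_ennreal powr_powr)
qed auto

lemma epowr_add:
  assumes "0 \<le> a" "0 \<le> b" shows "x epowr (a + b) = x epowr a * x epowr b"
proof (cases "a = 0 \<or> b = 0")
  case False
  then show ?thesis using assms
    by (cases x) (auto simp: epowr_ennreal powr_add ennreal_top_mult simp flip: ennreal_mult)
qed auto

lemma epowr_inverse_cancel:
  assumes "0 < t" shows "(x epowr t) epowr (1 / t) = x" "(x epowr (1 / t)) epowr t = x"
  using assms by (simp_all add: epowr_epowr)

lemma epowr_le_cancel:
  assumes "0 < t" "x \<le> y epowr (1 / t)" shows "x epowr t \<le> y"
  using epowr_mono[of t x "y epowr (1 / t)"] assms by (simp add: epowr_inverse_cancel)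

lemma epowr_measurable [measurable (raw)]:
  assumes "f \<in> borel_measurable M"
  shows "(\<lambda>x. f x epowr t) \<in> borel_measurable M"
  unfolding ennpowr_def using assms by measurable

text \<open>
  Write \<open>z\<^sup>t = z z\<^bsup>t-1\<^esup>\<close> and use that \<open>z\<^bsup>t-1\<^esup>\<close> is increasing.
\<close>

lemma epowr_superadditive:
  assumes "1 \<le> t" shows "x epowr t + y epowr t \<le> (x + y) epowr t"
proof -
  have t: "0 < t" "t = 1 + (t - 1)" using assms by auto
  have e: "z epowr t = z * z epowr (t - 1)" for z
    using epowr_add[of 1 "t - 1" z] assms by simp
  have "x epowr t + y epowr t \<le> x * (x + y) epowr (t - 1) + y * (x + y) epowr (t - 1)"
    unfolding e using assms by (intro add_mono mult_left_mono epowr_mono) auto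
  also have "\<dots> = (x + y) epowr t"
    unfolding e[of "x + y"] by (simp add: distrib_right)
  finally show ?thesis .
qed

lemma sum_epowr_le:
  assumes "1 \<le> t" "finite A" shows "(\<Sum>i\<in>A. x i epowr t) \<le> (\<Sum>i\<in>A. x i) epowr t"
  using assms(2)
proof (induction A rule: finite_induct)
  case (insert i A)
  have "x i epowr t + (\<Sum>i\<in>A. x i epowr t) \<le> x i epowr t + (\<Sum>i\<in>A. x i) epowr t"
    by (intro add_left_mono insert)
  also have "\<dots> \<le> (x i + (\<Sum>i\<in>A. x i)) epowr t"
    by (rule epowr_superadditive[OF assms(1)])
  finally show ?case using insert by simp
qed (use assms in simp)

lemma epowr_SUP:
  fixes h :: "nat \<Rightarrow> ennreal"
  assumes "0 < t" "incseq h"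
  shows "(SUP n. h n) epowr t = (SUP n. h n epowr t)"
proof (rule antisym)
  have "(SUP n. h n) \<le> (SUP n. h n epowr t) epowr (1 / t)"
  proof (rule SUP_least)
    fix n
    have "(h n epowr t) epowr (1 / t) \<le> (SUP n. h n epowr t) epowr (1 / t)"
      using assms by (intro epowr_mono SUP_upper) auto
    then show "h n \<le> (SUP n. h n epowr t) epowr (1 / t)"
      by (simp add: epowr_inverse_cancel assms)
  qed
  then show "(SUP n. h n) epowr t \<le> (SUP n. h n epowr t)"
    by (rule epowr_le_cancel[OF assms(1)])
next
  show "(SUP n. h n epowr t) \<le> (SUP n. h n) epowr t"
    using assms by (intro SUP_least epowr_mono SUP_upper) auto
qed

lemma youngs_inequality_epowr:
  fixes x y :: ennreal
  assumes "0 < a" "0 < b" "1 / a + 1 / b = 1"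
  shows "x * y \<le> ennreal (1 / a) * x epowr a + ennreal (1 / b) * y epowr b"
proof (cases "x = top \<or> y = top")
  case True
  then show ?thesis
    using assms by (cases "x = 0 \<or> y = 0") (auto simp: ennreal_mult_top)
next
  case False
  then obtain r s where rs: "x = ennreal r" "y = ennreal s" "0 \<le> r" "0 \<le> s"
    by (cases x; cases y) auto
  have "0 < 1 / a" "0 < 1 / b"
    using assms by auto
  then have "1 / a < 1" "1 / b < 1"
    using assms by linarith+
  then have ab: "1 < a" "1 < b"
    using assms by (simp_all add: divide_less_eq)
  have "r * s \<le> r powr a / a + s powr b / b"
    using Youngs_inequality[of a b r s] ab assms rs by simp
  then have "ennreal (r * s) \<le> ennreal (1 / a * r powr a + 1 / b * s powr b)"
    by (intro ennreal_leI) simp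
  also have "\<dots> = ennreal (1 / a) * ennreal (r powr a) + ennreal (1 / b) * ennreal (s powr b)"
    using assms by (subst ennreal_plus) (simp_all flip: ennreal_mult)
  finally show ?thesis
    using rs assms by (simp add: epowr_ennreal ennreal_mult)
qed

lemma ennreal_mult_inverse:
  fixes x :: ennreal
  assumes "x \<noteq> 0" "x < top" shows "x * inverse x = 1"
  using assms ennreal_divide_self[of x] by (simp add: divide_ennreal_def less_top)

lemma inverse_root_epowr:
  assumes "0 < a" "x \<noteq> 0" "x < top"
  shows "inverse (x epowr (1 / a)) epowr a * x = 1"
proof -
  have "inverse (x epowr (1 / a)) epowr a * (x epowr (1 / a)) epowr a = 1"
    using assms ennreal_mult_inverse[of "x epowr (1 / a)"]
    by (subst epowr_mult[symmetric]) (simp_all add: mult.commute)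
  then show ?thesis using assms by (simp add: epowr_inverse_cancel)
qed

text \<open>
  Young's inequality applies after both functions have been divided by their norms. This
  needs norms in \<open>(0,\<infinity>)\<close>; the remaining cases are immediate.
\<close>

lemma Holder_nn_integral:
  assumes [measurable]: "f \<in> borel_measurable M" "g \<in> borel_measurable M"
    and ab: "0 < a" "0 < b" "1 / a + 1 / b = 1"
  shows "(\<integral>\<^sup>+x. f x * g x \<partial>M)
    \<le> (\<integral>\<^sup>+x. f x epowr a \<partial>M) epowr (1 / a) * (\<integral>\<^sup>+x. g x epowr b \<partial>M) epowr (1 / b)"
proof -
  let ?F = "\<integral>\<^sup>+x. f x epowr a \<partial>M" and ?G = "\<integral>\<^sup>+x. g x epowr b \<partial>M"
  have zero: "(\<integral>\<^sup>+x. f x * g x \<partial>M) = 0" if "?F = 0 \<or> ?G = 0"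
  proof -
    have "AE x in M. f x * g x = 0"
      using that
    proof
      assume "?F = 0"
      then have "AE x in M. f x epowr a = 0"
        by (subst (asm) nn_integral_0_iff_AE) auto
      then show ?thesis by eventually_elim (use ab in auto)
    next
      assume "?G = 0"
      then have "AE x in M. g x epowr b = 0"
        by (subst (asm) nn_integral_0_iff_AE) auto
      then show ?thesis by eventually_elim (use ab in auto)
    qed
    then show ?thesis by (subst nn_integral_0_iff_AE) auto
  qed
  consider "?F = 0 \<or> ?G = 0" | "?F \<noteq> 0" "?G \<noteq> 0" "?F = top \<or> ?G = top"
    | "?F \<noteq> 0" "?F < top" "?G \<noteq> 0" "?G < top"
    using less_top by blast
  then show ?thesis
  proof cases
    case 1 then show ?thesis using zero by simp
  next
    case 2
    then have "?F epowr (1 / a) * ?G epowr (1 / b) = top"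
      using ab by (auto simp: ennreal_mult_eq_top_iff)
    then show ?thesis by simp
  next
    case 3
    let ?A = "?F epowr (1 / a)" and ?B = "?G epowr (1 / b)"
    have A: "?A \<noteq> 0" "?A < top" and B: "?B \<noteq> 0" "?B < top"
      using 3 ab by auto
    have inv: "inverse ?A epowr a * ?F = 1" "inverse ?B epowr b * ?G = 1"
      using 3 ab by (auto intro!: inverse_root_epowr)
    have "(\<integral>\<^sup>+x. (inverse ?A * f x) * (inverse ?B * g x) \<partial>M)
       \<le> (\<integral>\<^sup>+x. ennreal (1 / a) * (inverse ?A * f x) epowr a
             + ennreal (1 / b) * (inverse ?B * g x) epowr b \<partial>M)"
      by (intro nn_integral_mono youngs_inequality_epowr ab)
    also have "\<dots> = ennreal (1 / a) * (inverse ?A epowr a * ?F) + ennreal (1 / b) * (inverse ?B epowr b * ?G)"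
      using ab by (simp add: nn_integral_add nn_integral_cmult epowr_mult)
    also have "\<dots> = 1"
      unfolding inv using ab by (simp flip: ennreal_plus)
    finally have le: "(\<integral>\<^sup>+x. (inverse ?A * f x) * (inverse ?B * g x) \<partial>M) \<le> 1" .
    have "(\<integral>\<^sup>+x. f x * g x \<partial>M) = (\<integral>\<^sup>+x. (?A * ?B) * ((inverse ?A * f x) * (inverse ?B * g x)) \<partial>M)"
    proof (intro nn_integral_cong)
      fix x
      have "(?A * ?B) * ((inverse ?A * f x) * (inverse ?B * g x))
          = (?A * inverse ?A) * (?B * inverse ?B) * (f x * g x)"
        by (simp only: ac_simps)
      also have "\<dots> = f x * g x"
        unfolding ennreal_mult_inverse[OF A] ennreal_mult_inverse[OF B] by simp
      finally show "f x * g x = (?A * ?B) * ((inverse ?A * f x) * (inverse ?B * g x))" ..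
    qed
    also have "\<dots> = (?A * ?B) * (\<integral>\<^sup>+x. (inverse ?A * f x) * (inverse ?B * g x) \<partial>M)"
      by (rule nn_integral_cmult) measurable
    also have "\<dots> \<le> (?A * ?B) * 1"
      by (intro mult_left_mono le) simp
    finally show ?thesis by simp
  qed
qed

lemma Holder_sum:
  assumes "finite A" "0 < a" "0 < b" "1 / a + 1 / b = 1"
  shows "(\<Sum>i\<in>A. x i * y i)
    \<le> (\<Sum>i\<in>A. x i epowr a) epowr (1 / a) * (\<Sum>i\<in>A. y i epowr b) epowr (1 / b)"
  using Holder_nn_integral[OF _ _ assms(2-4), of x "count_space A" y]
  unfolding nn_integral_count_space_finite[OF assms(1)] by simp

section \<open>Stopping families, Carleson embedding and the maximal inequality\<close>

definition laminar :: "'a set set \<Rightarrow> bool" where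
  "laminar S \<longleftrightarrow> (\<forall>Q\<in>S. \<forall>R\<in>S. Q \<inter> R = {} \<or> Q \<subseteq> R \<or> R \<subseteq> Q)"

definition cube_family :: "'a measure \<Rightarrow> 'a set set \<Rightarrow> bool" where
  "cube_family \<mu> S \<longleftrightarrow> finite S \<and> laminar S \<and>
     (\<forall>Q\<in>S. Q \<in> sets \<mu> \<and> 0 < emeasure \<mu> Q \<and> emeasure \<mu> Q < top)"

lemma laminarD: "laminar S \<Longrightarrow> Q \<in> S \<Longrightarrow> R \<in> S \<Longrightarrow> x \<in> Q \<Longrightarrow> x \<in> R \<Longrightarrow> Q \<subseteq> R \<or> R \<subseteq> Q"
  unfolding laminar_def by blast

lemma laminar_subset: "laminar S \<Longrightarrow> S' \<subseteq> S \<Longrightarrow> laminar S'"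
  unfolding laminar_def by blast

lemma cube_family_subset: "cube_family \<mu> S \<Longrightarrow> S' \<subseteq> S \<Longrightarrow> cube_family \<mu> S'"
  unfolding cube_family_def by (meson finite_subset laminar_subset subsetD)

lemma cube_familyD:
  assumes "cube_family \<mu> S"
  shows "finite S" "laminar S" "Q \<in> S \<Longrightarrow> Q \<in> sets \<mu>" "Q \<in> S \<Longrightarrow> 0 < emeasure \<mu> Q"
    "Q \<in> S \<Longrightarrow> emeasure \<mu> Q < top" "Q \<in> S \<Longrightarrow> Q \<noteq> {}"
  using assms unfolding cube_family_def by auto

lemma avg_times_emeasure:
  assumes "0 < emeasure \<mu> Q" "emeasure \<mu> Q < top"
  shows "avg \<mu> f Q * emeasure \<mu> Q = (\<integral>\<^sup>+x\<in>Q. f x \<partial>\<mu>)"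
  unfolding avg_def divide_ennreal_def
  using ennreal_mult_inverse[of "emeasure \<mu> Q"] assms
  by (simp add: mult.assoc mult.commute[of "inverse _"])

lemma set_Holder:
  assumes [measurable]: "f \<in> borel_measurable \<mu>" "Q \<in> sets \<mu>"
    and ab: "0 < a" "0 < b" "1 / a + 1 / b = 1"
  shows "(\<integral>\<^sup>+x\<in>Q. f x \<partial>\<mu>) \<le> (\<integral>\<^sup>+x\<in>Q. f x epowr a \<partial>\<mu>) epowr (1 / a) * emeasure \<mu> Q epowr (1 / b)"
proof -
  have ind: "indicator Q x epowr t = (indicator Q x :: ennreal)" if "0 < t" for x t
    using that by (auto simp: indicator_def)
  have "(\<integral>\<^sup>+x\<in>Q. f x \<partial>\<mu>) = (\<integral>\<^sup>+x. (f x * indicator Q x) * indicator Q x \<partial>\<mu>)"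
    by (intro nn_integral_cong) (auto simp: indicator_def)
  also have "\<dots> \<le> (\<integral>\<^sup>+x. (f x * indicator Q x) epowr a \<partial>\<mu>) epowr (1 / a)
      * (\<integral>\<^sup>+x. indicator Q x epowr b \<partial>\<mu>) epowr (1 / b)"
    by (intro Holder_nn_integral ab) measurable
  finally show ?thesis
    using ab by (simp add: epowr_mult ind)
qed

text \<open>
  This is how an estimate obtained by duality is solved for the unknown quantity \<open>X\<close>: with
  \<open>X\<close> finite, the power of \<open>X\<close> on the right can be divided out. All
  applications are to finite sums, for which finiteness is known.
\<close>

lemma epowr_absorb:
  assumes "0 < a" "0 < b" "1 / a + 1 / b = 1" and X: "X < top" "X \<le> c * X epowr (1 / b)"
  shows "X \<le> c epowr a"
proof (cases "X = 0")
  case False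
  let ?Y = "X epowr (1 / b)"
  have Y: "?Y \<noteq> 0" "?Y < top" using False assms by auto
  have "X epowr (1 / a) * ?Y = X"
    using epowr_add[of "1 / a" "1 / b" X] assms by simp
  then have "?Y * X epowr (1 / a) \<le> ?Y * c"
    using X by (simp add: mult.commute)
  then have "X epowr (1 / a) \<le> c"
    using Y by (subst (asm) ennreal_mult_le_mult_iff) auto
  from epowr_mono[OF _ this, of a] show ?thesis
    using assms by (simp add: epowr_inverse_cancel)
qed simp

lemma ennreal_halves: "x / 2 + x / 2 = (x :: ennreal)"
proof -
  have "x / 2 + x / 2 = x * (2 * inverse 2)"
    unfolding mult_2 divide_ennreal_def by (simp add: distrib_left)
  also have "2 * inverse 2 = (1 :: ennreal)" by (rule ennreal_mult_inverse) auto
  finally show ?thesis by simp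
qed

text \<open>
  The weak-type estimate for the maximal function: the maximal members of a laminar family are disjoint
  and have the same union as the family.
\<close>

lemma weak_type:
  assumes "finite S" "laminar S" "S \<subseteq> sets \<mu>" and f: "f \<in> borel_measurable \<mu>"
    and le: "\<And>Q. Q \<in> S \<Longrightarrow> c * emeasure \<mu> Q \<le> (\<integral>\<^sup>+x\<in>Q. f x \<partial>\<mu>)"
  shows "c * emeasure \<mu> (\<Union>S) \<le> (\<integral>\<^sup>+x\<in>\<Union>S. f x \<partial>\<mu>)"
  using assms(1-3) le
proof (induction S rule: finite_psubset_induct)
  case (psubset S)
  show ?case
  proof (cases "S = {}")
    case False
    then obtain Q where Q: "Q \<in> S" "\<And>R. R \<in> S \<Longrightarrow> Q \<subseteq> R \<Longrightarrow> R = Q"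
      using finite_has_maximal[OF psubset(1)] by metis
    define S' where "S' = {R \<in> S. R \<inter> Q = {}}"
    have U: "\<Union>S = Q \<union> \<Union>S'" "Q \<inter> \<Union>S' = {}"
      using Q psubset(3) unfolding S'_def laminar_def by blast+
    have ne: "Q \<notin> S'" if "Q \<noteq> {}" using that by (auto simp: S'_def)
    have meas: "Q \<in> sets \<mu>" "\<Union>S' \<in> sets \<mu>"
      using Q psubset unfolding S'_def by (auto intro!: sets.finite_Union)
    \<comment> \<open>If the empty set is maximal, then it is the only member of \<open>S\<close>; then \<open>S'\<close> is not a smaller family.\<close>
    show ?thesis
    proof (cases "Q = {}")
      case True
      then have "S = {{}}" using Q by blast
      then show ?thesis by simp
    next
      case False
      have "S' \<subset> S" using ne[OF False] Q unfolding S'_def by blast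
      moreover have "laminar S'" "S' \<subseteq> sets \<mu>"
        using psubset(3,4) laminar_subset[of S S'] unfolding S'_def by auto
      ultimately have IH: "c * emeasure \<mu> (\<Union>S') \<le> (\<integral>\<^sup>+x\<in>\<Union>S'. f x \<partial>\<mu>)"
        using psubset.IH psubset.prems(3) by blast
      have "c * emeasure \<mu> (\<Union>S) = c * emeasure \<mu> Q + c * emeasure \<mu> (\<Union>S')"
        unfolding U(1) using U(2) meas by (subst plus_emeasure[symmetric]) (auto simp: distrib_left)
      also have "\<dots> \<le> (\<integral>\<^sup>+x\<in>Q. f x \<partial>\<mu>) + (\<integral>\<^sup>+x\<in>\<Union>S'. f x \<partial>\<mu>)"
        by (intro add_mono IH psubset.prems(3) Q)
      also have "\<dots> = (\<integral>\<^sup>+x\<in>\<Union>S. f x \<partial>\<mu>)"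
        unfolding U(1) using U(2) meas f by (subst nn_integral_disjoint_pair) auto
      finally show ?thesis .
    qed
  qed simp
qed

text \<open>
  A stopping family (principal cubes) for the averages \<open>y\<close> is a subfamily \<open>F\<close>
  of \<open>S\<close> that is \<open>growing\<close> and \<open>controlled\<close>. Requiring growth for
  all nested pairs, not only for parent and child, makes generations and children superfluous.
\<close>

definition growing :: "('a set \<Rightarrow> ennreal) \<Rightarrow> 'a set set \<Rightarrow> bool" where
  "growing y F \<longleftrightarrow> (\<forall>R\<in>F. \<forall>R'\<in>F. R' \<subset> R \<longrightarrow> 2 * y R < y R')"

definition controlled :: "('a set \<Rightarrow> ennreal) \<Rightarrow> 'a set set \<Rightarrow> 'a set set \<Rightarrow> bool" where
  "controlled y S F \<longleftrightarrow> (\<forall>Q\<in>S. \<exists>R\<in>F. Q \<subseteq> R \<and> y Q \<le> 2 * y R)"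

text \<open>
  Add the cubes from large to small, selecting a cube exactly when its average is more than twice that of
  every selected cube around it.
\<close>

lemma exists_stopping_family:
  assumes "finite S"
  obtains F where "F \<subseteq> S" "growing y F" "controlled y S F"
proof -
  have "\<exists>F\<subseteq>S. growing y F \<and> controlled y S F"
    using assms
  proof (induction S rule: finite_psubset_induct)
    case (psubset S)
    show ?case
    proof (cases "S = {}")
      case False
      then obtain Q where Q: "Q \<in> S" "\<And>R. R \<in> S \<Longrightarrow> R \<subseteq> Q \<Longrightarrow> R = Q"
        using finite_has_minimal[OF psubset(1)] by metis
      obtain F where F: "F \<subseteq> S - {Q}" "growing y F" "controlled y (S - {Q}) F"
        using psubset.IH[of "S - {Q}"] Q by blast
      show ?thesis
      proof (cases "\<exists>R\<in>F. Q \<subseteq> R \<and> y Q \<le> 2 * y R")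
        case True
        then have "controlled y S F" using F unfolding controlled_def by blast
        then show ?thesis using F by blast
      next
        case False
        have "y Q \<le> 2 * y Q" by (metis add_increasing2 mult_2 order_refl zero_le)
        then have "controlled y S (insert Q F)" using F unfolding controlled_def by blast
        moreover have "growing y (insert Q F)"
          unfolding growing_def
        proof (intro ballI impI)
          fix R R' assume RR: "R \<in> insert Q F" "R' \<in> insert Q F" "R' \<subset> R"
          then have "R \<noteq> Q" using Q F by blast
          then show "2 * y R < y R'"
            using RR F False unfolding growing_def by (auto simp: not_le)
        qed
        ultimately show ?thesis using F Q by blast
      qed
    qed (auto simp: growing_def controlled_def)
  qed
  then show ?thesis using that by blast
qed

text \<open>
  On the cubes strictly inside \<open>R\<close> the averages exceed twice the average over
  \<open>R\<close>, so by the weak-type estimate they cover at most half of \<open>R\<close>.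
\<close>

lemma stopping_family_sparse:
  assumes F: "cube_family \<mu> F" and g: "growing (avg \<mu> f) F" and f: "f \<in> borel_measurable \<mu>"
  shows "sparse_family \<mu> F"
  unfolding sparse_family_def
proof
  fix R assume R: "R \<in> F"
  let ?H = "{R' \<in> F. R' \<subset> R}" and ?y = "avg \<mu> f R"
  have fin: "0 < emeasure \<mu> R" "emeasure \<mu> R < top" "R \<in> sets \<mu>"
    using cube_familyD[OF F] R by auto
  have grow: "2 * ?y < avg \<mu> f R'" if "R' \<in> ?H" for R'
    using g R that unfolding growing_def by blast
  show "emeasure \<mu> (\<Union>?H) \<le> emeasure \<mu> R / 2"
  proof (cases "?H = {}")
    case False
    have H: "cube_family \<mu> ?H" by (rule cube_family_subset[OF F]) auto
    have "2 * ?y * emeasure \<mu> (\<Union>?H) \<le> (\<integral>\<^sup>+x\<in>\<Union>?H. f x \<partial>\<mu>)"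
    proof (rule weak_type[OF _ _ _ f])
      fix R' assume R': "R' \<in> ?H"
      have "2 * ?y * emeasure \<mu> R' \<le> avg \<mu> f R' * emeasure \<mu> R'"
        using grow[OF R'] by (intro mult_right_mono) auto
      also have "\<dots> = (\<integral>\<^sup>+x\<in>R'. f x \<partial>\<mu>)"
        using cube_familyD[OF H] R' by (intro avg_times_emeasure) auto
      finally show "2 * ?y * emeasure \<mu> R' \<le> (\<integral>\<^sup>+x\<in>R'. f x \<partial>\<mu>)" .
    qed (use cube_familyD[OF H] in auto)
    also have "\<dots> \<le> (\<integral>\<^sup>+x\<in>R. f x \<partial>\<mu>)"
      by (intro nn_integral_mono) (auto simp: indicator_def)
    also have "\<dots> = ?y * emeasure \<mu> R"
      using avg_times_emeasure fin by metis
    finally have le: "?y * (2 * emeasure \<mu> (\<Union>?H)) \<le> ?y * emeasure \<mu> R"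
      by (simp add: ac_simps)
    have y: "?y < top"
    proof (rule ccontr)
      assume "\<not> ?y < top"
      then have "?y = top" using less_top by metis
      then show False using grow False by (auto simp: ennreal_mult_top)
    qed
    \<comment> \<open>The average \<open>?y\<close> cancels unless it vanishes, and then no cube inside \<open>R\<close> has a larger average.\<close>
    have "2 * emeasure \<mu> (\<Union>?H) \<le> emeasure \<mu> R"
    proof (cases "?y = 0")
      case False
      then show ?thesis using le y by (subst (asm) ennreal_mult_le_mult_iff) auto
    next
      case True
      obtain R' where R': "R' \<in> ?H" using False by blast
      have zero: "(\<integral>\<^sup>+x\<in>R. f x \<partial>\<mu>) = 0"
        using avg_times_emeasure[OF fin(1,2), of f] True by simp
      have "(\<integral>\<^sup>+x\<in>R'. f x \<partial>\<mu>) \<le> (\<integral>\<^sup>+x\<in>R. f x \<partial>\<mu>)"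
        using R' by (intro nn_integral_mono) (auto simp: indicator_def)
      then have "avg \<mu> f R' = 0" using zero by (simp add: avg_def)
      then show ?thesis using grow[OF R'] by simp
    qed
    then have "2 * emeasure \<mu> (\<Union>?H) / 2 \<le> emeasure \<mu> R / 2"
      by (intro divide_right_mono_ennreal)
    then show ?thesis
      unfolding mult_2 add_divide_distrib_ennreal ennreal_halves .
  next
    case True
    then show ?thesis by (simp only: Union_empty emeasure_empty zero_le)
  qed
qed

definition geometric_const :: "real \<Rightarrow> real" where
  "geometric_const r = 1 / (1 - 2 powr (- r))"

lemma geometric_const_pos:
  assumes "0 < r" shows "1 < geometric_const r" "1 + geometric_const r * 2 powr (- r) = geometric_const r"
proof -
  have "2 powr (- r) < (1::real)" "0 < (2::real) powr (- r)"
    using assms powr_less_mono[of "-r" 0 "2::real"] by auto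
  then show "1 < geometric_const r" "1 + geometric_const r * 2 powr (- r) = geometric_const r"
    unfolding geometric_const_def by (auto simp: divide_simps)
qed

text \<open>
  Along a chain of nested cubes the values at least double, so a sum of powers is a geometric sum,
  dominated by its largest term.
\<close>

lemma growing_chain_sum:
  assumes "finite H" "growing y H" "\<And>R R'. R \<in> H \<Longrightarrow> R' \<in> H \<Longrightarrow> R \<subseteq> R' \<or> R' \<subseteq> R"
    "\<And>R. R \<in> H \<Longrightarrow> y R \<le> b" and r: "0 < r"
  shows "(\<Sum>R\<in>H. y R epowr r) \<le> ennreal (geometric_const r) * b epowr r"
  using assms(1-4)
proof (induction H arbitrary: b rule: finite_psubset_induct)
  case (psubset H)
  show ?case
  proof (cases "H = {}")
    case False
    then obtain Q where Q: "Q \<in> H" "\<And>R. R \<in> H \<Longrightarrow> R \<subseteq> Q \<Longrightarrow> R = Q"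
      using finite_has_minimal[OF psubset(1)] by metis
    let ?h = "ennreal (1 / 2)"
    have half: "?h * (2 * x) = x" for x :: ennreal
    proof -
      have "?h * 2 = 1" 
        using ennreal_mult[of "1/2" 2] by simp
      then show ?thesis by (metis mult.assoc mult_1)
    qed
    \<comment> \<open>The least cube \<open>Q\<close> carries the largest value, and all other values are at most half of it. So the
      constant \<open>K\<close> of the induction has to satisfy \<open>1 + K 2\<^bsup>-r\<^esup> = K\<close>.\<close>
    have "y R \<le> ?h * b" if "R \<in> H - {Q}" for R
    proof -
      have "Q \<subset> R" using that Q psubset.prems(2)[of Q R] by blast
      then have "2 * y R \<le> b"
        using psubset.prems(1,3) Q(1) that unfolding growing_def by (meson DiffD1 less_le_trans less_imp_le)
      then have "?h * (2 * y R) \<le> ?h * b" by (intro mult_left_mono) auto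
      then show ?thesis unfolding half .
    qed
    moreover have "growing y (H - {Q})" using psubset.prems(1) by (auto simp: growing_def)
    ultimately have "(\<Sum>R\<in>H - {Q}. y R epowr r) \<le> ennreal (geometric_const r) * (?h * b) epowr r"
      using psubset.IH[of "H - {Q}" "?h * b"] Q psubset.prems(2) by blast
    then have "(\<Sum>R\<in>H. y R epowr r) \<le> b epowr r + ennreal (geometric_const r) * (?h * b) epowr r"
      using Q(1) psubset.hyps psubset.prems(3) r
      by (subst sum.remove[of _ Q]) (auto intro!: add_mono epowr_mono)
    also have "(?h * b) epowr r = ennreal (2 powr (- r)) * b epowr r"
    proof -
      have "(1 / 2 :: real) powr r = 2 powr (- r)" by (simp add: powr_minus powr_divide field_simps)
      then show ?thesis
        using epowr_ennreal[OF r, of "1 / 2"] epowr_mult[of r ?h b] r by (metis less_imp_le zero_le_divide_1_iff zero_le_numeral)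
    qed
    also have "b epowr r + ennreal (geometric_const r) * (ennreal (2 powr (- r)) * b epowr r)
        = (1 + ennreal (geometric_const r * 2 powr (- r))) * b epowr r"
      using geometric_const_pos[OF r] by (simp add: distrib_right ennreal_mult mult.assoc)
    also have "1 + ennreal (geometric_const r * 2 powr (- r)) = ennreal (geometric_const r)"
      using geometric_const_pos[OF r] by (subst (2) geometric_const_pos(2)[OF r, symmetric], subst ennreal_plus) auto
    finally show ?thesis .
  qed simp
qed


text \<open>
  Linearise: with \<open>X\<close> the left-hand side, \<open>X = \<integral> f h d\<mu>\<close> for
  \<open>h = \<Sum>\<^sub>R y\<^sub>R\<^bsup>p-1\<^esup> 1\<^sub>R\<close>. At each point
  \<open>h\<close> is a geometric sum, so \<open>h\<^bsup>p'\<^esup>\<close> is controlled by its largest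
  term \<open>y\<^sub>R\<^sup>p\<close> and \<open>\<parallel>h\<parallel>\<^bsub>p'\<^esub>\<close> is
  again a power of \<open>X\<close>, which Hoelder's inequality and absorption then estimate. The maximal
  inequality is a consequence and not a prerequisite.
\<close>

lemma carleson_growing:
  assumes F: "cube_family \<mu> F" and g: "growing (avg \<mu> f) F"
    and f [measurable]: "f \<in> borel_measurable \<mu>" and p: "1 < p"
  shows "(\<Sum>R\<in>F. avg \<mu> f R epowr p * emeasure \<mu> R)
    \<le> ennreal (geometric_const (p - 1) powr p) * (\<integral>\<^sup>+x. f x epowr p \<partial>\<mu>)"
proof -
  let ?I = "\<integral>\<^sup>+x. f x epowr p \<partial>\<mu>" and ?y = "avg \<mu> f"
  define X where "X = (\<Sum>R\<in>F. ?y R epowr p * emeasure \<mu> R)"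
  define K where "K = geometric_const (p - 1)"
  define p' where "p' = p / (p - 1)"
  have pp: "0 < p" "0 < p'" "1 / p + 1 / p' = 1" "(p - 1) * p' = p"
    using p by (auto simp: p'_def field_simps)
  have K: "1 < K" using geometric_const_pos[of "p - 1"] p by (simp add: K_def)
  note Fs [measurable] = cube_familyD(3)[OF F]
  have "X \<le> ennreal (K powr p) * ?I"
  proof (cases "?I < top")
    case False
    then have "?I = top" using less_top by metis
    then show ?thesis using K by (simp add: ennreal_mult_top)
  next
    case True
    have int: "?y R * emeasure \<mu> R = (\<integral>\<^sup>+x\<in>R. f x \<partial>\<mu>)" if "R \<in> F" for R
      using cube_familyD[OF F] that by (intro avg_times_emeasure) auto
    have y: "?y R < top" if R: "R \<in> F" for R
    proof -
      have "(\<integral>\<^sup>+x\<in>R. f x epowr p \<partial>\<mu>) \<le> ?I"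
        by (intro nn_integral_mono) (auto simp: indicator_def)
      then have "(\<integral>\<^sup>+x\<in>R. f x epowr p \<partial>\<mu>) < top"
        using True by (rule le_less_trans)
      then have "(\<integral>\<^sup>+x\<in>R. f x epowr p \<partial>\<mu>) epowr (1 / p) * emeasure \<mu> R epowr (1 / p') < top"
        using pp cube_familyD(5)[OF F R] by (auto simp: ennreal_mult_less_top)
      with set_Holder[OF f Fs[OF R] pp(1-3)] have "(\<integral>\<^sup>+x\<in>R. f x \<partial>\<mu>) < top"
        by (rule le_less_trans)
      then show ?thesis
        using cube_familyD(4)[OF F R] by (auto simp: avg_def ennreal_divide_eq_top_iff less_top[symmetric])
    qed
    have X: "X < top"
      unfolding X_def using y cube_familyD[OF F] pp by (auto simp: ennreal_mult_less_top)
    define h where "h x = (\<Sum>R\<in>F. ?y R epowr (p - 1) * indicator R x)" for x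
    have [measurable]: "h \<in> borel_measurable \<mu>"
      unfolding h_def by measurable
    have hX: "(\<integral>\<^sup>+x. h x epowr p' \<partial>\<mu>) \<le> ennreal K epowr p' * X"
    proof -
      have "h x epowr p' \<le> ennreal K epowr p' * (\<Sum>R\<in>F. ?y R epowr p * indicator R x)" for x
      proof -
        define H where "H = {R \<in> F. x \<in> R}"
        have H: "finite H" "H \<subseteq> F" using cube_familyD(1)[OF F] by (auto simp: H_def)
        have hH: "h x = (\<Sum>R\<in>H. ?y R epowr (p - 1))"
          unfolding h_def H_def using cube_familyD(1)[OF F]
          by (intro sum.mono_neutral_cong_right) auto
        show ?thesis
        proof (cases "H = {}")
          case True
          then show ?thesis using hH pp by simp
        next
          case False
          define b where "b = Max (?y ` H)"
          have "b \<in> ?y ` H" unfolding b_def using H False by (intro Max_in) auto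
          then obtain R where R: "R \<in> H" "b = ?y R" by blast
          have "h x \<le> ennreal K * b epowr (p - 1)"
            unfolding hH K_def
          proof (rule growing_chain_sum)
            show "growing ?y H" using g H by (auto simp: growing_def)
            show "\<And>R R'. R \<in> H \<Longrightarrow> R' \<in> H \<Longrightarrow> R \<subseteq> R' \<or> R' \<subseteq> R"
              using laminarD[OF cube_familyD(2)[OF F]] by (auto simp: H_def)
          qed (use H p in \<open>auto simp: b_def\<close>)
          then have "h x epowr p' \<le> (ennreal K * b epowr (p - 1)) epowr p'"
            using pp by (intro epowr_mono) auto
          also have "\<dots> = ennreal K epowr p' * ?y R epowr p"
            using p pp R by (simp add: epowr_mult epowr_epowr)
          also have "\<dots> \<le> ennreal K epowr p' * (\<Sum>R\<in>F. ?y R epowr p * indicator R x)"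
          proof (intro mult_left_mono)
            have "?y R epowr p = ?y R epowr p * indicator R x"
              using R by (simp add: H_def)
            also have "\<dots> \<le> (\<Sum>R\<in>F. ?y R epowr p * indicator R x)"
              using R H cube_familyD(1)[OF F] by (intro member_le_sum) auto
            finally show "?y R epowr p \<le> (\<Sum>R\<in>F. ?y R epowr p * indicator R x)" .
          qed simp
          finally show ?thesis .
        qed
      qed
      then have "(\<integral>\<^sup>+x. h x epowr p' \<partial>\<mu>)
          \<le> (\<integral>\<^sup>+x. ennreal K epowr p' * (\<Sum>R\<in>F. ?y R epowr p * indicator R x) \<partial>\<mu>)"
        by (intro nn_integral_mono)
      also have "\<dots> = ennreal K epowr p' * (\<Sum>R\<in>F. \<integral>\<^sup>+x. ?y R epowr p * indicator R x \<partial>\<mu>)"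
        by (subst nn_integral_cmult, measurable, subst nn_integral_sum, measurable)
      also have "\<dots> = ennreal K epowr p' * X"
        unfolding X_def using Fs by (simp add: nn_integral_cmult_indicator)
      finally show ?thesis .
    qed
    have "X = (\<Sum>R\<in>F. ?y R epowr (p - 1) * (\<integral>\<^sup>+x\<in>R. f x \<partial>\<mu>))"
      unfolding X_def
    proof (intro sum.cong refl)
      fix R assume R: "R \<in> F"
      have "?y R epowr p = ?y R epowr (p - 1) * ?y R"
        using epowr_add[of "p - 1" 1 "?y R"] p by simp
      then show "?y R epowr p * emeasure \<mu> R = ?y R epowr (p - 1) * (\<integral>\<^sup>+x\<in>R. f x \<partial>\<mu>)"
        using int[OF R] by (simp add: mult.assoc)
    qed
    also have "\<dots> = (\<Sum>R\<in>F. \<integral>\<^sup>+x. ?y R epowr (p - 1) * (f x * indicator R x) \<partial>\<mu>)"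
      by (intro sum.cong refl nn_integral_cmult[symmetric]) measurable
    also have "\<dots> = (\<integral>\<^sup>+x. (\<Sum>R\<in>F. ?y R epowr (p - 1) * (f x * indicator R x)) \<partial>\<mu>)"
      by (intro nn_integral_sum[symmetric]) measurable
    also have "\<dots> = (\<integral>\<^sup>+x. f x * h x \<partial>\<mu>)"
      unfolding h_def by (simp add: sum_distrib_left ac_simps)
    also have "\<dots> \<le> ?I epowr (1 / p) * (\<integral>\<^sup>+x. h x epowr p' \<partial>\<mu>) epowr (1 / p')"
      by (intro Holder_nn_integral pp) measurable
    also have "\<dots> \<le> ?I epowr (1 / p) * (ennreal K epowr p' * X) epowr (1 / p')"
      using pp by (intro mult_left_mono epowr_mono hX) auto
    also have "(ennreal K epowr p' * X) epowr (1 / p') = ennreal K * X epowr (1 / p')"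
      using pp by (simp add: epowr_mult epowr_inverse_cancel)
    finally have "X \<le> (?I epowr (1 / p) * ennreal K) * X epowr (1 / p')"
      by (simp add: mult.assoc)
    then have "X \<le> (?I epowr (1 / p) * ennreal K) epowr p"
      by (rule epowr_absorb[OF pp(1-3) X])
    also have "\<dots> = ennreal (K powr p) * ?I"
      using pp K by (simp add: epowr_mult epowr_inverse_cancel epowr_ennreal mult.commute)
    finally show ?thesis .
  qed
  then show ?thesis by (simp add: X_def K_def)
qed

definition maximal_function :: "'a measure \<Rightarrow> 'a set set \<Rightarrow> ('a \<Rightarrow> ennreal) \<Rightarrow> 'a \<Rightarrow> ennreal" where
  "maximal_function \<mu> S f x = (SUP Q\<in>S. avg \<mu> f Q * indicator Q x)"

definition maximal_const :: "real \<Rightarrow> real" where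
  "maximal_const p = (2 * geometric_const (p - 1)) powr p"

lemma maximal_const_pos: "1 < p \<Longrightarrow> 0 < maximal_const p"
  using geometric_const_pos[of "p - 1"] by (simp add: maximal_const_def)

lemma maximal_function_measurable [measurable]:
  assumes "cube_family \<mu> S" shows "maximal_function \<mu> S f \<in> borel_measurable \<mu>"
  unfolding maximal_function_def
  using cube_familyD[OF assms] by (intro borel_measurable_SUP countable_finite) auto

lemma maximal_function_ge: "Q \<in> S \<Longrightarrow> x \<in> Q \<Longrightarrow> avg \<mu> f Q \<le> maximal_function \<mu> S f x"
  unfolding maximal_function_def by (rule SUP_upper2) auto

text \<open>
  At each point the maximal function is at most twice the average over some cube of the stopping family,
  so Carleson embedding for that family bounds its norm.
\<close>

lemma maximal_inequality:
  assumes S: "cube_family \<mu> S" and f: "f \<in> borel_measurable \<mu>" and p: "1 < p"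
  shows "(\<integral>\<^sup>+x. maximal_function \<mu> S f x epowr p \<partial>\<mu>)
    \<le> ennreal (maximal_const p) * (\<integral>\<^sup>+x. f x epowr p \<partial>\<mu>)"
proof -
  let ?y = "avg \<mu> f"
  obtain F where F: "F \<subseteq> S" "growing ?y F" "controlled ?y S F"
    using exists_stopping_family cube_familyD(1)[OF S] by blast
  note FF = cube_family_subset[OF S F(1)]
  note Fs [measurable] = cube_familyD(3)[OF FF]
  let ?c = "ennreal (2 powr p)"
  have pt: "maximal_function \<mu> S f x epowr p \<le> ?c * (\<Sum>R\<in>F. ?y R epowr p * indicator R x)" for x
  proof (rule epowr_le_cancel)
    show "maximal_function \<mu> S f x \<le> (?c * (\<Sum>R\<in>F. ?y R epowr p * indicator R x)) epowr (1 / p)"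
      unfolding maximal_function_def
    proof (rule SUP_least)
      fix Q assume Q: "Q \<in> S"
      show "?y Q * indicator Q x \<le> (?c * (\<Sum>R\<in>F. ?y R epowr p * indicator R x)) epowr (1 / p)"
      proof (cases "x \<in> Q")
        case True
        obtain R where R: "R \<in> F" "Q \<subseteq> R" "?y Q \<le> 2 * ?y R"
          using F(3) Q unfolding controlled_def by blast
        have "?y Q epowr p \<le> (2 * ?y R) epowr p" using R p by (intro epowr_mono) auto
        also have "\<dots> = ?c * (?y R epowr p * indicator R x)"
          using p True R epowr_ennreal[of p 2] by (auto simp: epowr_mult)
        also have "\<dots> \<le> ?c * (\<Sum>R\<in>F. ?y R epowr p * indicator R x)"
          using R cube_familyD(1)[OF FF] by (intro mult_left_mono member_le_sum) auto
        finally have "(?y Q epowr p) epowr (1 / p) \<le> (?c * (\<Sum>R\<in>F. ?y R epowr p * indicator R x)) epowr (1 / p)"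
          using p by (intro epowr_mono) auto
        then show ?thesis using True p by (simp add: epowr_inverse_cancel)
      qed simp
    qed
  qed (use p in simp)
  have "(\<integral>\<^sup>+x. maximal_function \<mu> S f x epowr p \<partial>\<mu>)
      \<le> (\<integral>\<^sup>+x. ?c * (\<Sum>R\<in>F. ?y R epowr p * indicator R x) \<partial>\<mu>)"
    by (intro nn_integral_mono pt)
  also have "\<dots> = ?c * (\<Sum>R\<in>F. \<integral>\<^sup>+x. ?y R epowr p * indicator R x \<partial>\<mu>)"
    by (subst nn_integral_cmult, measurable, subst nn_integral_sum, measurable)
  also have "\<dots> = ?c * (\<Sum>R\<in>F. ?y R epowr p * emeasure \<mu> R)"
    using Fs by (simp add: nn_integral_cmult_indicator)
  also have "\<dots> \<le> ?c * (ennreal (geometric_const (p - 1) powr p) * (\<integral>\<^sup>+x. f x epowr p \<partial>\<mu>))"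
    by (intro mult_left_mono carleson_growing FF F f p) simp
  also have "\<dots> = ennreal (maximal_const p) * (\<integral>\<^sup>+x. f x epowr p \<partial>\<mu>)"
    using geometric_const_pos[of "p - 1"] p
    by (simp add: maximal_const_def powr_mult ennreal_mult mult.assoc)
  finally show ?thesis .
qed

text \<open>
  Sparseness provides disjoint subsets \<open>E R\<close> of the cubes, each carrying half of the mass;
  on \<open>E R\<close> the average over \<open>R\<close> is at most the maximal function.
\<close>

lemma carleson_sparse:
  assumes F: "cube_family \<mu> F" and sp: "sparse_family \<mu> F"
    and f: "f \<in> borel_measurable \<mu>" and p: "1 < p"
  shows "(\<Sum>R\<in>F. avg \<mu> f R epowr p * emeasure \<mu> R)
    \<le> ennreal (2 * maximal_const p) * (\<integral>\<^sup>+x. f x epowr p \<partial>\<mu>)"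
proof -
  let ?y = "avg \<mu> f"
  define E where "E R = R - \<Union>{R' \<in> F. R' \<subset> R}" for R
  note Fs [measurable] = cube_familyD(3)[OF F]
  have [measurable]: "\<Union>{R' \<in> F. R' \<subset> R} \<in> sets \<mu>" for R
    using cube_familyD(1)[OF F] Fs by (intro sets.finite_Union) auto
  have Es [measurable]: "R \<in> F \<Longrightarrow> E R \<in> sets \<mu>" for R
    unfolding E_def by measurable
  have half: "emeasure \<mu> R \<le> 2 * emeasure \<mu> (E R)" if R: "R \<in> F" for R
  proof -
    let ?u = "emeasure \<mu> (\<Union>{R' \<in> F. R' \<subset> R})" and ?r = "emeasure \<mu> R"
    have "?r \<le> emeasure \<mu> (E R \<union> \<Union>{R' \<in> F. R' \<subset> R})"
      using R by (intro emeasure_mono) (auto simp: E_def)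
    also have "\<dots> \<le> emeasure \<mu> (E R) + ?u"
      using R by (intro emeasure_subadditive) measurable
    finally have 1: "?r \<le> emeasure \<mu> (E R) + ?u" .
    have 2: "?u \<le> ?r / 2" using sp R unfolding sparse_family_def by blast
    have 3: "?r / 2 + ?r / 2 = ?r" by (rule ennreal_halves)
    have "?r + ?r \<le> (emeasure \<mu> (E R) + ?u) + (emeasure \<mu> (E R) + ?u)"
      by (intro add_mono 1)
    also have "\<dots> \<le> (emeasure \<mu> (E R) + ?r / 2) + (emeasure \<mu> (E R) + ?r / 2)"
      by (intro add_mono 2 order_refl)
    also have "\<dots> = 2 * emeasure \<mu> (E R) + ?r"
      using 3 by (simp add: mult_2 ac_simps)
    finally show ?thesis
      using cube_familyD(5)[OF F R] by (auto simp: add.commute ennreal_add_left_cancel_le)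
  qed
  have pt: "(\<Sum>R\<in>F. ?y R epowr p * indicator (E R) x) \<le> maximal_function \<mu> F f x epowr p" for x
  proof (cases "\<exists>R\<in>F. x \<in> E R")
    case True
    then obtain R where R: "R \<in> F" "x \<in> E R" by blast
    have "(\<Sum>R\<in>F. ?y R epowr p * indicator (E R) x) = (\<Sum>R'\<in>{R}. ?y R' epowr p * indicator (E R') x)"
    proof (rule sum.mono_neutral_right)
      show "\<forall>R'\<in>F - {R}. ?y R' epowr p * indicator (E R') x = 0"
      proof
        fix R' assume R': "R' \<in> F - {R}"
        have "x \<notin> E R'"
          using R R' laminarD[OF cube_familyD(2)[OF F], of R R' x] unfolding E_def by blast
        then show "?y R' epowr p * indicator (E R') x = 0" by simp
      qed
    qed (use R cube_familyD(1)[OF F] in auto)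
    also have "\<dots> \<le> maximal_function \<mu> F f x epowr p"
      using R p by (auto simp: E_def intro!: epowr_mono maximal_function_ge)
    finally show ?thesis .
  next
    case False
    then have "(\<Sum>R\<in>F. ?y R epowr p * indicator (E R) x) = 0"
      by (intro sum.neutral) auto
    then show ?thesis by simp
  qed
  have "(\<Sum>R\<in>F. ?y R epowr p * emeasure \<mu> R) \<le> (\<Sum>R\<in>F. ?y R epowr p * (2 * emeasure \<mu> (E R)))"
    by (intro sum_mono mult_left_mono half) auto
  also have "\<dots> = 2 * (\<Sum>R\<in>F. \<integral>\<^sup>+x. ?y R epowr p * indicator (E R) x \<partial>\<mu>)"
    unfolding sum_distrib_left
    by (intro sum.cong refl, subst nn_integral_cmult_indicator[OF Es]) (simp_all only: ac_simps)
  also have "\<dots> = 2 * (\<integral>\<^sup>+x. (\<Sum>R\<in>F. ?y R epowr p * indicator (E R) x) \<partial>\<mu>)"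
    by (subst nn_integral_sum, measurable)
  also have "\<dots> \<le> 2 * (\<integral>\<^sup>+x. maximal_function \<mu> F f x epowr p \<partial>\<mu>)"
    by (intro mult_left_mono nn_integral_mono pt) simp
  also have "\<dots> \<le> 2 * (ennreal (maximal_const p) * (\<integral>\<^sup>+x. f x epowr p \<partial>\<mu>))"
    by (intro mult_left_mono maximal_inequality F f p) simp
  also have "\<dots> = ennreal (2 * maximal_const p) * (\<integral>\<^sup>+x. f x epowr p \<partial>\<mu>)"
    using maximal_const_pos[OF p] by (simp add: ennreal_mult mult.assoc)
  finally show ?thesis .
qed

lemma nn_integral_sum_cubes_finite:
  assumes F: "cube_family \<mu> F" and c: "\<And>R. R \<in> F \<Longrightarrow> c R < top" and pos: "0 < p"
  shows "(\<integral>\<^sup>+x. (\<Sum>R\<in>F. c R * indicator R x) epowr p \<partial>\<mu>) < top"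
proof -
  note Fs [measurable] = cube_familyD(3)[OF F]
  let ?\<phi> = "\<lambda>x. \<Sum>R\<in>F. c R * indicator R x" and ?C = "\<Sum>R\<in>F. c R"
  have "(\<integral>\<^sup>+x. ?\<phi> x epowr p \<partial>\<mu>) \<le> (\<integral>\<^sup>+x. ?C epowr p * indicator (\<Union>F) x \<partial>\<mu>)"
  proof (intro nn_integral_mono)
    fix x
    show "?\<phi> x epowr p \<le> ?C epowr p * indicator (\<Union>F) x"
    proof (cases "x \<in> \<Union>F")
      case True
      have "?\<phi> x \<le> ?C" by (intro sum_mono) (auto simp: indicator_def)
      then show ?thesis using True pos by (simp add: epowr_mono)
    next
      case False
      then have "?\<phi> x = 0" by (intro sum.neutral) auto
      then show ?thesis using pos by simp
    qed
  qed
  also have "\<dots> = ?C epowr p * emeasure \<mu> (\<Union>F)"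
    using cube_familyD[OF F] by (intro nn_integral_cmult_indicator sets.finite_Union) auto
  also have "\<dots> < top"
  proof -
    have "emeasure \<mu> (\<Union>F) \<le> (\<Sum>R\<in>F. emeasure \<mu> R)"
      using emeasure_subadditive_finite[of F "\<lambda>R. R" \<mu>] cube_familyD(1)[OF F] Fs
      by (simp add: image_subset_iff subset_iff)
    also have "\<dots> < top" using cube_familyD[OF F] by auto
    finally have "emeasure \<mu> (\<Union>F) < top" .
    moreover have "?C < top" using c cube_familyD(1)[OF F] by simp
    ultimately show ?thesis using pos by (simp add: ennreal_mult_less_top)
  qed
  finally show ?thesis .
qed

text \<open>
  Dual to Carleson embedding. With \<open>\<phi>\<close> the sum in question, \<open>\<integral>
  \<phi>\<^sup>p d\<mu> = \<Sum>\<^sub>R c\<^sub>R \<integral>\<^sub>R \<phi>\<^bsup>p-1\<^esup>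
  d\<mu>\<close>; Hoelder's inequality and the embedding in \<open>L\<^bsup>p'\<^esup>\<close> for
  \<open>\<phi>\<^bsup>p-1\<^esup>\<close> lead back to a power of \<open>\<integral> \<phi>\<^sup>p
  d\<mu>\<close>, which is absorbed.
\<close>

lemma sparse_sum_norm:
  assumes F: "cube_family \<mu> F" and sp: "sparse_family \<mu> F"
    and c: "\<And>R. R \<in> F \<Longrightarrow> c R < top"
    and pp: "1 < p" "1 < p'" "1 / p + 1 / p' = 1"
  shows "(\<integral>\<^sup>+x. (\<Sum>R\<in>F. c R * indicator R x) epowr p \<partial>\<mu>)
    \<le> ennreal ((2 * maximal_const p') powr (p / p')) * (\<Sum>R\<in>F. c R epowr p * emeasure \<mu> R)"
proof -
  note Fs [measurable] = cube_familyD(3)[OF F]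
  define \<phi> where "\<phi> x = (\<Sum>R\<in>F. c R * indicator R x)" for x
  define h where "h x = \<phi> x epowr (p - 1)" for x
  have m [measurable]: "\<phi> \<in> borel_measurable \<mu>" "h \<in> borel_measurable \<mu>"
    unfolding \<phi>_def h_def by measurable
  let ?Y = "\<Sum>R\<in>F. c R epowr p * emeasure \<mu> R"
  define X where "X = (\<integral>\<^sup>+x. \<phi> x epowr p \<partial>\<mu>)"
  have pos: "0 < p" "0 < p'" "0 \<le> p - 1" using pp by auto
  have p1: "(p - 1) * p' = p" using pp by (simp add: field_simps)
  have int: "avg \<mu> h R * emeasure \<mu> R = (\<integral>\<^sup>+x\<in>R. h x \<partial>\<mu>)" if "R \<in> F" for R
    using cube_familyD[OF F] that by (intro avg_times_emeasure) auto
  have X: "X < top"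
    unfolding X_def \<phi>_def by (rule nn_integral_sum_cubes_finite[OF F c pos(1)])
  have "X = (\<integral>\<^sup>+x. (\<Sum>R\<in>F. c R * (h x * indicator R x)) \<partial>\<mu>)"
    unfolding X_def
  proof (intro nn_integral_cong)
    fix x
    have "\<phi> x epowr p = \<phi> x * h x"
      using epowr_add[of 1 "p - 1" "\<phi> x"] pos by (simp add: h_def)
    then show "\<phi> x epowr p = (\<Sum>R\<in>F. c R * (h x * indicator R x))"
      by (simp add: \<phi>_def sum_distrib_left ac_simps)
  qed
  also have "\<dots> = (\<Sum>R\<in>F. \<integral>\<^sup>+x. c R * (h x * indicator R x) \<partial>\<mu>)"
    by (intro nn_integral_sum) measurable
  also have "\<dots> = (\<Sum>R\<in>F. c R * (\<integral>\<^sup>+x\<in>R. h x \<partial>\<mu>))"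
    by (intro sum.cong refl nn_integral_cmult) measurable
  also have "\<dots> = (\<Sum>R\<in>F. (c R * emeasure \<mu> R epowr (1 / p)) * (avg \<mu> h R * emeasure \<mu> R epowr (1 / p')))"
  proof (intro sum.cong refl)
    fix R assume R: "R \<in> F"
    have "emeasure \<mu> R epowr (1 / p) * emeasure \<mu> R epowr (1 / p') = emeasure \<mu> R"
      using epowr_add[of "1 / p" "1 / p'" "emeasure \<mu> R"] pp pos by simp
    then show "c R * (\<integral>\<^sup>+x\<in>R. h x \<partial>\<mu>)
        = (c R * emeasure \<mu> R epowr (1 / p)) * (avg \<mu> h R * emeasure \<mu> R epowr (1 / p'))"
      using int[OF R] by (metis (no_types, lifting) mult.assoc mult.commute)
  qed
  also have "\<dots> \<le> (\<Sum>R\<in>F. (c R * emeasure \<mu> R epowr (1 / p)) epowr p) epowr (1 / p)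
      * (\<Sum>R\<in>F. (avg \<mu> h R * emeasure \<mu> R epowr (1 / p')) epowr p') epowr (1 / p')"
    by (intro Holder_sum cube_familyD(1)[OF F] pos pp)
  also have "\<dots> = ?Y epowr (1 / p) * (\<Sum>R\<in>F. avg \<mu> h R epowr p' * emeasure \<mu> R) epowr (1 / p')"
    using pos by (simp add: epowr_mult epowr_inverse_cancel)
  also have "\<dots> \<le> ?Y epowr (1 / p) * (ennreal (2 * maximal_const p') * (\<integral>\<^sup>+x. h x epowr p' \<partial>\<mu>)) epowr (1 / p')"
    using pos by (intro mult_left_mono epowr_mono carleson_sparse F sp m pp) auto
  also have "(\<integral>\<^sup>+x. h x epowr p' \<partial>\<mu>) = X"
    using pos p1 by (simp add: X_def h_def epowr_epowr)
  finally have "X \<le> (?Y epowr (1 / p) * ennreal (2 * maximal_const p') epowr (1 / p')) * X epowr (1 / p')"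
    using pos by (simp add: epowr_mult mult.assoc)
  then have "X \<le> (?Y epowr (1 / p) * ennreal (2 * maximal_const p') epowr (1 / p')) epowr p"
    using pos pp X by (intro epowr_absorb) auto
  also have "\<dots> = ennreal ((2 * maximal_const p') powr (p / p')) * ?Y"
    using pos maximal_const_pos[OF pp(2)]
    by (simp add: epowr_mult epowr_epowr epowr_ennreal powr_powr mult.commute)
  finally show ?thesis by (simp add: X_def \<phi>_def)
qed

section \<open>Testing conditions are sufficient: finite families\<close>

lemma integrability_exponent_cases:
  assumes "0 < p" "0 < q" "inverse s = ennreal (max (1 / q - 1 / p) 0)"
  obtains "p \<le> q" "s = top" | r where "q < p" "s = ennreal r" "0 < r" "1 / r = 1 / q - 1 / p"
proof (cases "p \<le> q")
  case True
  then have "1 / q \<le> 1 / p" using assms by (simp add: frac_le)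
  then have "inverse s = 0" using assms(3) by (simp add: max_def)
  then show ?thesis using that(1) True by (simp add: ennreal_inverse_eq_0_iff)
next
  case False
  then have d: "0 < 1 / q - 1 / p" using assms by (simp add: field_simps)
  have "s = inverse (inverse s)"
    using divide_ennreal_def one_divide_one_divide_ennreal by auto
  also have "\<dots> = ennreal (1 / (1 / q - 1 / p))"
    using d assms(3) by (simp add: inverse_ennreal max_def inverse_eq_divide)
  finally show ?thesis using that(2)[of "1 / (1 / q - 1 / p)"] d False by simp
qed

text \<open>
  Hoelder's inequality with \<open>1/q = 1/p + 1/s\<close> if \<open>q < p\<close>; otherwise \<open>s =
  \<infinity>\<close>, and the inclusion of \<open>\<ell>\<^sup>p\<close> into
  \<open>\<ell>\<^sup>q\<close> replaces it.
\<close>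

lemma ell_norm_Holder:
  assumes I: "finite I" and pq: "0 < p" "0 < q" and s: "inverse s = ennreal (max (1 / q - 1 / p) 0)"
  shows "(\<Sum>i\<in>I. (x i * A i) epowr q) epowr (1 / q) \<le> (\<Sum>i\<in>I. x i epowr p) epowr (1 / p) * ell_norm s I A"
  using pq s
proof (cases rule: integrability_exponent_cases)
  case 1
  let ?a = "SUP i\<in>I. A i"
  have "(\<Sum>i\<in>I. (x i * A i) epowr q) \<le> (\<Sum>i\<in>I. ?a epowr q * (x i epowr p) epowr (q / p))"
  proof (rule sum_mono)
    fix i assume "i \<in> I"
    then have "(x i * A i) epowr q \<le> (?a * x i) epowr q"
      using pq by (subst mult.commute, intro epowr_mono mult_right_mono SUP_upper) auto
    then show "(x i * A i) epowr q \<le> ?a epowr q * (x i epowr p) epowr (q / p)"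
      using pq by (simp add: epowr_mult epowr_epowr)
  qed
  also have "\<dots> \<le> ?a epowr q * (\<Sum>i\<in>I. x i epowr p) epowr (q / p)"
    using pq 1 I unfolding sum_distrib_left[symmetric]
    by (intro mult_left_mono sum_epowr_le) auto
  finally have "(\<Sum>i\<in>I. (x i * A i) epowr q) epowr (1 / q)
      \<le> (?a epowr q * (\<Sum>i\<in>I. x i epowr p) epowr (q / p)) epowr (1 / q)"
    using pq by (intro epowr_mono) auto
  also have "\<dots> = (\<Sum>i\<in>I. x i epowr p) epowr (1 / p) * ?a"
    using pq by (simp add: epowr_mult epowr_epowr mult.commute)
  finally show ?thesis using 1 by (simp add: ell_norm_def)
next
  case (2 r)
  have sum1: "1 / (p / q) + 1 / (r / q) = 1"
  proof -
    have "1 / (p / q) + 1 / (r / q) = q * (1 / p + 1 / r)" by (simp add: field_simps)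
    also have "\<dots> = 1" using 2 pq by simp
    finally show ?thesis .
  qed
  have "(\<Sum>i\<in>I. (x i * A i) epowr q) = (\<Sum>i\<in>I. x i epowr q * A i epowr q)"
    using pq by (simp add: epowr_mult)
  also have "\<dots> \<le> (\<Sum>i\<in>I. (x i epowr q) epowr (p / q)) epowr (1 / (p / q))
       * (\<Sum>i\<in>I. (A i epowr q) epowr (r / q)) epowr (1 / (r / q))"
    using pq 2 sum1 by (intro Holder_sum I) auto
  also have "\<dots> = (\<Sum>i\<in>I. x i epowr p) epowr (q / p) * (\<Sum>i\<in>I. A i epowr r) epowr (q / r)"
    using pq 2 by (simp add: epowr_epowr)
  finally have "(\<Sum>i\<in>I. (x i * A i) epowr q) epowr (1 / q)
      \<le> ((\<Sum>i\<in>I. x i epowr p) epowr (q / p) * (\<Sum>i\<in>I. A i epowr r) epowr (q / r)) epowr (1 / q)"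
    using pq by (intro epowr_mono) auto
  also have "\<dots> = (\<Sum>i\<in>I. x i epowr p) epowr (1 / p) * (\<Sum>i\<in>I. A i epowr r) epowr (1 / r)"
    using pq 2 by (simp add: epowr_mult epowr_epowr)
  finally show ?thesis
    using 2 I by (simp add: ell_norm_def Lp_norm_def nn_integral_count_space_finite)
qed

text \<open>
  The operator \<open>T\<^sub>F(u)\<close> with \<open>\<mu> = u dx\<close> and \<open>a Q =
  \<tau>\<^sub>Q / |Q|\<close>. In these coefficients neither weight is preferred, so the dual testing
  constant is obtained by exchanging the measures.
\<close>

definition local_op :: "'a measure \<Rightarrow> 'a set set \<Rightarrow> ('a set \<Rightarrow> ennreal) \<Rightarrow> 'a set \<Rightarrow> 'a \<Rightarrow> ennreal" where
  "local_op \<mu> S a F x = (\<integral>\<^sup>+Q. a Q * emeasure \<mu> Q * indicator Q x \<partial>count_space {Q \<in> S. Q \<subseteq> F})"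

definition testing ::
  "'a measure \<Rightarrow> 'a measure \<Rightarrow> 'a set set \<Rightarrow> ('a set \<Rightarrow> ennreal) \<Rightarrow> ennreal \<Rightarrow> real \<Rightarrow> real \<Rightarrow> ennreal" where
  "testing \<mu> \<nu> S a s p q = (SUP F\<in>{F. F \<subseteq> S \<and> sparse_family \<mu> F}.
     ell_norm s F (\<lambda>R. Lp_norm \<nu> q (local_op \<mu> S a R) / emeasure \<mu> R epowr (1 / p)))"

lemma local_op_finite:
  "finite S \<Longrightarrow> local_op \<mu> S a F x = (\<Sum>Q\<in>{Q \<in> S. Q \<subseteq> F}. a Q * emeasure \<mu> Q * indicator Q x)"
  unfolding local_op_def by (rule nn_integral_count_space_finite) simp

text \<open>
  The selected cubes around a given cube form a chain. By growth the least of them has the largest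
  average, so it inherits the control provided by any other.
\<close>

lemma least_stopping_cube:
  assumes S: "cube_family \<mu> S" and F: "F \<subseteq> S" "growing y F" "controlled y S F"
  obtains \<phi> where "\<And>Q. Q \<in> S \<Longrightarrow> \<phi> Q \<in> F" "\<And>Q. Q \<in> S \<Longrightarrow> Q \<subseteq> \<phi> Q"
    "\<And>Q R. Q \<in> S \<Longrightarrow> R \<in> F \<Longrightarrow> Q \<subseteq> R \<Longrightarrow> \<phi> Q \<subseteq> R" "\<And>Q. Q \<in> S \<Longrightarrow> y Q \<le> 2 * y (\<phi> Q)"
proof -
  have "\<exists>P. P \<in> F \<and> Q \<subseteq> P \<and> (\<forall>R\<in>F. Q \<subseteq> R \<longrightarrow> P \<subseteq> R) \<and> y Q \<le> 2 * y P" if Q: "Q \<in> S" for Q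
  proof -
    obtain R where R: "R \<in> F" "Q \<subseteq> R" "y Q \<le> 2 * y R"
      using F Q unfolding controlled_def by blast
    let ?H = "{R \<in> F. Q \<subseteq> R}"
    have "finite ?H" "?H \<noteq> {}"
      using cube_familyD(1)[OF S] F(1) R finite_subset[of F S] by auto
    then obtain P where P: "P \<in> ?H" "\<And>R. R \<in> ?H \<Longrightarrow> R \<subseteq> P \<Longrightarrow> R = P"
      using finite_has_minimal[of ?H] by metis
    obtain x where x: "x \<in> Q" using cube_familyD(6)[OF S Q] by blast
    have least: "P \<subseteq> R'" if "R' \<in> F" "Q \<subseteq> R'" for R'
      using laminarD[OF cube_familyD(2)[OF S], of P R' x] P that F(1) x by blast
    have "y R \<le> y P"
    proof (cases "R = P")
      case False
      then have "2 * y R < y P"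
        using least[OF R(1,2)] F(2) R(1) P(1) unfolding growing_def by blast
      moreover have "y R \<le> 2 * y R" by (metis add_increasing2 mult_2 order_refl zero_le)
      ultimately show ?thesis by simp
    qed simp
    then have "2 * y R \<le> 2 * y P" by (rule mult_left_mono) simp
    with R(3) have "y Q \<le> 2 * y P" by (rule order_trans)
    then show ?thesis using P least by blast
  qed
  then show ?thesis using that by metis
qed

text \<open>
  The half of the form in which the stopping cube \<open>\<gamma> Q\<close> of \<open>g\<close> lies
  inside the stopping cube \<open>\<phi> Q\<close> of \<open>f\<close>. The point is that then
  \<open>\<gamma> Q\<close> itself has \<open>\<phi> Q\<close> as its stopping cube. So the sum over the
  \<open>Q\<close> with \<open>\<phi> Q = R\<close> sees only those members of \<open>G\<close> that are
  attached to \<open>R\<close>, and each of these is attached to one \<open>R\<close> only.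
\<close>

lemma stopping_half:
  assumes S: "cube_family \<mu> S" "cube_family \<nu> S"
    and f [measurable]: "f \<in> borel_measurable \<mu>" and g [measurable]: "g \<in> borel_measurable \<nu>"
    and pq: "1 < p" "1 < q" "1 < q'" "1 / q + 1 / q' = 1"
    and s: "inverse s = ennreal (max (1 / q - 1 / p) 0)"
    and F: "F \<subseteq> S" "growing (avg \<mu> f) F" and G: "G \<subseteq> S" "growing (avg \<nu> g) G"
    and \<phi>: "\<And>Q. Q \<in> S \<Longrightarrow> \<phi> Q \<in> F" "\<And>Q. Q \<in> S \<Longrightarrow> Q \<subseteq> \<phi> Q"
      "\<And>Q R. Q \<in> S \<Longrightarrow> R \<in> F \<Longrightarrow> Q \<subseteq> R \<Longrightarrow> \<phi> Q \<subseteq> R" "\<And>Q. Q \<in> S \<Longrightarrow> avg \<mu> f Q \<le> 2 * avg \<mu> f (\<phi> Q)"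
    and \<gamma>: "\<And>Q. Q \<in> S \<Longrightarrow> \<gamma> Q \<in> G" "\<And>Q. Q \<in> S \<Longrightarrow> Q \<subseteq> \<gamma> Q"
      "\<And>Q. Q \<in> S \<Longrightarrow> avg \<nu> g Q \<le> 2 * avg \<nu> g (\<gamma> Q)"
  shows "(\<Sum>Q\<in>{Q \<in> S. \<gamma> Q \<subseteq> \<phi> Q}. a Q * (\<integral>\<^sup>+x\<in>Q. f x \<partial>\<mu>) * (\<integral>\<^sup>+x\<in>Q. g x \<partial>\<nu>))
    \<le> ennreal (4 * geometric_const (p - 1) * geometric_const (q' - 1)) * testing \<mu> \<nu> S a s p q
        * (Lp_norm \<mu> p f * Lp_norm \<nu> q' g)"
proof -
  define S1 where "S1 = {Q \<in> S. \<gamma> Q \<subseteq> \<phi> Q}"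
  let ?y = "avg \<mu> f" and ?z = "avg \<nu> g"
  let ?Kp = "geometric_const (p - 1)" and ?Kq = "geometric_const (q' - 1)"
  have K: "1 < ?Kp" "1 < ?Kq" using geometric_const_pos pq by auto
  have pos: "0 < p" "0 < q" "0 < q'" using pq by auto
  have fin: "finite S" "finite S1" "finite F" "finite G"
    using cube_familyD(1)[OF S(1)] F(1) G(1) by (auto simp: S1_def dest: finite_subset)
  note Ss [measurable] = cube_familyD(3)[OF S(2)]
  note FF = cube_family_subset[OF S(1) F(1)] and GG = cube_family_subset[OF S(2) G(1)]
  define Z where "Z R = (\<Sum>K\<in>{K \<in> G. \<phi> K = R}. ?z K epowr q' * emeasure \<nu> K)" for R
  define N where "N R = Lp_norm \<nu> q (local_op \<mu> S a R)" for R
  have inner: "(\<Sum>Q\<in>{Q \<in> S1. \<phi> Q = R}. a Q * emeasure \<mu> Q * ?z (\<gamma> Q) * emeasure \<nu> Q) \<le> N R * Z R epowr (1 / q')"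
    if R: "R \<in> F" for R
  proof -
    define h where "h x = (\<Sum>K\<in>{K \<in> G. \<phi> K = R}. ?z K epowr q' * indicator K x)" for x
    have [measurable]: "h \<in> borel_measurable \<nu>"
      unfolding h_def using G(1) by (intro borel_measurable_sum) auto
    have [measurable]: "local_op \<mu> S a R \<in> borel_measurable \<nu>"
      unfolding local_op_finite[OF fin(1)] by (intro borel_measurable_sum) auto
    have "(\<Sum>Q\<in>{Q \<in> S1. \<phi> Q = R}. a Q * emeasure \<mu> Q * ?z (\<gamma> Q) * emeasure \<nu> Q)
       = (\<Sum>Q\<in>{Q \<in> S1. \<phi> Q = R}. \<integral>\<^sup>+x. a Q * emeasure \<mu> Q * ?z (\<gamma> Q) * indicator Q x \<partial>\<nu>)"
      by (intro sum.cong refl nn_integral_cmult_indicator[symmetric] Ss) (auto simp: S1_def)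
    also have "\<dots> = (\<integral>\<^sup>+x. (\<Sum>Q\<in>{Q \<in> S1. \<phi> Q = R}. a Q * emeasure \<mu> Q * ?z (\<gamma> Q) * indicator Q x) \<partial>\<nu>)"
      by (intro nn_integral_sum[symmetric]) (auto simp: S1_def)
    also have "\<dots> \<le> (\<integral>\<^sup>+x. local_op \<mu> S a R x * h x epowr (1 / q') \<partial>\<nu>)"
    proof (intro nn_integral_mono)
      fix x
      have "(\<Sum>Q\<in>{Q \<in> S1. \<phi> Q = R}. a Q * emeasure \<mu> Q * ?z (\<gamma> Q) * indicator Q x)
         \<le> (\<Sum>Q\<in>{Q \<in> S1. \<phi> Q = R}. (a Q * emeasure \<mu> Q * indicator Q x) * h x epowr (1 / q'))"
      proof (rule sum_mono)
        fix Q assume "Q \<in> {Q \<in> S1. \<phi> Q = R}"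
        then have Q: "Q \<in> S" "\<gamma> Q \<subseteq> R" "\<phi> Q = R" by (auto simp: S1_def)
        show "a Q * emeasure \<mu> Q * ?z (\<gamma> Q) * indicator Q x
            \<le> (a Q * emeasure \<mu> Q * indicator Q x) * h x epowr (1 / q')"
        proof (cases "x \<in> Q")
          case True
          have K: "\<gamma> Q \<in> S" "x \<in> \<gamma> Q" "\<gamma> Q \<in> G" using \<gamma> Q True G(1) by blast+
          \<comment> \<open>Both cubes are least: \<open>R\<close> is a candidate for \<open>\<gamma> Q\<close>, because \<open>\<gamma> Q \<subseteq> R\<close>, and \<open>\<phi> (\<gamma> Q)\<close> is a candidate for \<open>Q\<close>.\<close>
          have "\<phi> (\<gamma> Q) = R"
          proof
            show "\<phi> (\<gamma> Q) \<subseteq> R" using \<phi>(3)[OF K(1) R] Q by blast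
            have "Q \<subseteq> \<phi> (\<gamma> Q)" using \<gamma>(2)[OF Q(1)] \<phi>(2)[OF K(1)] by blast
            then show "R \<subseteq> \<phi> (\<gamma> Q)" using \<phi>(3)[OF Q(1) \<phi>(1)[OF K(1)]] Q(3) by blast
          qed
          then have "?z (\<gamma> Q) epowr q' * indicator (\<gamma> Q) x \<le> h x"
            unfolding h_def using K fin(4)
            by (intro member_le_sum[where f = "\<lambda>K. ?z K epowr q' * indicator K x"]) auto
          then have "(?z (\<gamma> Q) epowr q') epowr (1 / q') \<le> h x epowr (1 / q')"
            using K pos by (intro epowr_mono) auto
          then have "?z (\<gamma> Q) \<le> h x epowr (1 / q')"
            using pos by (simp add: epowr_inverse_cancel)
          then show ?thesis using True by (auto intro!: mult_left_mono)
        qed simp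
      qed
      also have "\<dots> = (\<Sum>Q\<in>{Q \<in> S1. \<phi> Q = R}. a Q * emeasure \<mu> Q * indicator Q x) * h x epowr (1 / q')"
        by (simp add: sum_distrib_right)
      also have "\<dots> \<le> local_op \<mu> S a R x * h x epowr (1 / q')"
        unfolding local_op_finite[OF fin(1)]
        using \<phi>(2) fin(1) by (intro mult_right_mono sum_mono2) (auto simp: S1_def)
      finally show "(\<Sum>Q\<in>{Q \<in> S1. \<phi> Q = R}. a Q * emeasure \<mu> Q * ?z (\<gamma> Q) * indicator Q x)
         \<le> local_op \<mu> S a R x * h x epowr (1 / q')" .
    qed
    also have "\<dots> \<le> N R * (\<integral>\<^sup>+x. (h x epowr (1 / q')) epowr q' \<partial>\<nu>) epowr (1 / q')"
      unfolding N_def Lp_norm_def by (intro Holder_nn_integral pos pq) measurable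
    also have "(\<integral>\<^sup>+x. (h x epowr (1 / q')) epowr q' \<partial>\<nu>) = (\<integral>\<^sup>+x. h x \<partial>\<nu>)"
      using pos by (simp add: epowr_inverse_cancel)
    also have "(\<integral>\<^sup>+x. h x \<partial>\<nu>) = (\<Sum>K\<in>{K \<in> G. \<phi> K = R}. \<integral>\<^sup>+x. ?z K epowr q' * indicator K x \<partial>\<nu>)"
      unfolding h_def using G(1) by (intro nn_integral_sum) auto
    also have "\<dots> = Z R"
      unfolding Z_def using G(1) by (intro sum.cong refl nn_integral_cmult_indicator Ss) auto
    finally show ?thesis .
  qed
  have "(\<Sum>Q\<in>S1. a Q * (\<integral>\<^sup>+x\<in>Q. f x \<partial>\<mu>) * (\<integral>\<^sup>+x\<in>Q. g x \<partial>\<nu>))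
      \<le> (\<Sum>Q\<in>S1. 4 * (?y (\<phi> Q) * (a Q * emeasure \<mu> Q * ?z (\<gamma> Q) * emeasure \<nu> Q)))"
  proof (rule sum_mono)
    fix Q assume "Q \<in> S1"
    then have Q: "Q \<in> S" by (simp add: S1_def)
    have "a Q * (\<integral>\<^sup>+x\<in>Q. f x \<partial>\<mu>) * (\<integral>\<^sup>+x\<in>Q. g x \<partial>\<nu>)
        = a Q * (?y Q * emeasure \<mu> Q) * (?z Q * emeasure \<nu> Q)"
      using cube_familyD[OF S(1)] cube_familyD[OF S(2)] Q by (simp add: avg_times_emeasure)
    also have "\<dots> \<le> a Q * ((2 * ?y (\<phi> Q)) * emeasure \<mu> Q) * ((2 * ?z (\<gamma> Q)) * emeasure \<nu> Q)"
      by (intro mult_mono order_refl \<phi>(4)[OF Q] \<gamma>(3)[OF Q]) auto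
    also have "\<dots> = (2 * 2) * (?y (\<phi> Q) * (a Q * emeasure \<mu> Q * ?z (\<gamma> Q) * emeasure \<nu> Q))"
      by (simp only: ac_simps)
    finally show "a Q * (\<integral>\<^sup>+x\<in>Q. f x \<partial>\<mu>) * (\<integral>\<^sup>+x\<in>Q. g x \<partial>\<nu>)
        \<le> 4 * (?y (\<phi> Q) * (a Q * emeasure \<mu> Q * ?z (\<gamma> Q) * emeasure \<nu> Q))" by simp
  qed
  also have "\<dots> = 4 * (\<Sum>R\<in>F. \<Sum>Q\<in>{Q \<in> S1. \<phi> Q = R}. ?y (\<phi> Q) * (a Q * emeasure \<mu> Q * ?z (\<gamma> Q) * emeasure \<nu> Q))"
    unfolding sum_distrib_left[symmetric] using fin \<phi>(1)
    by (subst sum.group) (auto simp: S1_def)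
  also have "\<dots> = 4 * (\<Sum>R\<in>F. ?y R * (\<Sum>Q\<in>{Q \<in> S1. \<phi> Q = R}. a Q * emeasure \<mu> Q * ?z (\<gamma> Q) * emeasure \<nu> Q))"
    by (simp add: sum_distrib_left)
  also have "\<dots> \<le> 4 * (\<Sum>R\<in>F. ?y R * (N R * Z R epowr (1 / q')))"
    by (intro mult_left_mono sum_mono inner) auto
  also have "(\<Sum>R\<in>F. ?y R * (N R * Z R epowr (1 / q')))
      = (\<Sum>R\<in>F. (?y R * emeasure \<mu> R epowr (1 / p) * (N R / emeasure \<mu> R epowr (1 / p))) * Z R epowr (1 / q'))"
  proof (intro sum.cong refl)
    fix R assume R: "R \<in> F"
    let ?m = "emeasure \<mu> R epowr (1 / p)"
    have "?m * inverse ?m = 1"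
      using cube_familyD(4,5)[OF FF R] pos by (intro ennreal_mult_inverse) auto
    then have "?m * (N R / ?m) = N R"
      unfolding divide_ennreal_def by (metis mult.assoc mult.commute mult.right_neutral)
    then show "?y R * (N R * Z R epowr (1 / q')) = (?y R * ?m * (N R / ?m)) * Z R epowr (1 / q')"
      by (simp add: mult.assoc)
  qed
  also have "\<dots> \<le> (\<Sum>R\<in>F. (?y R * emeasure \<mu> R epowr (1 / p) * (N R / emeasure \<mu> R epowr (1 / p))) epowr q) epowr (1 / q)
      * (\<Sum>R\<in>F. (Z R epowr (1 / q')) epowr q') epowr (1 / q')"
    by (intro Holder_sum fin pos pq)
  also have "(\<Sum>R\<in>F. (Z R epowr (1 / q')) epowr q') = (\<Sum>K\<in>G. ?z K epowr q' * emeasure \<nu> K)"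
    using pos fin \<phi>(1) G(1) by (simp add: epowr_inverse_cancel Z_def) (subst sum.group, auto)
  finally have main: "(\<Sum>Q\<in>S1. a Q * (\<integral>\<^sup>+x\<in>Q. f x \<partial>\<mu>) * (\<integral>\<^sup>+x\<in>Q. g x \<partial>\<nu>))
      \<le> 4 * ((\<Sum>R\<in>F. (?y R * emeasure \<mu> R epowr (1 / p) * (N R / emeasure \<mu> R epowr (1 / p))) epowr q) epowr (1 / q)
          * (\<Sum>K\<in>G. ?z K epowr q' * emeasure \<nu> K) epowr (1 / q'))"
    by (simp add: mult_left_mono)
  have left: "(\<Sum>R\<in>F. (?y R * emeasure \<mu> R epowr (1 / p) * (N R / emeasure \<mu> R epowr (1 / p))) epowr q) epowr (1 / q)
     \<le> (ennreal ?Kp * Lp_norm \<mu> p f) * testing \<mu> \<nu> S a s p q"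
  proof -
    have "(\<Sum>R\<in>F. (?y R * emeasure \<mu> R epowr (1 / p) * (N R / emeasure \<mu> R epowr (1 / p))) epowr q) epowr (1 / q)
      \<le> (\<Sum>R\<in>F. (?y R * emeasure \<mu> R epowr (1 / p)) epowr p) epowr (1 / p)
          * ell_norm s F (\<lambda>R. N R / emeasure \<mu> R epowr (1 / p))"
      by (intro ell_norm_Holder fin pos s)
    also have "\<dots> \<le> (ennreal ?Kp * Lp_norm \<mu> p f) * testing \<mu> \<nu> S a s p q"
    proof (intro mult_mono)
      have "(\<Sum>R\<in>F. (?y R * emeasure \<mu> R epowr (1 / p)) epowr p) epowr (1 / p)
          = (\<Sum>R\<in>F. ?y R epowr p * emeasure \<mu> R) epowr (1 / p)"
        using pos by (simp add: epowr_mult epowr_inverse_cancel)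
      also have "\<dots> \<le> (ennreal (?Kp powr p) * (\<integral>\<^sup>+x. f x epowr p \<partial>\<mu>)) epowr (1 / p)"
        using pos by (intro epowr_mono carleson_growing FF F f pq) auto
      also have "\<dots> = ennreal ?Kp * Lp_norm \<mu> p f"
        using pos K by (simp add: epowr_mult Lp_norm_def epowr_ennreal powr_powr)
      finally show "(\<Sum>R\<in>F. (?y R * emeasure \<mu> R epowr (1 / p)) epowr p) epowr (1 / p)
          \<le> ennreal ?Kp * Lp_norm \<mu> p f" .
      show "ell_norm s F (\<lambda>R. N R / emeasure \<mu> R epowr (1 / p)) \<le> testing \<mu> \<nu> S a s p q"
        unfolding testing_def N_def
        by (rule SUP_upper) (use F stopping_family_sparse[OF FF F(2) f] in auto)
    qed auto
    finally show ?thesis .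
  qed
  have right: "(\<Sum>K\<in>G. ?z K epowr q' * emeasure \<nu> K) epowr (1 / q') \<le> ennreal ?Kq * Lp_norm \<nu> q' g"
  proof -
    have "(\<Sum>K\<in>G. ?z K epowr q' * emeasure \<nu> K) epowr (1 / q')
        \<le> (ennreal (?Kq powr q') * (\<integral>\<^sup>+x. g x epowr q' \<partial>\<nu>)) epowr (1 / q')"
      using pos by (intro epowr_mono carleson_growing GG G g pq) auto
    also have "\<dots> = ennreal ?Kq * Lp_norm \<nu> q' g"
      using pos K by (simp add: epowr_mult Lp_norm_def epowr_ennreal powr_powr)
    finally show ?thesis .
  qed
  have "(\<Sum>Q\<in>S1. a Q * (\<integral>\<^sup>+x\<in>Q. f x \<partial>\<mu>) * (\<integral>\<^sup>+x\<in>Q. g x \<partial>\<nu>))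
      \<le> 4 * (((ennreal ?Kp * Lp_norm \<mu> p f) * testing \<mu> \<nu> S a s p q) * (ennreal ?Kq * Lp_norm \<nu> q' g))"
    using main by (rule order_trans) (intro mult_left_mono mult_mono left right, auto)
  also have "\<dots> = (4 * ennreal ?Kp * ennreal ?Kq) * testing \<mu> \<nu> S a s p q * (Lp_norm \<mu> p f * Lp_norm \<nu> q' g)"
    by (simp only: ac_simps)
  also have "4 * ennreal ?Kp * ennreal ?Kq = ennreal (4 * ?Kp * ?Kq)"
    using K by (simp add: ennreal_mult)
  finally show ?thesis by (simp add: S1_def)
qed

text \<open>
  The two stopping cubes of \<open>Q\<close> intersect, hence are nested. The second half is the first
  one for the exchanged measures, with \<open>(q', p')\<close> in place of \<open>(p, q)\<close>; this
  leaves \<open>s\<close> unchanged.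
\<close>

theorem testing_sufficient:
  assumes S: "cube_family \<mu> S" "cube_family \<nu> S"
    and f: "f \<in> borel_measurable \<mu>" and g: "g \<in> borel_measurable \<nu>"
    and pq: "1 < p" "1 < p'" "1 / p + 1 / p' = 1" "1 < q" "1 < q'" "1 / q + 1 / q' = 1"
    and s: "inverse s = ennreal (max (1 / q - 1 / p) 0)"
  shows "(\<Sum>Q\<in>S. a Q * (\<integral>\<^sup>+x\<in>Q. f x \<partial>\<mu>) * (\<integral>\<^sup>+x\<in>Q. g x \<partial>\<nu>))
    \<le> ennreal (4 * geometric_const (p - 1) * geometric_const (q' - 1))
        * (testing \<mu> \<nu> S a s p q + testing \<nu> \<mu> S a s q' p') * (Lp_norm \<mu> p f * Lp_norm \<nu> q' g)"
proof -
  obtain F where F: "F \<subseteq> S" "growing (avg \<mu> f) F" "controlled (avg \<mu> f) S F"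
    using exists_stopping_family cube_familyD(1)[OF S(1)] by blast
  obtain G where G: "G \<subseteq> S" "growing (avg \<nu> g) G" "controlled (avg \<nu> g) S G"
    using exists_stopping_family cube_familyD(1)[OF S(1)] by blast
  obtain \<phi> where \<phi>: "\<And>Q. Q \<in> S \<Longrightarrow> \<phi> Q \<in> F" "\<And>Q. Q \<in> S \<Longrightarrow> Q \<subseteq> \<phi> Q"
    "\<And>Q R. Q \<in> S \<Longrightarrow> R \<in> F \<Longrightarrow> Q \<subseteq> R \<Longrightarrow> \<phi> Q \<subseteq> R"
    "\<And>Q. Q \<in> S \<Longrightarrow> avg \<mu> f Q \<le> 2 * avg \<mu> f (\<phi> Q)"
    using least_stopping_cube[OF S(1) F] by metis
  obtain \<gamma> where \<gamma>: "\<And>Q. Q \<in> S \<Longrightarrow> \<gamma> Q \<in> G" "\<And>Q. Q \<in> S \<Longrightarrow> Q \<subseteq> \<gamma> Q"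
    "\<And>Q R. Q \<in> S \<Longrightarrow> R \<in> G \<Longrightarrow> Q \<subseteq> R \<Longrightarrow> \<gamma> Q \<subseteq> R"
    "\<And>Q. Q \<in> S \<Longrightarrow> avg \<nu> g Q \<le> 2 * avg \<nu> g (\<gamma> Q)"
    using least_stopping_cube[OF S(2) G] by metis
  let ?B = "\<lambda>Q. a Q * (\<integral>\<^sup>+x\<in>Q. f x \<partial>\<mu>) * (\<integral>\<^sup>+x\<in>Q. g x \<partial>\<nu>)"
  let ?K = "ennreal (4 * geometric_const (p - 1) * geometric_const (q' - 1))"
  let ?n = "Lp_norm \<mu> p f * Lp_norm \<nu> q' g"
  have s': "inverse s = ennreal (max (1 / p' - 1 / q') 0)"
  proof -
    have "1 / p' - 1 / q' = 1 / q - 1 / p" using pq by linarith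
    then show ?thesis using s by simp
  qed
  have "S = {Q \<in> S. \<gamma> Q \<subseteq> \<phi> Q} \<union> {Q \<in> S. \<phi> Q \<subseteq> \<gamma> Q}"
  proof -
    have "\<gamma> Q \<subseteq> \<phi> Q \<or> \<phi> Q \<subseteq> \<gamma> Q" if Q: "Q \<in> S" for Q
    proof -
      obtain x where "x \<in> Q" using cube_familyD(6)[OF S(1) Q] by blast
      then show ?thesis
        using laminarD[OF cube_familyD(2)[OF S(1)], of "\<gamma> Q" "\<phi> Q" x] \<phi>(1,2)[OF Q] \<gamma>(1,2)[OF Q] F(1) G(1)
        by blast
    qed
    then show ?thesis by blast
  qed
  then have "(\<Sum>Q\<in>S. ?B Q) = (\<Sum>Q\<in>{Q \<in> S. \<gamma> Q \<subseteq> \<phi> Q} \<union> {Q \<in> S. \<phi> Q \<subseteq> \<gamma> Q}. ?B Q)" by simp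
  also have "\<dots> \<le> (\<Sum>Q\<in>{Q \<in> S. \<gamma> Q \<subseteq> \<phi> Q}. ?B Q) + (\<Sum>Q\<in>{Q \<in> S. \<phi> Q \<subseteq> \<gamma> Q}. ?B Q)"
    using cube_familyD(1)[OF S(1)] by (subst sum.union_inter[symmetric]) auto
  also have "\<dots> \<le> ?K * testing \<mu> \<nu> S a s p q * ?n + ?K * testing \<nu> \<mu> S a s q' p' * ?n"
  proof (rule add_mono)
    show "(\<Sum>Q\<in>{Q \<in> S. \<gamma> Q \<subseteq> \<phi> Q}. ?B Q) \<le> ?K * testing \<mu> \<nu> S a s p q * ?n"
      by (rule stopping_half[OF S f g pq(1,4,5,6) s F(1,2) G(1,2) \<phi> \<gamma>(1,2,4)])
    have "(\<Sum>Q\<in>{Q \<in> S. \<phi> Q \<subseteq> \<gamma> Q}. a Q * (\<integral>\<^sup>+x\<in>Q. g x \<partial>\<nu>) * (\<integral>\<^sup>+x\<in>Q. f x \<partial>\<mu>))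
        \<le> ennreal (4 * geometric_const (q' - 1) * geometric_const (p - 1))
            * testing \<nu> \<mu> S a s q' p' * (Lp_norm \<nu> q' g * Lp_norm \<mu> p f)"
      by (rule stopping_half[OF S(2,1) g f pq(5,2,1) _ s' G(1,2) F(1,2) \<gamma> \<phi>(1,2,4)])
        (use pq in simp)
    then show "(\<Sum>Q\<in>{Q \<in> S. \<phi> Q \<subseteq> \<gamma> Q}. ?B Q) \<le> ?K * testing \<nu> \<mu> S a s q' p' * ?n"
      by (simp only: ac_simps)
  qed
  also have "\<dots> = ?K * (testing \<mu> \<nu> S a s p q + testing \<nu> \<mu> S a s q' p') * ?n"
    by (simp add: distrib_left distrib_right)
  finally show ?thesis .
qed

definition pavg :: "'a measure \<Rightarrow> real \<Rightarrow> ('a \<Rightarrow> ennreal) \<Rightarrow> 'a set \<Rightarrow> ennreal" where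
  "pavg \<mu> r f Q = avg \<mu> (\<lambda>x. f x epowr r) Q epowr (1 / r)"

lemma avg_le_pavg:
  assumes [measurable]: "f \<in> borel_measurable \<mu>" "Q \<in> sets \<mu>"
    and Q: "0 < emeasure \<mu> Q" "emeasure \<mu> Q < top" and r: "1 \<le> r"
  shows "avg \<mu> f Q \<le> pavg \<mu> r f Q"
proof (cases "r = 1")
  case True
  then show ?thesis by (simp add: pavg_def)
next
  case False
  define r' where "r' = r / (r - 1)"
  have rr: "0 < r" "0 < r'" "1 / r + 1 / r' = 1"
    using r False by (auto simp: r'_def field_simps)
  let ?m = "emeasure \<mu> Q"
  have m: "?m epowr (1 / r') = ?m * inverse ?m epowr (1 / r)"
  proof -
    have "?m epowr (1 / r) * inverse ?m epowr (1 / r) = 1"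
      using rr Q by (simp add: epowr_mult[symmetric] ennreal_mult_inverse)
    then have "?m epowr (1 / r') * (?m epowr (1 / r) * inverse ?m epowr (1 / r)) = ?m epowr (1 / r')"
      by simp
    moreover have "?m epowr (1 / r') * ?m epowr (1 / r) = ?m"
      using epowr_add[of "1 / r'" "1 / r" ?m] rr by (simp add: add.commute)
    ultimately show ?thesis by (metis mult.assoc)
  qed
  have "(\<integral>\<^sup>+x\<in>Q. f x \<partial>\<mu>) * inverse ?m
      \<le> ((\<integral>\<^sup>+x\<in>Q. f x epowr r \<partial>\<mu>) epowr (1 / r) * ?m epowr (1 / r')) * inverse ?m"
    by (intro mult_right_mono set_Holder rr) measurable
  also have "\<dots> = (\<integral>\<^sup>+x\<in>Q. f x epowr r \<partial>\<mu>) epowr (1 / r) * inverse ?m epowr (1 / r) * (?m * inverse ?m)"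
    unfolding m by (simp only: ac_simps)
  also have "\<dots> = pavg \<mu> r f Q"
    unfolding pavg_def avg_def divide_ennreal_def ennreal_mult_inverse[OF less_imp_neq[OF Q(1), symmetric] Q(2)]
    using rr by (simp add: epowr_mult)
  finally show ?thesis by (simp add: avg_def divide_ennreal_def)
qed

text \<open>
  The function \<open>h\<close> is \<open>(M(f\<^sup>r))\<^bsup>1/r\<^esup>\<close>, which is at least
  \<open>pavg \<mu> r f Q\<close> throughout \<open>Q\<close>. Its norm is controlled by the maximal
  inequality in \<open>L\<^bsup>p/r\<^esup>\<close>, where \<open>p/r > 1\<close>.
\<close>

lemma pavg_dominated:
  assumes S: "cube_family \<mu> S" and f [measurable]: "f \<in> borel_measurable \<mu>" and r: "1 \<le> r" "r < p"
  obtains h where "h \<in> borel_measurable \<mu>"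
    "\<And>Q. Q \<in> S \<Longrightarrow> pavg \<mu> r f Q * emeasure \<mu> Q \<le> (\<integral>\<^sup>+x\<in>Q. h x \<partial>\<mu>)"
    "Lp_norm \<mu> p h \<le> ennreal (maximal_const (p / r) powr (1 / p)) * Lp_norm \<mu> p f"
proof
  define h where "h x = maximal_function \<mu> S (\<lambda>x. f x epowr r) x epowr (1 / r)" for x
  note [measurable] = maximal_function_measurable[OF S]
  show "h \<in> borel_measurable \<mu>" unfolding h_def by measurable
  show "pavg \<mu> r f Q * emeasure \<mu> Q \<le> (\<integral>\<^sup>+x\<in>Q. h x \<partial>\<mu>)" if Q: "Q \<in> S" for Q
  proof -
    have "pavg \<mu> r f Q * emeasure \<mu> Q = (\<integral>\<^sup>+x. pavg \<mu> r f Q * indicator Q x \<partial>\<mu>)"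
      using cube_familyD(3)[OF S Q] by (simp add: nn_integral_cmult_indicator)
    also have "\<dots> \<le> (\<integral>\<^sup>+x\<in>Q. h x \<partial>\<mu>)"
      using Q r unfolding pavg_def h_def
      by (intro nn_integral_mono) (auto simp: indicator_def intro!: epowr_mono maximal_function_ge)
    finally show ?thesis .
  qed
  have pr: "0 < p" "0 < r" "1 < p / r" using r by auto
  have "(\<integral>\<^sup>+x. h x epowr p \<partial>\<mu>) = (\<integral>\<^sup>+x. maximal_function \<mu> S (\<lambda>x. f x epowr r) x epowr (p / r) \<partial>\<mu>)"
    using pr by (simp add: h_def epowr_epowr)
  also have "\<dots> \<le> ennreal (maximal_const (p / r)) * (\<integral>\<^sup>+x. (f x epowr r) epowr (p / r) \<partial>\<mu>)"
    by (intro maximal_inequality S pr) measurable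
  also have "\<dots> = ennreal (maximal_const (p / r)) * (\<integral>\<^sup>+x. f x epowr p \<partial>\<mu>)"
    using pr by (simp add: epowr_epowr)
  finally have "Lp_norm \<mu> p h \<le> (ennreal (maximal_const (p / r)) * (\<integral>\<^sup>+x. f x epowr p \<partial>\<mu>)) epowr (1 / p)"
    unfolding Lp_norm_def using pr by (intro epowr_mono) auto
  also have "\<dots> = ennreal (maximal_const (p / r) powr (1 / p)) * Lp_norm \<mu> p f"
    using pr maximal_const_pos[OF pr(3)] by (simp add: epowr_mult epowr_ennreal Lp_norm_def)
  finally show "Lp_norm \<mu> p h \<le> ennreal (maximal_const (p / r) powr (1 / p)) * Lp_norm \<mu> p f" .
qed

definition upper_const :: "real \<Rightarrow> real \<Rightarrow> real \<Rightarrow> real \<Rightarrow> real" where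
  "upper_const r t p q' = 4 * geometric_const (p - 1) * geometric_const (q' - 1)
     * maximal_const (p / r) powr (1 / p) * maximal_const (q' / t) powr (1 / q')"

theorem testing_sufficient_pavg:
  assumes S: "cube_family \<mu> S" "cube_family \<nu> S"
    and f: "f \<in> borel_measurable \<mu>" and g: "g \<in> borel_measurable \<nu>"
    and pq: "1 < p" "1 < p'" "1 / p + 1 / p' = 1" "1 < q" "1 < q'" "1 / q + 1 / q' = 1"
    and s: "inverse s = ennreal (max (1 / q - 1 / p) 0)"
    and rt: "1 \<le> r" "r < p" "1 \<le> t" "t < q'"
  shows "(\<Sum>Q\<in>S. a Q * (pavg \<mu> r f Q * emeasure \<mu> Q) * (pavg \<nu> t g Q * emeasure \<nu> Q))
    \<le> ennreal (upper_const r t p q') * (testing \<mu> \<nu> S a s p q + testing \<nu> \<mu> S a s q' p')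
        * (Lp_norm \<mu> p f * Lp_norm \<nu> q' g)"
proof -
  obtain h where h: "h \<in> borel_measurable \<mu>"
    "\<And>Q. Q \<in> S \<Longrightarrow> pavg \<mu> r f Q * emeasure \<mu> Q \<le> (\<integral>\<^sup>+x\<in>Q. h x \<partial>\<mu>)"
    "Lp_norm \<mu> p h \<le> ennreal (maximal_const (p / r) powr (1 / p)) * Lp_norm \<mu> p f"
    using pavg_dominated[OF S(1) f rt(1,2)] by blast
  obtain k where k: "k \<in> borel_measurable \<nu>"
    "\<And>Q. Q \<in> S \<Longrightarrow> pavg \<nu> t g Q * emeasure \<nu> Q \<le> (\<integral>\<^sup>+x\<in>Q. k x \<partial>\<nu>)"
    "Lp_norm \<nu> q' k \<le> ennreal (maximal_const (q' / t) powr (1 / q')) * Lp_norm \<nu> q' g"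
    using pavg_dominated[OF S(2) g rt(3,4)] by blast
  let ?T = "testing \<mu> \<nu> S a s p q + testing \<nu> \<mu> S a s q' p'"
  let ?K = "4 * geometric_const (p - 1) * geometric_const (q' - 1)"
  let ?A = "maximal_const (p / r) powr (1 / p)" and ?B = "maximal_const (q' / t) powr (1 / q')"
  have K: "0 < ?K" using geometric_const_pos[of "p - 1"] geometric_const_pos[of "q' - 1"] pq by simp
  have "(\<Sum>Q\<in>S. a Q * (pavg \<mu> r f Q * emeasure \<mu> Q) * (pavg \<nu> t g Q * emeasure \<nu> Q))
      \<le> (\<Sum>Q\<in>S. a Q * (\<integral>\<^sup>+x\<in>Q. h x \<partial>\<mu>) * (\<integral>\<^sup>+x\<in>Q. k x \<partial>\<nu>))"
    by (intro sum_mono mult_mono h k) auto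
  also have "\<dots> \<le> ennreal ?K * ?T * (Lp_norm \<mu> p h * Lp_norm \<nu> q' k)"
    by (rule testing_sufficient[OF S h(1) k(1) pq s])
  also have "\<dots> \<le> ennreal ?K * ?T * ((ennreal ?A * Lp_norm \<mu> p f) * (ennreal ?B * Lp_norm \<nu> q' g))"
    by (intro mult_left_mono mult_mono h k) auto
  also have "\<dots> = (ennreal ?K * ennreal ?A * ennreal ?B) * ?T * (Lp_norm \<mu> p f * Lp_norm \<nu> q' g)"
    by (simp only: ac_simps)
  also have "ennreal ?K * ennreal ?A * ennreal ?B = ennreal (upper_const r t p q')"
    unfolding upper_const_def using K by (simp add: ennreal_mult')
  finally show ?thesis .
qed

section \<open>Testing conditions are necessary: finite families\<close>

lemma nn_integral_count_space_mono_set: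
  assumes "I \<subseteq> J" shows "(\<integral>\<^sup>+i. h i \<partial>count_space I) \<le> (\<integral>\<^sup>+i. h i \<partial>count_space J)"
proof -
  have "(\<integral>\<^sup>+i. h i * indicator I i \<partial>count_space UNIV) \<le> (\<integral>\<^sup>+i. h i * indicator J i \<partial>count_space UNIV)"
    using assms by (intro nn_integral_mono) (auto simp: indicator_def)
  then show ?thesis by (simp add: nn_integral_count_space_indicator)
qed

lemma nn_integral_count_space_Union:
  fixes J :: "nat \<Rightarrow> 'i set"
  assumes "incseq J"
  shows "(\<integral>\<^sup>+i. h i \<partial>count_space (\<Union>n. J n)) = (SUP n. \<integral>\<^sup>+i. h i \<partial>count_space (J n))"
proof -
  have "(\<integral>\<^sup>+i. h i \<partial>count_space (\<Union>n. J n)) = (\<integral>\<^sup>+i. h i * indicator (\<Union>n. J n) i \<partial>count_space UNIV)"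
    by (simp add: nn_integral_count_space_indicator)
  also have "\<dots> = (\<integral>\<^sup>+i. (SUP n. h i * indicator (J n) i) \<partial>count_space UNIV)"
  proof (intro nn_integral_cong)
    fix i
    show "h i * indicator (\<Union>n. J n) i = (SUP n. h i * indicator (J n) i)"
    proof (cases "\<exists>n. i \<in> J n")
      case True
      then obtain n where "i \<in> J n" ..
      then have "h i \<le> (SUP n. h i * indicator (J n) i)" by (intro SUP_upper2[of n]) auto
      moreover have "(SUP n. h i * indicator (J n) i) \<le> h i"
        by (intro SUP_least) (simp add: indicator_def)
      ultimately show ?thesis using True by (auto intro: antisym)
    qed simp
  qed
  also have "\<dots> = (SUP n. \<integral>\<^sup>+i. h i * indicator (J n) i \<partial>count_space UNIV)"
    using assms by (intro nn_integral_monotone_convergence_SUP)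
      (auto simp: incseq_def le_fun_def indicator_def subset_iff)
  also have "\<dots> = (SUP n. \<integral>\<^sup>+i. h i \<partial>count_space (J n))"
    by (simp add: nn_integral_count_space_indicator)
  finally show ?thesis .
qed

lemma countable_finite_exhaustion:
  assumes "countable S"
  obtains J :: "nat \<Rightarrow> 'i set" where "incseq J" "\<And>n. finite (J n)" "\<And>n. J n \<subseteq> S" "(\<Union>n. J n) = S"
proof -
  obtain e :: "'i \<Rightarrow> nat" where e: "inj_on e S" using assms by (rule countableE)
  define J where "J n = {i \<in> S. e i \<le> n}" for n
  have "finite (J n)" for n
    by (rule inj_on_finite[of e _ "{..n}"]) (auto simp: J_def intro: inj_on_subset[OF e])
  moreover have "incseq J" by (auto simp: incseq_def J_def)
  ultimately show ?thesis using that[of J] by (auto simp: J_def)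
qed

text \<open>
  Only finite-valued functions are tested, since these correspond to the real-valued functions in the
  sparse form.
\<close>

definition form_bounded ::
  "'a measure \<Rightarrow> 'a measure \<Rightarrow> 'a set set \<Rightarrow> ('a set \<Rightarrow> ennreal) \<Rightarrow> real \<Rightarrow> real \<Rightarrow> ennreal \<Rightarrow> bool" where
  "form_bounded \<mu> \<nu> S a p q' N \<longleftrightarrow>
    (\<forall>f\<in>borel_measurable \<mu>. \<forall>g\<in>borel_measurable \<nu>. (\<forall>x. f x < top) \<longrightarrow> (\<forall>x. g x < top) \<longrightarrow>
       Lp_norm \<mu> p f < top \<longrightarrow> Lp_norm \<nu> q' g < top \<longrightarrow>
       (\<integral>\<^sup>+Q. a Q * (\<integral>\<^sup>+x\<in>Q. f x \<partial>\<mu>) * (\<integral>\<^sup>+x\<in>Q. g x \<partial>\<nu>) \<partial>count_space S)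
         \<le> N * (Lp_norm \<mu> p f * Lp_norm \<nu> q' g))"

lemma form_bounded_subset:
  assumes "form_bounded \<mu> \<nu> S a p q' N" "S' \<subseteq> S" shows "form_bounded \<mu> \<nu> S' a p q' N"
  using assms(1) unfolding form_bounded_def
  by (blast intro: order_trans[OF nn_integral_count_space_mono_set[OF assms(2)]])

lemma form_bounded_swap:
  assumes "form_bounded \<mu> \<nu> S a p q' N" shows "form_bounded \<nu> \<mu> S a q' p N"
  unfolding form_bounded_def
proof (intro ballI impI)
  fix G F assume *: "G \<in> borel_measurable \<nu>" "F \<in> borel_measurable \<mu>" "\<forall>x. G x < top" "\<forall>x. F x < top"
    "Lp_norm \<nu> q' G < top" "Lp_norm \<mu> p F < top"
  have "(\<integral>\<^sup>+Q. a Q * (\<integral>\<^sup>+x\<in>Q. F x \<partial>\<mu>) * (\<integral>\<^sup>+x\<in>Q. G x \<partial>\<nu>) \<partial>count_space S)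
      \<le> N * (Lp_norm \<mu> p F * Lp_norm \<nu> q' G)"
    using assms * unfolding form_bounded_def by blast
  then show "(\<integral>\<^sup>+Q. a Q * (\<integral>\<^sup>+x\<in>Q. G x \<partial>\<nu>) * (\<integral>\<^sup>+x\<in>Q. F x \<partial>\<mu>) \<partial>count_space S)
      \<le> N * (Lp_norm \<nu> q' G * Lp_norm \<mu> p F)"
    by (simp only: ac_simps)
qed

lemma Lp_norm_mono:
  assumes "0 \<le> t" "\<And>x. f x \<le> g x" shows "Lp_norm \<mu> t f \<le> Lp_norm \<mu> t g"
  unfolding Lp_norm_def using assms by (intro epowr_mono nn_integral_mono) auto

text \<open>
  Duality for the operator attached to the form: test with \<open>g = h\<^bsup>q-1\<^esup>\<close>, the
  function for which Hoelder's inequality is an equality.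
\<close>

lemma form_bounded_op:
  assumes S: "cube_family \<mu> S" "cube_family \<nu> S" and a: "\<And>Q. Q \<in> S \<Longrightarrow> a Q < top"
    and pq: "1 < p" "1 < p'" "1 / p + 1 / p' = 1" "1 < q" "1 < q'" "1 / q + 1 / q' = 1"
    and N: "form_bounded \<mu> \<nu> S a p q' N"
    and f [measurable]: "f \<in> borel_measurable \<mu>" and ff: "\<And>x. f x < top" "Lp_norm \<mu> p f < top"
  shows "Lp_norm \<nu> q (\<lambda>x. \<Sum>Q\<in>S. a Q * (\<integral>\<^sup>+y\<in>Q. f y \<partial>\<mu>) * indicator Q x) \<le> N * Lp_norm \<mu> p f"
proof -
  have pos: "0 < p" "0 < p'" "0 < q" "0 < q'" using pq by auto
  note Ss [measurable] = cube_familyD(3)[OF S(2)]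
  define c where "c Q = a Q * (\<integral>\<^sup>+y\<in>Q. f y \<partial>\<mu>)" for Q
  define h where "h x = (\<Sum>Q\<in>S. c Q * indicator Q x)" for x
  define g where "g x = h x epowr (q - 1)" for x
  have [measurable]: "h \<in> borel_measurable \<nu>" "g \<in> borel_measurable \<nu>"
    unfolding h_def g_def by measurable
  have c: "c Q < top" if Q: "Q \<in> S" for Q
  proof -
    have "(\<integral>\<^sup>+x\<in>Q. f x epowr p \<partial>\<mu>) \<le> (\<integral>\<^sup>+x. f x epowr p \<partial>\<mu>)"
      by (intro nn_integral_mono) (auto simp: indicator_def)
    also have "\<dots> < top" using ff(2) pos by (simp add: Lp_norm_def)
    finally have "(\<integral>\<^sup>+x\<in>Q. f x epowr p \<partial>\<mu>) epowr (1 / p) * emeasure \<mu> Q epowr (1 / p') < top"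
      using pos cube_familyD(5)[OF S(1) Q] by (auto simp: ennreal_mult_less_top)
    with set_Holder[OF f cube_familyD(3)[OF S(1) Q] pos(1,2) pq(3)] have "(\<integral>\<^sup>+x\<in>Q. f x \<partial>\<mu>) < top"
      by (rule le_less_trans)
    then show ?thesis using a[OF Q] by (simp add: c_def ennreal_mult_less_top)
  qed
  define X where "X = (\<integral>\<^sup>+x. h x epowr q \<partial>\<nu>)"
  have X: "X < top"
    unfolding X_def h_def by (rule nn_integral_sum_cubes_finite[OF S(2) c pos(3)])
  have h: "h x < top" for x
    unfolding h_def using c cube_familyD(1)[OF S(1)] by (auto simp: ennreal_mult_less_top indicator_def)
  have g: "g x < top" for x using h pq by (simp add: g_def)
  have q1: "(q - 1) * q' = q" using pq by (simp add: field_simps)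
  have gn: "Lp_norm \<nu> q' g = X epowr (1 / q')"
    using pq q1 by (simp add: Lp_norm_def X_def g_def epowr_epowr)
  have "X = (\<integral>\<^sup>+x. (\<Sum>Q\<in>S. c Q * (g x * indicator Q x)) \<partial>\<nu>)"
    unfolding X_def
  proof (intro nn_integral_cong)
    fix x
    have "h x epowr q = h x * g x"
      using epowr_add[of 1 "q - 1" "h x"] pq by (simp add: g_def)
    then show "h x epowr q = (\<Sum>Q\<in>S. c Q * (g x * indicator Q x))"
      by (simp add: h_def sum_distrib_left ac_simps)
  qed
  also have "\<dots> = (\<Sum>Q\<in>S. \<integral>\<^sup>+x. c Q * (g x * indicator Q x) \<partial>\<nu>)"
    by (intro nn_integral_sum) measurable
  also have "\<dots> = (\<Sum>Q\<in>S. c Q * (\<integral>\<^sup>+x\<in>Q. g x \<partial>\<nu>))"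
    by (intro sum.cong refl nn_integral_cmult) measurable
  also have "\<dots> = (\<integral>\<^sup>+Q. a Q * (\<integral>\<^sup>+x\<in>Q. f x \<partial>\<mu>) * (\<integral>\<^sup>+x\<in>Q. g x \<partial>\<nu>) \<partial>count_space S)"
    using cube_familyD(1)[OF S(1)] by (simp add: nn_integral_count_space_finite c_def)
  also have "\<dots> \<le> N * (Lp_norm \<mu> p f * Lp_norm \<nu> q' g)"
  proof -
    have "Lp_norm \<nu> q' g < top" unfolding gn using X pos by simp
    then show ?thesis
      using N ff g unfolding form_bounded_def by simp
  qed
  finally have "X \<le> (N * Lp_norm \<mu> p f) * X epowr (1 / q')"
    unfolding gn by (simp add: mult.assoc)
  then have "X \<le> (N * Lp_norm \<mu> p f) epowr q"
    by (rule epowr_absorb[OF pos(3,4) pq(6) X])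
  then have "X epowr (1 / q) \<le> ((N * Lp_norm \<mu> p f) epowr q) epowr (1 / q)"
    using pos by (intro epowr_mono) auto
  then show ?thesis
    using pos by (simp add: X_def h_def c_def Lp_norm_def epowr_inverse_cancel)
qed

lemma divide_le_of_le_mult:
  fixes x m N :: ennreal
  assumes "m \<noteq> 0" "m < top" "x \<le> N * m" shows "x / m \<le> N"
proof -
  have "x * inverse m \<le> (N * m) * inverse m" using assms(3) by (rule mult_right_mono) simp
  then show ?thesis
    using ennreal_mult_inverse[OF assms(1,2)] by (simp add: divide_ennreal_def mult.assoc)
qed

text \<open>
  The summand \<open>1\<close> is the constant for \<open>s = \<infinity>\<close>, the other one that for \<open>s < \<infinity>\<close>.
\<close>

definition lower_const :: "real \<Rightarrow> real" where
  "lower_const p' = 1 + (2 * maximal_const p') powr (1 / p')"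

text \<open>
  The definition of \<open>c R\<close> in the proof makes \<open>c\<^sub>R\<^sup>p \<mu>(R)\<close> and
  \<open>c\<^sub>R\<^sup>q \<parallel>T\<^sub>R(u)\<parallel>\<^sup>q\<close> both equal to
  \<open>A\<^sub>R\<^sup>r\<close>; the latter because \<open>1/r = 1/q - 1/p\<close>. The resulting
  estimate has \<open>X = \<Sum>\<^sub>R A\<^sub>R\<^sup>r\<close> on the left and
  \<open>X\<^bsup>q/p\<^esup>\<close> on the right, and \<open>q < p\<close> allows it to be absorbed.
  The indicator estimate is used for \<open>X < \<infinity>\<close>.
\<close>

lemma testing_necessary_finite:
  assumes S: "cube_family \<mu> S" "cube_family \<nu> S" and a: "\<And>Q. Q \<in> S \<Longrightarrow> a Q < top"
    and pq: "1 < p" "1 < p'" "1 / p + 1 / p' = 1" "1 < q" "1 < q'" "1 / q + 1 / q' = 1"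
    and s: "inverse s = ennreal (max (1 / q - 1 / p) 0)"
    and N: "form_bounded \<mu> \<nu> S a p q' N" "N < top"
    and F: "cube_family \<mu> F" "sparse_family \<mu> F"
  shows "ell_norm s F (\<lambda>R. Lp_norm \<nu> q (local_op \<mu> S a R) / emeasure \<mu> R epowr (1 / p))
    \<le> ennreal (lower_const p') * N"
proof -
  have pos: "0 < p" "0 < p'" "0 < q" "0 < q'" using pq by auto
  have fin: "finite S" "finite F" using cube_familyD(1)[OF S(1)] cube_familyD(1)[OF F(1)] by auto
  note Ss [measurable] = cube_familyD(3)[OF S(2)] and Fs [measurable] = cube_familyD(3)[OF F(1)]
  define A where "A R = Lp_norm \<nu> q (local_op \<mu> S a R) / emeasure \<mu> R epowr (1 / p)" for R
  have m: "emeasure \<mu> R epowr (1 / p) \<noteq> 0" "emeasure \<mu> R epowr (1 / p) < top" if "R \<in> F" for R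
    using cube_familyD(4,5)[OF F(1) that] pos by auto
  have single: "A R \<le> N" if R: "R \<in> F" for R
  proof -
    let ?f = "indicator R :: _ \<Rightarrow> ennreal"
    have ind: "?f x epowr p = ?f x" for x using pos by (simp add: indicator_def)
    have norm: "Lp_norm \<mu> p ?f = emeasure \<mu> R epowr (1 / p)"
      unfolding Lp_norm_def ind using Fs[OF R] by simp
    have "local_op \<mu> S a R x \<le> (\<Sum>Q\<in>S. a Q * (\<integral>\<^sup>+y\<in>Q. ?f y \<partial>\<mu>) * indicator Q x)" for x
    proof -
      have "local_op \<mu> S a R x = (\<Sum>Q\<in>{Q \<in> S. Q \<subseteq> R}. a Q * (\<integral>\<^sup>+y\<in>Q. ?f y \<partial>\<mu>) * indicator Q x)"
        unfolding local_op_finite[OF fin(1)]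
      proof (intro sum.cong refl)
        fix Q assume Q: "Q \<in> {Q \<in> S. Q \<subseteq> R}"
        have "(\<integral>\<^sup>+y\<in>Q. ?f y \<partial>\<mu>) = (\<integral>\<^sup>+y. indicator Q y \<partial>\<mu>)"
          using Q by (intro nn_integral_cong) (auto simp: indicator_def)
        then show "a Q * emeasure \<mu> Q * indicator Q x = a Q * (\<integral>\<^sup>+y\<in>Q. ?f y \<partial>\<mu>) * indicator Q x"
          using cube_familyD(3)[OF S(1)] Q by simp
      qed
      also have "\<dots> \<le> (\<Sum>Q\<in>S. a Q * (\<integral>\<^sup>+y\<in>Q. ?f y \<partial>\<mu>) * indicator Q x)"
        using fin by (intro sum_mono2) auto
      finally show ?thesis .
    qed
    then have "Lp_norm \<nu> q (local_op \<mu> S a R) \<le> Lp_norm \<nu> q (\<lambda>x. \<Sum>Q\<in>S. a Q * (\<integral>\<^sup>+y\<in>Q. ?f y \<partial>\<mu>) * indicator Q x)"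
      using pos(3) by (intro Lp_norm_mono) auto
    also have "\<dots> \<le> N * Lp_norm \<mu> p ?f"
    proof (rule form_bounded_op[OF S a pq N(1)])
      show "?f \<in> borel_measurable \<mu>" using Fs[OF R] by simp
      show "Lp_norm \<mu> p ?f < top" unfolding norm by (rule m(2)[OF R])
    qed (simp_all add: indicator_def)
    finally show ?thesis
      unfolding A_def norm by (rule divide_le_of_le_mult[OF m[OF R]])
  qed
  have "ell_norm s F A \<le> ennreal (lower_const p') * N"
    using pos(1,3) s
  proof (cases rule: integrability_exponent_cases)
    case 1
    have "ell_norm s F A \<le> 1 * N"
      using 1 single by (auto simp: ell_norm_def intro: SUP_least)
    also have "\<dots> \<le> ennreal (lower_const p') * N"
      by (intro mult_right_mono) (auto simp: lower_const_def)
    finally show ?thesis .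
  next
    case (2 r)
    define X where "X = (\<Sum>R\<in>F. A R epowr r)"
    define c where "c R = A R epowr (r / p) / emeasure \<mu> R epowr (1 / p)" for R
    define C0 where "C0 = (2 * maximal_const p') powr (p / p')"
    have A: "A R < top" if "R \<in> F" for R using single[OF that] N(2) by (rule le_less_trans)
    have X: "X < top" unfolding X_def using A fin 2 by simp
    have cm: "c R * emeasure \<mu> R epowr (1 / p) = A R epowr (r / p)" if "R \<in> F" for R
      unfolding c_def divide_ennreal_def
      using ennreal_mult_inverse[OF m[OF that]] by (simp add: mult.assoc mult.commute[of "inverse _"])
    have AN: "A R * emeasure \<mu> R epowr (1 / p) = Lp_norm \<nu> q (local_op \<mu> S a R)" if "R \<in> F" for R
      unfolding A_def divide_ennreal_def
      using ennreal_mult_inverse[OF m[OF that]] by (simp add: mult.assoc mult.commute[of "inverse _"])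
    have c: "c R < top" if R: "R \<in> F" for R
      using A[OF R] m[OF R] 2 pos by (auto simp: c_def ennreal_divide_eq_top_iff less_top[symmetric])
    define \<phi> where "\<phi> x = (\<Sum>R\<in>F. c R * indicator R x)" for x
    have [measurable]: "\<phi> \<in> borel_measurable \<mu>" unfolding \<phi>_def by measurable
    have \<phi>: "\<phi> x < top" for x
      unfolding \<phi>_def using c fin by (auto simp: ennreal_mult_less_top indicator_def)
    have "(\<integral>\<^sup>+x. \<phi> x epowr p \<partial>\<mu>) \<le> ennreal C0 * (\<Sum>R\<in>F. c R epowr p * emeasure \<mu> R)"
      unfolding \<phi>_def C0_def by (intro sparse_sum_norm F c pq)
    also have "(\<Sum>R\<in>F. c R epowr p * emeasure \<mu> R) = X"
      unfolding X_def
    proof (intro sum.cong refl)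
      fix R assume R: "R \<in> F"
      have "c R epowr p * emeasure \<mu> R = (c R * emeasure \<mu> R epowr (1 / p)) epowr p"
        using pos by (simp add: epowr_mult epowr_inverse_cancel)
      then show "c R epowr p * emeasure \<mu> R = A R epowr r"
        using pos 2 by (simp add: cm[OF R] epowr_epowr)
    qed
    finally have \<phi>int: "(\<integral>\<^sup>+x. \<phi> x epowr p \<partial>\<mu>) \<le> ennreal C0 * X" .
    have "Lp_norm \<mu> p \<phi> \<le> (ennreal C0 * X) epowr (1 / p)"
      unfolding Lp_norm_def using \<phi>int pos by (intro epowr_mono) auto
    also have "\<dots> = ennreal (C0 powr (1 / p)) * X epowr (1 / p)"
      using pos by (simp add: epowr_mult epowr_ennreal C0_def)
    finally have \<phi>norm: "Lp_norm \<mu> p \<phi> \<le> ennreal (C0 powr (1 / p)) * X epowr (1 / p)" .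
    have "ennreal (C0 powr (1 / p)) * X epowr (1 / p) < top"
      using X pos by (simp add: ennreal_mult_less_top)
    with \<phi>norm have \<phi>fin: "Lp_norm \<mu> p \<phi> < top" by (rule le_less_trans)
    define h where "h x = (\<Sum>Q\<in>S. a Q * (\<integral>\<^sup>+y\<in>Q. \<phi> y \<partial>\<mu>) * indicator Q x)" for x
    have hN: "Lp_norm \<nu> q h \<le> N * (ennreal (C0 powr (1 / p)) * X epowr (1 / p))"
      unfolding h_def
      by (rule order_trans[OF form_bounded_op[OF S a pq N(1) _ \<phi> \<phi>fin]]) (auto intro!: mult_left_mono \<phi>norm)
    \<comment> \<open>A cube \<open>Q\<close> is counted on the left once for each \<open>R \<supseteq> Q\<close>, and on such \<open>Q\<close> all these \<open>c R\<close> contribute to \<open>\<phi>\<close>.\<close>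
    have hlow: "(\<Sum>R\<in>F. c R * local_op \<mu> S a R x) \<le> h x" for x
    proof -
      have "(\<Sum>R\<in>F. c R * local_op \<mu> S a R x)
          = (\<Sum>R\<in>F. \<Sum>Q\<in>S. if Q \<subseteq> R then c R * (a Q * emeasure \<mu> Q * indicator Q x) else 0)"
        unfolding local_op_finite[OF fin(1)] sum_distrib_left
        by (simp only: sum.inter_filter[OF fin(1)])
      also have "\<dots> = (\<Sum>Q\<in>S. \<Sum>R\<in>F. if Q \<subseteq> R then c R * (a Q * emeasure \<mu> Q * indicator Q x) else 0)"
        by (rule sum.swap)
      also have "\<dots> \<le> (\<Sum>Q\<in>S. a Q * (\<integral>\<^sup>+y\<in>Q. \<phi> y \<partial>\<mu>) * indicator Q x)"
      proof (rule sum_mono)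
        fix Q assume Q: "Q \<in> S"
        note [measurable] = cube_familyD(3)[OF S(1) Q]
        have "(\<Sum>R\<in>F. if Q \<subseteq> R then c R * emeasure \<mu> Q else 0)
            \<le> (\<Sum>R\<in>F. \<integral>\<^sup>+y. c R * (indicator R y * indicator Q y) \<partial>\<mu>)"
        proof (rule sum_mono)
          fix R assume R: "R \<in> F"
          have "c R * emeasure \<mu> Q = (\<integral>\<^sup>+y. c R * (indicator R y * indicator Q y) \<partial>\<mu>)" if "Q \<subseteq> R"
          proof -
            have "(\<integral>\<^sup>+y. c R * (indicator R y * indicator Q y) \<partial>\<mu>) = (\<integral>\<^sup>+y. c R * indicator Q y \<partial>\<mu>)"
              using that by (intro nn_integral_cong) (auto simp: indicator_def)
            then show ?thesis by (simp add: nn_integral_cmult_indicator)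
          qed
          then show "(if Q \<subseteq> R then c R * emeasure \<mu> Q else 0)
              \<le> (\<integral>\<^sup>+y. c R * (indicator R y * indicator Q y) \<partial>\<mu>)" by simp
        qed
        also have "\<dots> = (\<integral>\<^sup>+y. (\<Sum>R\<in>F. c R * (indicator R y * indicator Q y)) \<partial>\<mu>)"
          by (intro nn_integral_sum[symmetric]) measurable
        also have "\<dots> = (\<integral>\<^sup>+y\<in>Q. \<phi> y \<partial>\<mu>)"
          unfolding \<phi>_def by (simp add: sum_distrib_right mult.assoc)
        finally have "a Q * (\<Sum>R\<in>F. if Q \<subseteq> R then c R * emeasure \<mu> Q else 0) * indicator Q x
            \<le> a Q * (\<integral>\<^sup>+y\<in>Q. \<phi> y \<partial>\<mu>) * indicator Q x"
          by (intro mult_left_mono mult_right_mono) auto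
        also have "a Q * (\<Sum>R\<in>F. if Q \<subseteq> R then c R * emeasure \<mu> Q else 0) * indicator Q x
            = (\<Sum>R\<in>F. if Q \<subseteq> R then c R * (a Q * emeasure \<mu> Q * indicator Q x) else 0)"
          unfolding sum_distrib_left sum_distrib_right
          by (intro sum.cong refl) (auto simp: ac_simps)
        finally show "(\<Sum>R\<in>F. if Q \<subseteq> R then c R * (a Q * emeasure \<mu> Q * indicator Q x) else 0)
            \<le> a Q * (\<integral>\<^sup>+y\<in>Q. \<phi> y \<partial>\<mu>) * indicator Q x" .
      qed
      finally show ?thesis unfolding h_def .
    qed
    have [measurable]: "local_op \<mu> S a R \<in> borel_measurable \<nu>" for R
      unfolding local_op_finite[OF fin(1)] by (intro borel_measurable_sum) auto
    have expo: "q * (r / p) + q = r"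
    proof -
      have "q * (r / p) + q = q * r * (1 / p + 1 / r)" using 2(3) by (simp add: distrib_left)
      then show ?thesis using 2 pos by simp
    qed
    have "X = (\<Sum>R\<in>F. c R epowr q * (\<integral>\<^sup>+x. local_op \<mu> S a R x epowr q \<partial>\<nu>))"
      unfolding X_def
    proof (intro sum.cong refl)
      fix R assume R: "R \<in> F"
      have "(\<integral>\<^sup>+x. local_op \<mu> S a R x epowr q \<partial>\<nu>) = Lp_norm \<nu> q (local_op \<mu> S a R) epowr q"
        using pos by (simp add: Lp_norm_def epowr_inverse_cancel)
      then have "c R epowr q * (\<integral>\<^sup>+x. local_op \<mu> S a R x epowr q \<partial>\<nu>)
          = (c R * emeasure \<mu> R epowr (1 / p) * A R) epowr q"
        unfolding AN[OF R, symmetric] using pos by (simp add: epowr_mult ac_simps)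
      also have "\<dots> = A R epowr (q * (r / p) + q)"
        unfolding cm[OF R] using pos 2 by (subst epowr_add) (auto simp: epowr_mult epowr_epowr mult.commute)
      finally show "A R epowr r = c R epowr q * (\<integral>\<^sup>+x. local_op \<mu> S a R x epowr q \<partial>\<nu>)"
        unfolding expo ..
    qed
    also have "\<dots> = (\<integral>\<^sup>+x. (\<Sum>R\<in>F. (c R * local_op \<mu> S a R x) epowr q) \<partial>\<nu>)"
      using pos by (subst nn_integral_sum) (auto simp: epowr_mult nn_integral_cmult)
    also have "\<dots> \<le> (\<integral>\<^sup>+x. h x epowr q \<partial>\<nu>)"
    proof (intro nn_integral_mono)
      fix x
      have "(\<Sum>R\<in>F. (c R * local_op \<mu> S a R x) epowr q) \<le> (\<Sum>R\<in>F. c R * local_op \<mu> S a R x) epowr q"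
        using pq fin by (intro sum_epowr_le) auto
      also have "\<dots> \<le> h x epowr q" using pos hlow by (intro epowr_mono) auto
      finally show "(\<Sum>R\<in>F. (c R * local_op \<mu> S a R x) epowr q) \<le> h x epowr q" .
    qed
    also have "\<dots> = Lp_norm \<nu> q h epowr q"
      using pos by (simp add: Lp_norm_def epowr_inverse_cancel)
    also have "\<dots> \<le> (N * (ennreal (C0 powr (1 / p)) * X epowr (1 / p))) epowr q"
      using pos by (intro epowr_mono hN) auto
    also have "\<dots> = (ennreal (C0 powr (1 / p)) * N) epowr q * X epowr (1 / (p / q))"
      using pos by (simp add: epowr_mult epowr_epowr ac_simps)
    finally have "X \<le> ((ennreal (C0 powr (1 / p)) * N) epowr q) epowr (r / q)"
    proof (intro epowr_absorb[of "r / q" "p / q" X])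
      have "1 / (r / q) + 1 / (p / q) = q * (1 / p + 1 / r)" by (simp add: field_simps)
      then show "1 / (r / q) + 1 / (p / q) = 1" using 2 pos by simp
    qed (use pos 2 X in auto)
    then have "X \<le> (ennreal (C0 powr (1 / p)) * N) epowr r"
      using pos 2 by (simp add: epowr_epowr)
    then have "X epowr (1 / r) \<le> ((ennreal (C0 powr (1 / p)) * N) epowr r) epowr (1 / r)"
      using 2(3) by (intro epowr_mono) auto
    then have "X epowr (1 / r) \<le> ennreal (C0 powr (1 / p)) * N"
      using 2(3) by (simp add: epowr_inverse_cancel)
    also have "C0 powr (1 / p) = (2 * maximal_const p') powr (1 / p')"
      using pos by (simp add: C0_def powr_powr)
    also have "ennreal \<dots> * N \<le> ennreal (lower_const p') * N"
      by (intro mult_right_mono ennreal_leI) (auto simp: lower_const_def)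
    finally show ?thesis
      using 2 fin by (simp add: ell_norm_def Lp_norm_def nn_integral_count_space_finite X_def)
  qed
  then show ?thesis by (simp add: A_def[abs_def])
qed

section \<open>Countable families\<close>

lemma local_op_SUP:
  assumes J: "incseq J" "(\<Union>n. J n) = S"
  shows "local_op \<mu> S a R x = (SUP n. local_op \<mu> (J n) a R x)"
proof -
  have "{Q \<in> S. Q \<subseteq> R} = (\<Union>n. {Q \<in> J n. Q \<subseteq> R})" using J(2) by auto
  moreover have "incseq (\<lambda>n. {Q \<in> J n. Q \<subseteq> R})" using J(1) by (auto simp: incseq_def subset_iff)
  ultimately show ?thesis
    unfolding local_op_def by (simp add: nn_integral_count_space_Union)
qed

lemma local_op_mono: "S' \<subseteq> S \<Longrightarrow> local_op \<mu> S' a R x \<le> local_op \<mu> S a R x"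
  unfolding local_op_def by (intro nn_integral_count_space_mono_set) auto

lemma ell_norm_mono:
  assumes "\<And>i. i \<in> I \<Longrightarrow> A i \<le> B i" shows "ell_norm s I A \<le> ell_norm s I B"
  using assms unfolding ell_norm_def Lp_norm_def
  by (auto intro!: SUP_mono' epowr_mono nn_integral_mono simp: SUP_subset_mono)

lemma testing_mono:
  assumes "S' \<subseteq> S" "0 < q" shows "testing \<mu> \<nu> S' a s p q \<le> testing \<mu> \<nu> S a s p q"
  unfolding testing_def
proof (rule SUP_mono)
  fix F assume F: "F \<in> {F. F \<subseteq> S' \<and> sparse_family \<mu> F}"
  have "ell_norm s F (\<lambda>R. Lp_norm \<nu> q (local_op \<mu> S' a R) / emeasure \<mu> R epowr (1 / p))
      \<le> ell_norm s F (\<lambda>R. Lp_norm \<nu> q (local_op \<mu> S a R) / emeasure \<mu> R epowr (1 / p))"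
    using assms by (intro ell_norm_mono divide_right_mono_ennreal Lp_norm_mono local_op_mono) auto
  then show "\<exists>F'\<in>{F. F \<subseteq> S \<and> sparse_family \<mu> F}.
      ell_norm s F (\<lambda>R. Lp_norm \<nu> q (local_op \<mu> S' a R) / emeasure \<mu> R epowr (1 / p))
      \<le> ell_norm s F' (\<lambda>R. Lp_norm \<nu> q (local_op \<mu> S a R) / emeasure \<mu> R epowr (1 / p))"
    using F assms(1) by (intro bexI[of _ F]) auto
qed

lemma Lp_norm_SUP:
  assumes "0 < t" "\<And>n. h n \<in> borel_measurable \<mu>" "incseq h"
  shows "Lp_norm \<mu> t (\<lambda>x. SUP n. h n x) = (SUP n. Lp_norm \<mu> t (h n))"
proof -
  have inc: "incseq (\<lambda>n. h n x)" for x using assms(3) by (auto simp: incseq_def le_fun_def)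
  have "(\<integral>\<^sup>+x. (SUP n. h n x) epowr t \<partial>\<mu>) = (\<integral>\<^sup>+x. (SUP n. h n x epowr t) \<partial>\<mu>)"
    using assms(1) inc by (simp add: epowr_SUP)
  also have "\<dots> = (SUP n. \<integral>\<^sup>+x. h n x epowr t \<partial>\<mu>)"
    using assms inc by (intro nn_integral_monotone_convergence_SUP)
      (auto simp: incseq_def le_fun_def intro!: epowr_mono)
  finally have "Lp_norm \<mu> t (\<lambda>x. SUP n. h n x) = (SUP n. \<integral>\<^sup>+x. h n x epowr t \<partial>\<mu>) epowr (1 / t)"
    by (simp add: Lp_norm_def)
  also have "\<dots> = (SUP n. Lp_norm \<mu> t (h n))"
    unfolding Lp_norm_def using assms inc
    by (intro epowr_SUP) (auto simp: incseq_def intro!: nn_integral_mono epowr_mono)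
  finally show ?thesis .
qed

text \<open>
  Monotone convergence in the summands and in the index set together.
\<close>

lemma ell_norm_SUP_le:
  assumes I: "countable I" and A: "\<And>i. i \<in> I \<Longrightarrow> A i = (SUP n. B n i)" "\<And>i. incseq (\<lambda>n. B n i)"
    and s: "s \<noteq> 0" and le: "\<And>n J. finite J \<Longrightarrow> J \<subseteq> I \<Longrightarrow> ell_norm s J (B n) \<le> b"
  shows "ell_norm s I A \<le> b"
proof (cases "s = top")
  case True
  have "B n i \<le> b" if "i \<in> I" for n i
    using le[of "{i}" n] that True by (simp add: ell_norm_def)
  then show ?thesis using True A(1) by (auto simp: ell_norm_def intro!: SUP_least)
next
  case False
  define r where "r = enn2real s"
  have r: "0 < r" using s False by (simp add: r_def enn2real_positive_iff less_top zero_less_iff_neq_zero)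
  obtain J where J: "incseq J" "\<And>n. finite (J n)" "\<And>n. J n \<subseteq> I" "(\<Union>n. J n) = I"
    using countable_finite_exhaustion[OF I] by metis
  have "(\<integral>\<^sup>+i. A i epowr r \<partial>count_space I) = (\<integral>\<^sup>+i. (SUP n. B n i epowr r) \<partial>count_space I)"
    using A r by (intro nn_integral_cong) (simp add: epowr_SUP)
  also have "\<dots> = (SUP n. \<integral>\<^sup>+i. B n i epowr r \<partial>count_space I)"
    using A(2) r by (intro nn_integral_monotone_convergence_SUP)
      (auto simp: incseq_def le_fun_def intro!: epowr_mono)
  also have "\<dots> \<le> b epowr r"
  proof (rule SUP_least)
    fix n
    have "(\<integral>\<^sup>+i. B n i epowr r \<partial>count_space (J m)) \<le> b epowr r" for m
      using le[OF J(2,3), of m n] epowr_mono[of r "ell_norm s (J m) (B n)" b] r False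
      by (simp add: ell_norm_def Lp_norm_def r_def[symmetric] epowr_inverse_cancel)
    then show "(\<integral>\<^sup>+i. B n i epowr r \<partial>count_space I) \<le> b epowr r"
      using nn_integral_count_space_Union[OF J(1), of "\<lambda>i. B n i epowr r"] J(4)
      by (simp add: SUP_least)
  qed
  finally have "(\<integral>\<^sup>+i. A i epowr r \<partial>count_space I) epowr (1 / r) \<le> (b epowr r) epowr (1 / r)"
    using r by (intro epowr_mono) auto
  then show ?thesis
    using r False by (simp add: ell_norm_def Lp_norm_def r_def[symmetric] epowr_inverse_cancel)
qed

theorem testing_necessary:
  assumes S: "countable S" "\<And>J. finite J \<Longrightarrow> J \<subseteq> S \<Longrightarrow> cube_family \<mu> J"
      "\<And>J. finite J \<Longrightarrow> J \<subseteq> S \<Longrightarrow> cube_family \<nu> J"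
    and a: "\<And>Q. Q \<in> S \<Longrightarrow> a Q < top"
    and pq: "1 < p" "1 < p'" "1 / p + 1 / p' = 1" "1 < q" "1 < q'" "1 / q + 1 / q' = 1"
    and s: "inverse s = ennreal (max (1 / q - 1 / p) 0)"
    and N: "form_bounded \<mu> \<nu> S a p q' N" "N < top"
  shows "testing \<mu> \<nu> S a s p q \<le> ennreal (lower_const p') * N"
  unfolding testing_def
proof (rule SUP_least)
  fix F assume "F \<in> {F. F \<subseteq> S \<and> sparse_family \<mu> F}"
  then have F: "F \<subseteq> S" "sparse_family \<mu> F" by auto
  obtain J where J: "incseq J" "\<And>n. finite (J n)" "\<And>n. J n \<subseteq> S" "(\<Union>n. J n) = S"
    using countable_finite_exhaustion[OF S(1)] by metis
  have s0: "s \<noteq> 0" using s by auto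
  have q: "0 < q" using pq by simp
  have meas: "local_op \<mu> (J n) a R \<in> borel_measurable \<nu>" for n R
    unfolding local_op_finite[OF J(2)] using cube_familyD(3)[OF S(3)[OF J(2,3)]]
    by (intro borel_measurable_sum) auto
  have inc: "incseq (\<lambda>n. local_op \<mu> (J n) a R)" for R
    using J(1) by (auto simp: incseq_def le_fun_def intro!: local_op_mono)
  have sup: "Lp_norm \<nu> q (local_op \<mu> S a R) = (SUP n. Lp_norm \<nu> q (local_op \<mu> (J n) a R))" for R
  proof -
    have "local_op \<mu> S a R = (\<lambda>x. SUP n. local_op \<mu> (J n) a R x)"
      by (rule ext) (rule local_op_SUP[OF J(1,4)])
    then show ?thesis by (simp only: Lp_norm_SUP[OF q meas inc])
  qed
  show "ell_norm s F (\<lambda>R. Lp_norm \<nu> q (local_op \<mu> S a R) / emeasure \<mu> R epowr (1 / p))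
      \<le> ennreal (lower_const p') * N"
  proof (rule ell_norm_SUP_le[where B = "\<lambda>n R. Lp_norm \<nu> q (local_op \<mu> (J n) a R) / emeasure \<mu> R epowr (1 / p)"])
    show "countable F" using S(1) F(1) countable_subset by blast
    show "Lp_norm \<nu> q (local_op \<mu> S a R) / emeasure \<mu> R epowr (1 / p)
        = (SUP n. Lp_norm \<nu> q (local_op \<mu> (J n) a R) / emeasure \<mu> R epowr (1 / p))" for R
      unfolding sup by (simp add: SUP_divide_ennreal)
    show "incseq (\<lambda>n. Lp_norm \<nu> q (local_op \<mu> (J n) a R) / emeasure \<mu> R epowr (1 / p))" for R
      using inc[of R] q unfolding incseq_def le_fun_def
      by (auto intro!: divide_right_mono_ennreal Lp_norm_mono)
    show "s \<noteq> 0" by (rule s0)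
    fix n H assume H: "finite H" "H \<subseteq> F"
    have "sparse_family \<mu> H"
      unfolding sparse_family_def
    proof
      fix R assume R: "R \<in> H"
      have "\<Union>{R' \<in> F. R' \<subset> R} \<in> sets \<mu>"
      proof (rule sets.countable_Union)
        show "countable {R' \<in> F. R' \<subset> R}"
          using S(1) F(1) by (auto intro: countable_subset[of _ S])
        show "{R' \<in> F. R' \<subset> R} \<subseteq> sets \<mu>"
        proof
          fix R' assume "R' \<in> {R' \<in> F. R' \<subset> R}"
          then have "cube_family \<mu> {R'}" using F(1) by (intro S(2)) auto
          then show "R' \<in> sets \<mu>" by (rule cube_familyD(3)) simp
        qed
      qed
      then have "emeasure \<mu> (\<Union>{R' \<in> H. R' \<subset> R}) \<le> emeasure \<mu> (\<Union>{R' \<in> F. R' \<subset> R})"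
        using H by (intro emeasure_mono) auto
      also have "\<dots> \<le> emeasure \<mu> R / 2"
        using F(2) R H unfolding sparse_family_def by blast
      finally show "emeasure \<mu> (\<Union>{R' \<in> H. R' \<subset> R}) \<le> emeasure \<mu> R / 2" .
    qed
    then show "ell_norm s H (\<lambda>R. Lp_norm \<nu> q (local_op \<mu> (J n) a R) / emeasure \<mu> R epowr (1 / p))
        \<le> ennreal (lower_const p') * N"
      using J(3)[of n] H F(1) a
      by (intro testing_necessary_finite[OF S(2,3)[OF J(2,3)] _ pq s
            form_bounded_subset[OF N(1) J(3)] N(2) S(2)]) auto
  qed
qed

theorem testing_sufficient_countable:
  assumes S: "countable S" "\<And>J. finite J \<Longrightarrow> J \<subseteq> S \<Longrightarrow> cube_family \<mu> J"
      "\<And>J. finite J \<Longrightarrow> J \<subseteq> S \<Longrightarrow> cube_family \<nu> J"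
    and f: "f \<in> borel_measurable \<mu>" and g: "g \<in> borel_measurable \<nu>"
    and pq: "1 < p" "1 < p'" "1 / p + 1 / p' = 1" "1 < q" "1 < q'" "1 / q + 1 / q' = 1"
    and s: "inverse s = ennreal (max (1 / q - 1 / p) 0)"
    and rt: "1 \<le> r" "r < p" "1 \<le> t" "t < q'"
  shows "(\<integral>\<^sup>+Q. a Q * (pavg \<mu> r f Q * emeasure \<mu> Q) * (pavg \<nu> t g Q * emeasure \<nu> Q) \<partial>count_space S)
    \<le> ennreal (upper_const r t p q') * (testing \<mu> \<nu> S a s p q + testing \<nu> \<mu> S a s q' p')
        * (Lp_norm \<mu> p f * Lp_norm \<nu> q' g)"
proof -
  obtain J where J: "incseq J" "\<And>n. finite (J n)" "\<And>n. J n \<subseteq> S" "(\<Union>n. J n) = S"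
    using countable_finite_exhaustion[OF S(1)] by metis
  let ?h = "\<lambda>Q. a Q * (pavg \<mu> r f Q * emeasure \<mu> Q) * (pavg \<nu> t g Q * emeasure \<nu> Q)"
  have "(\<integral>\<^sup>+Q. ?h Q \<partial>count_space (J n))
      \<le> ennreal (upper_const r t p q') * (testing \<mu> \<nu> S a s p q + testing \<nu> \<mu> S a s q' p')
        * (Lp_norm \<mu> p f * Lp_norm \<nu> q' g)" for n
  proof -
    have "(\<integral>\<^sup>+Q. ?h Q \<partial>count_space (J n)) = (\<Sum>Q\<in>J n. ?h Q)"
      by (rule nn_integral_count_space_finite[OF J(2)])
    also have "\<dots> \<le> ennreal (upper_const r t p q')
        * (testing \<mu> \<nu> (J n) a s p q + testing \<nu> \<mu> (J n) a s q' p') * (Lp_norm \<mu> p f * Lp_norm \<nu> q' g)"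
      by (rule testing_sufficient_pavg[OF S(2,3)[OF J(2,3)] f g pq s rt])
    also have "\<dots> \<le> ennreal (upper_const r t p q') * (testing \<mu> \<nu> S a s p q + testing \<nu> \<mu> S a s q' p')
        * (Lp_norm \<mu> p f * Lp_norm \<nu> q' g)"
      using pq by (intro mult_left_mono mult_right_mono add_mono testing_mono J(3)) auto
    finally show ?thesis .
  qed
  then show ?thesis
    using nn_integral_count_space_Union[OF J(1), of ?h] J(4) by (simp add: SUP_least)
qed

section \<open>Dyadic cubes, weights and the change of function\<close>

lemma doubling_spaceD:
  fixes M :: "'a::metric_space measure"
  assumes "doubling_space M"
  shows "locally_compact_space (euclidean :: 'a topology)" "sets M = sets borel"
    "compact K \<Longrightarrow> emeasure M K < top" "open U \<Longrightarrow> U \<noteq> {} \<Longrightarrow> 0 < emeasure M U"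
    "\<exists>B::real. \<forall>x r. 0 < r \<longrightarrow> emeasure M (ball x (2 * r)) \<le> ennreal B * emeasure M (ball x r)"
  using assms unfolding doubling_space_def by simp_all

text \<open>
  Some ball around \<open>x\<close> lies in a compact set; doubling passes to larger radii.
\<close>

lemma doubling_space_ball_finite:
  fixes M :: "'a::metric_space measure"
  assumes M: "doubling_space M"
  shows "emeasure M (ball x r) < top"
proof -
  obtain B :: real where B: "\<And>x r. 0 < r \<Longrightarrow> emeasure M (ball x (2 * r)) \<le> ennreal B * emeasure M (ball x r)"
    using doubling_spaceD(5)[OF M] by auto
  note sM = doubling_spaceD(2)[OF M]
  have "\<exists>U. open U \<and> (\<exists>K. compact K \<and> x \<in> U \<and> U \<subseteq> K)"
    using doubling_spaceD(1)[OF M] unfolding locally_compact_space_def by auto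
  then obtain U K where UK: "open U" "compact K" "x \<in> U" "U \<subseteq> K" by blast
  obtain e where e: "0 < e" "ball x e \<subseteq> U" using UK by (meson openE)
  have "emeasure M (ball x e) \<le> emeasure M K"
    using e UK sM by (intro emeasure_mono) (auto simp: compact_imp_closed)
  also have "\<dots> < top" using doubling_spaceD(3)[OF M] UK by blast
  finally have e0: "emeasure M (ball x e) < top" .
  have "emeasure M (ball x (2 ^ n * e)) < top" for n
  proof (induction n)
    case (Suc n)
    have "emeasure M (ball x (2 * (2 ^ n * e))) \<le> ennreal B * emeasure M (ball x (2 ^ n * e))"
      using e by (intro B) simp
    also have "\<dots> < top" using Suc by (simp add: ennreal_mult_less_top)
    finally show ?case by (simp add: mult.assoc)
  qed (use e0 in simp)
  moreover obtain n where "r / e < 2 ^ n" using real_arch_pow[of 2 "r / e"] by auto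
  then have "ball x r \<subseteq> ball x (2 ^ n * e)" using e by (intro subset_ball) (simp add: field_simps)
  then have "emeasure M (ball x r) \<le> emeasure M (ball x (2 ^ n * e))"
    using sM by (intro emeasure_mono) auto
  ultimately show ?thesis by (meson le_less_trans)
qed

lemma dyadic_cube:
  fixes M :: "'a::metric_space measure"
  assumes M: "doubling_space M" and D: "dyadic_system D" and Q: "Q \<in> (\<Union>k. D k)"
  shows "Q \<in> sets M" "0 < emeasure M Q" "emeasure M Q < top" "\<exists>z r. Q \<subseteq> ball z r"
proof -
  note sM = doubling_spaceD(2)[OF M]
  obtain k where k: "Q \<in> D k" using Q by blast
  show Qs: "Q \<in> sets M" using D k sM unfolding dyadic_system_def by auto
  obtain \<delta> c C :: real where \<delta>: "0 < \<delta>" "0 < c"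
    "\<forall>k. \<forall>Q\<in>D k. \<exists>z. ball z (c * \<delta> powi k) \<subseteq> Q \<and> Q \<subseteq> ball z (C * \<delta> powi k)"
    using D unfolding dyadic_system_def by (elim conjE exE)
  obtain z where z: "ball z (c * \<delta> powi k) \<subseteq> Q" "Q \<subseteq> ball z (C * \<delta> powi k)"
    using \<delta>(3) k by blast
  then show "\<exists>z r. Q \<subseteq> ball z r" by blast
  have "0 < emeasure M (ball z (c * \<delta> powi k))"
    using \<delta> by (intro doubling_spaceD(4)[OF M]) (auto simp: not_le)
  also have "\<dots> \<le> emeasure M Q" using z Qs by (intro emeasure_mono)
  finally show "0 < emeasure M Q" .
  have "emeasure M Q \<le> emeasure M (ball z (C * \<delta> powi k))"
    using z sM by (intro emeasure_mono) auto
  then show "emeasure M Q < top" using doubling_space_ball_finite[OF M] by (rule le_less_trans)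
qed

lemma weight_measure_pos_finite:
  fixes M :: "'a::metric_space measure"
  assumes u: "weight M u" and Q: "Q \<in> sets M" "0 < emeasure M Q" "Q \<subseteq> ball z r"
  shows "0 < emeasure (wmeasure M u) Q" "emeasure (wmeasure M u) Q < top"
proof -
  have [measurable]: "u \<in> borel_measurable M" and pos: "AE x in M. 0 < u x"
    and int: "set_integrable M (ball z r) u"
    using u unfolding weight_def by auto
  note [measurable] = Q(1)
  have eq: "emeasure (wmeasure M u) Q = (\<integral>\<^sup>+x\<in>Q. ennreal (u x) \<partial>M)"
    by (subst emeasure_density) auto
  have "(\<integral>\<^sup>+x\<in>Q. ennreal (u x) \<partial>M) \<le> (\<integral>\<^sup>+x. ennreal (norm (indicator (ball z r) x *\<^sub>R u x)) \<partial>M)"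
    using Q(3) by (intro nn_integral_mono) (auto simp: indicator_def intro!: ennreal_leI)
  also have "\<dots> < top"
    using int unfolding set_integrable_def integrable_iff_bounded by (simp add: less_top[symmetric] top_ennreal_def)
  finally show "emeasure (wmeasure M u) Q < top" unfolding eq .
  show "0 < emeasure (wmeasure M u) Q"
  proof (rule ccontr)
    assume "\<not> 0 < emeasure (wmeasure M u) Q"
    then have "(\<integral>\<^sup>+x\<in>Q. ennreal (u x) \<partial>M) = 0" unfolding eq by (simp add: zero_less_iff_neq_zero)
    then have "AE x in M. ennreal (u x) * indicator Q x = 0"
      by (subst (asm) nn_integral_0_iff_AE) auto
    with pos have "AE x in M. x \<notin> Q"
      by eventually_elim (auto simp: indicator_def ennreal_eq_0_iff split: if_splits)
    then have "emeasure M Q = 0" using Q(1) by (simp add: AE_iff_null_sets[symmetric] null_sets_def)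
    then show False using Q(2) by simp
  qed
qed

lemma avg_weight:
  assumes "u \<in> borel_measurable M" "Q \<in> sets M"
  shows "avg M (\<lambda>x. ennreal (u x)) Q = emeasure (wmeasure M u) Q / emeasure M Q"
  unfolding avg_def using assms by (subst emeasure_density) auto

lemma testing_const_eq_testing:
  assumes u: "u \<in> borel_measurable M" and S: "S \<subseteq> sets M"
  shows "testing_const M S t s p q u v
    = testing (wmeasure M u) (wmeasure M v) S (\<lambda>Q. t Q / emeasure M Q) s p q"
proof -
  have "T_op M S t F u x = local_op (wmeasure M u) S (\<lambda>Q. t Q / emeasure M Q) F x" for F x
    unfolding T_op_def local_op_def
  proof (intro nn_integral_cong)
    fix Q assume "Q \<in> space (count_space {Q \<in> S. Q \<subseteq> F})"
    then have Q: "Q \<in> sets M" using S by auto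
    then show "t Q * avg M (\<lambda>y. ennreal (u y)) Q * indicator Q x
        = t Q / emeasure M Q * emeasure (wmeasure M u) Q * indicator Q x"
      unfolding avg_weight[OF u Q] divide_ennreal_def by (simp only: ac_simps)
  qed
  then have "T_op M S t F u = local_op (wmeasure M u) S (\<lambda>Q. t Q / emeasure M Q) F" for F by blast
  then show ?thesis unfolding testing_const_def testing_def by simp
qed

text \<open>
  The exponent of \<open>u\<close> is chosen so that \<open>u\<^bsup>1-p/r\<^esup> = w\<close>.
\<close>

lemma change_of_function:
  fixes f u w :: "'a \<Rightarrow> real"
  assumes [measurable]: "f \<in> borel_measurable M" "w \<in> borel_measurable M" and w: "AE x in M. 0 < w x"
    and u: "u = (\<lambda>x. w x powr (r / (r - p)))" and r: "0 < r" "r < p"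
    and F: "F = (\<lambda>x. ennreal (\<bar>f x\<bar> * u x powr (- 1 / r)))"
  shows "Lp_norm (wmeasure M u) p F = Lp_norm (wmeasure M w) p (\<lambda>x. ennreal \<bar>f x\<bar>)"
    and "\<And>Q. Q \<in> sets M \<Longrightarrow> (\<integral>\<^sup>+x\<in>Q. F x epowr r \<partial>wmeasure M u) = (\<integral>\<^sup>+x\<in>Q. ennreal (\<bar>f x\<bar> powr r) \<partial>M)"
proof -
  have [measurable]: "u \<in> borel_measurable M" unfolding u by measurable
  have [measurable]: "F \<in> borel_measurable M" unfolding F by measurable
  have "(\<integral>\<^sup>+x. F x epowr p \<partial>wmeasure M u) = (\<integral>\<^sup>+x. ennreal (u x) * F x epowr p \<partial>M)"
    by (rule nn_integral_density) measurable
  also have "\<dots> = (\<integral>\<^sup>+x. ennreal (w x) * ennreal \<bar>f x\<bar> epowr p \<partial>M)"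
  proof (intro nn_integral_cong_AE, use w in eventually_elim)
    case (elim x)
    have "u x * (\<bar>f x\<bar> * u x powr (- 1 / r)) powr p = u x * (u x powr (- p / r) * \<bar>f x\<bar> powr p)"
      by (simp add: powr_mult powr_powr)
    also have "\<dots> = u x powr (1 - p / r) * \<bar>f x\<bar> powr p"
      using elim powr_add[of "u x" 1 "- p / r"] by (simp add: u mult.assoc)
    also have "u x powr (1 - p / r) = w x"
    proof -
      have e: "r / (r - p) * (1 - p / r) = 1" using r by (simp add: field_simps)
      have "u x powr (1 - p / r) = w x powr (r / (r - p) * (1 - p / r))" by (simp add: u powr_powr)
      then show ?thesis unfolding e using elim by simp
    qed
    finally show ?case
      using elim r by (simp add: F epowr_ennreal u flip: ennreal_mult)
  qed
  also have "\<dots> = (\<integral>\<^sup>+x. ennreal \<bar>f x\<bar> epowr p \<partial>wmeasure M w)"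
    by (rule nn_integral_density[symmetric]) measurable
  finally show "Lp_norm (wmeasure M u) p F = Lp_norm (wmeasure M w) p (\<lambda>x. ennreal \<bar>f x\<bar>)"
    by (simp add: Lp_norm_def)
  fix Q assume [measurable]: "Q \<in> sets M"
  have "(\<integral>\<^sup>+x\<in>Q. F x epowr r \<partial>wmeasure M u) = (\<integral>\<^sup>+x. ennreal (u x) * (F x epowr r * indicator Q x) \<partial>M)"
    by (rule nn_integral_density) measurable
  also have "\<dots> = (\<integral>\<^sup>+x\<in>Q. ennreal (\<bar>f x\<bar> powr r) \<partial>M)"
  proof (intro nn_integral_cong_AE, use w in eventually_elim)
    case (elim x)
    have ux: "0 < u x" using elim by (simp add: u)
    have "(u x powr (- 1 / r)) powr r = 1 / u x"
      using ux r unfolding powr_powr by (simp add: powr_neg_one)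
    then have "u x * (\<bar>f x\<bar> * u x powr (- 1 / r)) powr r = \<bar>f x\<bar> powr r"
      using ux by (simp add: powr_mult)
    then have "ennreal (u x) * F x epowr r = ennreal (\<bar>f x\<bar> powr r)"
      using ux r by (simp add: F epowr_ennreal flip: ennreal_mult)
    then show ?case by (simp add: mult.assoc[symmetric])
  qed
  finally show "(\<integral>\<^sup>+x\<in>Q. F x epowr r \<partial>wmeasure M u) = (\<integral>\<^sup>+x\<in>Q. ennreal (\<bar>f x\<bar> powr r) \<partial>M)" .
qed

text \<open>
  The inverse of the substitution in \<open>change_of_function\<close>; it holds almost everywhere only,
  because weights are positive almost everywhere only.
\<close>

lemma recover_function:
  assumes F: "F \<in> borel_measurable M" "\<And>x. F x < top" and pos: "AE x in M. 0 < \<omega> x"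
    and f: "f = (\<lambda>x. enn2real (F x) * \<omega> x powr (1 / r))"
  shows "AE x in M. ennreal (\<bar>f x\<bar> * \<omega> x powr (- 1 / r)) = F x"
  using pos
proof eventually_elim
  case (elim x)
  have "\<omega> x powr (1 / r) * \<omega> x powr (- 1 / r) = 1"
    using elim by (simp add: powr_add[symmetric])
  then have "\<bar>f x\<bar> * \<omega> x powr (- 1 / r) = enn2real (F x)"
    by (simp add: f abs_mult mult.assoc)
  then show ?case using F(2)[of x] by simp
qed

lemma AE_weighted_cong:
  assumes "AE x in M. F x = F' x" "\<omega> \<in> borel_measurable M"
  shows "AE x in wmeasure M \<omega>. F x = F' x"
  using assms by (subst AE_density) auto

lemma avg_root_eq:
  assumes Q: "emeasure M Q \<noteq> 0" "emeasure M Q < top" "0 < emeasure \<mu> Q" "emeasure \<mu> Q < top" and r: "0 < r"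
    and eq: "(\<integral>\<^sup>+x\<in>Q. F x epowr r \<partial>\<mu>) = (\<integral>\<^sup>+x\<in>Q. h x \<partial>M)"
  shows "avg M h Q epowr (1 / r) = pavg \<mu> r F Q * (emeasure \<mu> Q / emeasure M Q) epowr (1 / r)"
proof -
  have "avg M h Q = avg \<mu> (\<lambda>x. F x epowr r) Q * (emeasure \<mu> Q / emeasure M Q)"
    unfolding avg_def[of M] eq[symmetric] avg_times_emeasure[OF Q(3,4), symmetric] divide_ennreal_def
    by (simp only: mult.assoc)
  then show ?thesis using r by (simp add: pavg_def epowr_mult)
qed

lemma epowr_one_minus:
  assumes "0 < x" "x < top" shows "x epowr (1 - e) = x * x epowr (- e)"
proof -
  obtain y where y: "x = ennreal y" "0 < y"
    using assms by (cases x) (auto simp: ennreal_less_zero_iff)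
  show ?thesis using y
    by (simp add: ennpowr_ennreal powr_diff powr_minus divide_inverse flip: ennreal_mult)
qed

text \<open>
  With \<open>U\<close>, \<open>V\<close>, \<open>m\<close> the masses \<open>u(Q)\<close>,
  \<open>v(Q)\<close>, \<open>|Q|\<close> and \<open>l = \<lambda>\<^sub>Q\<close>, the right-hand side
  is \<open>(\<tau>\<^sub>Q / |Q|) u(Q) v(Q)\<close>.
\<close>

lemma sparse_coefficient:
  fixes U V m l :: ennreal
  assumes U: "0 < U" "U < top" and V: "0 < V" "V < top" and m: "m \<noteq> 0" "m < top"
    and e: "1 / r = 1 - e" "1 / t = 1 - k"
  shows "(U / m) epowr (1 / r) * (V / m) epowr (1 / t) * l
    = ((U / m) epowr (- e) * (V / m) epowr (- k) * (l / m)) / m * U * V"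
proof -
  have pos: "0 < x / m" "x / m < top" if "0 < x" "x < top" for x
    using that m by (auto simp: ennreal_zero_less_divide ennreal_divide_eq_top_iff less_top[symmetric])
  show ?thesis
    unfolding e epowr_one_minus[OF pos[OF U]] epowr_one_minus[OF pos[OF V]]
    unfolding divide_ennreal_def by (simp only: ac_simps)
qed

section \<open>The sparse form\<close>

lemma conj_exp_bounds:
  fixes q0 :: ennreal
  assumes "1 < q" "ennreal q < q0"
  shows "1 \<le> enn2real (conj_exp q0)" "enn2real (conj_exp q0) < q / (q - 1)"
    "1 / enn2real (conj_exp q0) = 1 - enn2real (inverse q0)"
proof -
  have "1 \<le> enn2real (conj_exp q0) \<and> enn2real (conj_exp q0) < q / (q - 1)
    \<and> 1 / enn2real (conj_exp q0) = 1 - enn2real (inverse q0)"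
  proof (cases q0)
    case top
    then show ?thesis using assms by (simp add: conj_exp_top)
  next
    case (real r)
    then have r: "q < r" using assms by (simp add: ennreal_less_iff)
    then have c: "enn2real (conj_exp q0) = r / (r - 1)"
      using conj_exp_real[of r] real assms by simp
    have i: "enn2real (inverse q0) = 1 / r"
      using real r assms by (simp add: inverse_ennreal inverse_eq_divide)
    show ?thesis unfolding c i using r assms(1) by (auto simp: field_simps)
  qed
  then show "1 \<le> enn2real (conj_exp q0)" "enn2real (conj_exp q0) < q / (q - 1)"
    "1 / enn2real (conj_exp q0) = 1 - enn2real (inverse q0)" by auto
qed

lemma inverse_conj_exp_real:
  assumes "1 \<le> r" shows "1 / r = 1 - enn2real (inverse (conj_exp (ennreal r)))"
proof (cases "r = 1")
  case True
  then show ?thesis by (simp add: conj_exp_1)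
next
  case False
  then have r: "1 < r" using assms by simp
  then have "inverse (conj_exp (ennreal r)) = ennreal ((r - 1) / r)"
    by (simp add: conj_exp_real inverse_ennreal)
  then show ?thesis using r by (simp add: field_simps)
qed

lemma conj_exp_enn2real:
  assumes "1 < q" shows "1 < enn2real (conj_exp (ennreal q))" "1 / q + 1 / enn2real (conj_exp (ennreal q)) = 1"
    "enn2real (conj_exp (ennreal q)) = q / (q - 1)"
  using assms by (simp_all add: conj_exp_real field_simps)

text \<open>
  The exponent conditions are stated for real \<open>p'\<close>, \<open>q'\<close>, \<open>q0'\<close>,
  so that the two possibilities \<open>q\<^sub>0 < \<infinity>\<close> and \<open>q\<^sub>0 =
  \<infinity>\<close> need no separate treatment; \<open>p0_eq\<close> and \<open>q0_eq\<close> tie them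
  to the exponents occurring in \<^const>\<open>tau\<close>.
\<close>

locale weighted_sparse_form =
  fixes M :: "'a::metric_space measure" and D :: "int \<Rightarrow> 'a set set" and S :: "'a set set"
    and lam :: "'a set \<Rightarrow> real" and w \<sigma> u v :: "'a \<Rightarrow> real"
    and p0 p p' q q' q0' :: real and q0 :: ennreal
  assumes M: "doubling_space M" and D: "dyadic_system D" and S: "S \<subseteq> (\<Union>k. D k)"
    and w: "weight M w" and \<sigma>: "weight M \<sigma>" and u: "weight M u" and v: "weight M v"
    and u_eq: "u = (\<lambda>x. w x powr (p0 / (p0 - p)))"
    and v_eq: "v = (\<lambda>x. \<sigma> x powr (q0' / (q0' - q')))"
    and p0: "1 \<le> p0" "p0 < p" and q0': "1 \<le> q0'" "q0' < q'" "q0' = enn2real (conj_exp q0)"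
    and pq: "1 < p" "1 < p'" "1 / p + 1 / p' = 1" "1 < q" "1 < q'" "1 / q + 1 / q' = 1"
    and p0_eq: "1 / p0 = 1 - enn2real (inverse (conj_exp (ennreal p0)))"
    and q0_eq: "1 / q0' = 1 - enn2real (inverse q0)"
begin

abbreviation "\<mu> \<equiv> wmeasure M u"
abbreviation "\<nu> \<equiv> wmeasure M v"

definition coeff :: "'a set \<Rightarrow> ennreal" where
  "coeff Q = tau M p0 q0 lam u v Q / emeasure M Q"

lemma measurable_weights [measurable]:
  "w \<in> borel_measurable M" "\<sigma> \<in> borel_measurable M" "u \<in> borel_measurable M" "v \<in> borel_measurable M"
  using w \<sigma> u v unfolding weight_def by auto

lemma weights_pos: "AE x in M. 0 < w x" "AE x in M. 0 < \<sigma> x"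
  using w \<sigma> unfolding weight_def by auto

lemma cube:
  assumes "Q \<in> S"
  shows "Q \<in> sets M" "0 < emeasure M Q" "emeasure M Q < top"
    "0 < emeasure \<mu> Q" "emeasure \<mu> Q < top" "0 < emeasure \<nu> Q" "emeasure \<nu> Q < top"
proof -
  have Q: "Q \<in> (\<Union>k. D k)" using S assms by blast
  note dc = dyadic_cube[OF M D Q]
  show "Q \<in> sets M" "0 < emeasure M Q" "emeasure M Q < top" by (fact dc)+
  obtain z r where "Q \<subseteq> ball z r" using dc(4) by blast
  note wm = weight_measure_pos_finite[OF _ dc(1,2) this]
  show "0 < emeasure \<mu> Q" "emeasure \<mu> Q < top" by (rule wm[OF u])+
  show "0 < emeasure \<nu> Q" "emeasure \<nu> Q < top" by (rule wm[OF v])+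
qed

lemma countable_S: "countable S"
proof -
  have "countable (\<Union>k. D k)" using D unfolding dyadic_system_def by auto
  then show ?thesis using S countable_subset by blast
qed

lemma laminar_S: "laminar S"
proof -
  have "\<forall>Q\<in>(\<Union>k. D k). \<forall>R\<in>(\<Union>k. D k). Q \<inter> R = {} \<or> Q \<subseteq> R \<or> R \<subseteq> Q"
    using D unfolding dyadic_system_def by (elim conjE)
  then have "laminar (\<Union>k. D k)" unfolding laminar_def .
  then show ?thesis using S by (rule laminar_subset)
qed

lemma cube_families:
  assumes "finite J" "J \<subseteq> S" shows "cube_family \<mu> J" "cube_family \<nu> J"
  using assms cube laminar_subset[OF laminar_S assms(2)] unfolding cube_family_def by auto

lemma coeff_finite: "Q \<in> S \<Longrightarrow> coeff Q < top"
proof -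
  assume Q: "Q \<in> S"
  have fin: "x epowr t < top" if "0 < x" "x < top" for x t
    using that by (auto simp: ennpowr_def)
  have pos: "0 < x / emeasure M Q" "x / emeasure M Q < top" if "0 < x" "x < top" for x
    using that cube[OF Q] by (auto simp: ennreal_zero_less_divide ennreal_divide_eq_top_iff less_top[symmetric])
  have quot: "x / emeasure M Q < top" if "x < top" for x
    using that cube[OF Q] by (auto simp: ennreal_divide_eq_top_iff less_top[symmetric])
  show ?thesis
    unfolding coeff_def tau_def avg_weight[OF measurable_weights(3) cube(1)[OF Q]]
      avg_weight[OF measurable_weights(4) cube(1)[OF Q]]
    by (intro quot ennreal_mult_less_top[THEN iffD2] disjI2 conjI fin pos cube Q ennreal_less_top)
qed

lemma sparse_form_eq:
  assumes f: "f \<in> borel_measurable M" and g: "g \<in> borel_measurable M"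
    and F: "F = (\<lambda>x. ennreal (\<bar>f x\<bar> * u x powr (- 1 / p0)))"
    and G: "G = (\<lambda>x. ennreal (\<bar>g x\<bar> * v x powr (- 1 / q0')))"
  shows "sparse_form M p0 q0 S lam f g
    = (\<integral>\<^sup>+Q. coeff Q * (pavg \<mu> p0 F Q * emeasure \<mu> Q) * (pavg \<nu> q0' G Q * emeasure \<nu> Q) \<partial>count_space S)"
  unfolding sparse_form_def Let_def q0'(3)[symmetric]
proof (intro nn_integral_cong)
  fix Q assume "Q \<in> space (count_space S)"
  then have Q: "Q \<in> S" by simp
  note cQ = cube[OF Q]
  have r: "0 < p0" "0 < q0'" "emeasure M Q \<noteq> 0" using p0 q0' cQ by auto
  have 1: "avg M (\<lambda>x. ennreal (\<bar>f x\<bar> powr p0)) Q epowr (1 / p0)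
      = pavg \<mu> p0 F Q * (emeasure \<mu> Q / emeasure M Q) epowr (1 / p0)"
    by (intro avg_root_eq change_of_function(2)[OF f _ weights_pos(1) u_eq r(1) p0(2) F]) (use cQ r in auto)
  have 2: "avg M (\<lambda>x. ennreal (\<bar>g x\<bar> powr q0')) Q epowr (1 / q0')
      = pavg \<nu> q0' G Q * (emeasure \<nu> Q / emeasure M Q) epowr (1 / q0')"
    by (intro avg_root_eq change_of_function(2)[OF g _ weights_pos(2) v_eq r(2) q0'(2) G]) (use cQ r in auto)
  have "avg M (\<lambda>x. ennreal (\<bar>f x\<bar> powr p0)) Q epowr (1 / p0)
      * avg M (\<lambda>x. ennreal (\<bar>g x\<bar> powr q0')) Q epowr (1 / q0') * ennreal (lam Q)
    = pavg \<mu> p0 F Q * pavg \<nu> q0' G Q * ((emeasure \<mu> Q / emeasure M Q) epowr (1 / p0)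
      * (emeasure \<nu> Q / emeasure M Q) epowr (1 / q0') * ennreal (lam Q))"
    unfolding 1 2 by (simp only: ac_simps)
  also have "(emeasure \<mu> Q / emeasure M Q) epowr (1 / p0)
      * (emeasure \<nu> Q / emeasure M Q) epowr (1 / q0') * ennreal (lam Q) = coeff Q * emeasure \<mu> Q * emeasure \<nu> Q"
    unfolding coeff_def tau_def avg_weight[OF measurable_weights(3) cQ(1)] avg_weight[OF measurable_weights(4) cQ(1)]
    by (rule sparse_coefficient[OF cQ(4-7) r(3) cQ(3) p0_eq q0_eq])
  finally show "avg M (\<lambda>x. ennreal (\<bar>f x\<bar> powr p0)) Q epowr (1 / p0)
      * avg M (\<lambda>x. ennreal (\<bar>g x\<bar> powr q0')) Q epowr (1 / q0') * ennreal (lam Q)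
    = coeff Q * (pavg \<mu> p0 F Q * emeasure \<mu> Q) * (pavg \<nu> q0' G Q * emeasure \<nu> Q)"
    by (simp only: ac_simps)
qed

lemma sparse_form_le:
  assumes f: "f \<in> borel_measurable M" and g: "g \<in> borel_measurable M"
    and s: "inverse s = ennreal (max (1 / q - 1 / p) 0)"
  shows "sparse_form M p0 q0 S lam f g
    \<le> ennreal (upper_const p0 q0' p q') * (testing \<mu> \<nu> S coeff s p q + testing \<nu> \<mu> S coeff s q' p')
      * Lp_norm (wmeasure M w) p (\<lambda>x. ennreal \<bar>f x\<bar>) * Lp_norm (wmeasure M \<sigma>) q' (\<lambda>x. ennreal \<bar>g x\<bar>)"
proof -
  define F where "F = (\<lambda>x. ennreal (\<bar>f x\<bar> * u x powr (- 1 / p0)))"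
  define G where "G = (\<lambda>x. ennreal (\<bar>g x\<bar> * v x powr (- 1 / q0')))"
  note [measurable] = f g
  have meas: "F \<in> borel_measurable \<mu>" "G \<in> borel_measurable \<nu>"
    unfolding F_def G_def by measurable
  have pos: "0 < p0" "0 < q0'" using p0 q0' by auto
  have norms: "Lp_norm \<mu> p F = Lp_norm (wmeasure M w) p (\<lambda>x. ennreal \<bar>f x\<bar>)"
    "Lp_norm \<nu> q' G = Lp_norm (wmeasure M \<sigma>) q' (\<lambda>x. ennreal \<bar>g x\<bar>)"
    by (rule change_of_function(1)[OF f measurable_weights(1) weights_pos(1) u_eq pos(1) p0(2) F_def]
        change_of_function(1)[OF g measurable_weights(2) weights_pos(2) v_eq pos(2) q0'(2) G_def])+
  show ?thesis
    unfolding sparse_form_eq[OF f g F_def G_def] norms[symmetric] mult.assoc[of _ "Lp_norm _ _ _"]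
    by (rule testing_sufficient_countable[OF countable_S cube_families meas pq s p0 q0'(1,2)])
qed

lemma form_bounded_of_sparse_form:
  assumes N: "\<forall>f\<in>Lp_space (wmeasure M w) p. \<forall>g\<in>Lp_space (wmeasure M \<sigma>) q'.
      sparse_form M p0 q0 S lam f g \<le> N * Lp_norm (wmeasure M w) p (\<lambda>x. ennreal \<bar>f x\<bar>)
         * Lp_norm (wmeasure M \<sigma>) q' (\<lambda>x. ennreal \<bar>g x\<bar>)"
  shows "form_bounded \<mu> \<nu> S coeff p q' N"
  unfolding form_bounded_def
proof (intro ballI impI)
  fix F G assume FG: "F \<in> borel_measurable \<mu>" "G \<in> borel_measurable \<nu>" "\<forall>x. F x < top" "\<forall>x. G x < top"
    "Lp_norm \<mu> p F < top" "Lp_norm \<nu> q' G < top"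
  have [measurable]: "F \<in> borel_measurable M" "G \<in> borel_measurable M" using FG(1,2) by auto
  have uv: "AE x in M. 0 < u x" "AE x in M. 0 < v x" using u v unfolding weight_def by auto
  have pos: "0 < p0" "0 < q0'" using p0 q0' by auto
  define f where "f = (\<lambda>x. enn2real (F x) * u x powr (1 / p0))"
  define g where "g = (\<lambda>x. enn2real (G x) * v x powr (1 / q0'))"
  have fm [measurable]: "f \<in> borel_measurable M" "g \<in> borel_measurable M"
    unfolding f_def g_def by measurable
  define F' where "F' = (\<lambda>x. ennreal (\<bar>f x\<bar> * u x powr (- 1 / p0)))"
  define G' where "G' = (\<lambda>x. ennreal (\<bar>g x\<bar> * v x powr (- 1 / q0')))"
  have meas: "F' \<in> borel_measurable \<mu>" "G' \<in> borel_measurable \<nu>"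
    unfolding F'_def G'_def by measurable
  have ae: "AE x in \<mu>. F' x = F x" "AE x in \<nu>. G' x = G x"
    unfolding F'_def G'_def
    by (intro AE_weighted_cong recover_function[OF _ _ _ f_def] recover_function[OF _ _ _ g_def]; use FG uv in auto)+
  have nF: "Lp_norm \<mu> p F' = Lp_norm \<mu> p F"
    unfolding Lp_norm_def using ae(1)
    by (intro arg_cong[where f = "\<lambda>t. t epowr _"] nn_integral_cong_AE) auto
  have nG: "Lp_norm \<nu> q' G' = Lp_norm \<nu> q' G"
    unfolding Lp_norm_def using ae(2)
    by (intro arg_cong[where f = "\<lambda>t. t epowr _"] nn_integral_cong_AE) auto
  have norms: "Lp_norm (wmeasure M w) p (\<lambda>x. ennreal \<bar>f x\<bar>) = Lp_norm \<mu> p F"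
    "Lp_norm (wmeasure M \<sigma>) q' (\<lambda>x. ennreal \<bar>g x\<bar>) = Lp_norm \<nu> q' G"
    using change_of_function(1)[OF fm(1) measurable_weights(1) weights_pos(1) u_eq pos(1) p0(2) F'_def]
      change_of_function(1)[OF fm(2) measurable_weights(2) weights_pos(2) v_eq pos(2) q0'(2) G'_def] nF nG by simp_all
  have "(\<integral>\<^sup>+Q. coeff Q * (\<integral>\<^sup>+x\<in>Q. F x \<partial>\<mu>) * (\<integral>\<^sup>+x\<in>Q. G x \<partial>\<nu>) \<partial>count_space S)
      \<le> (\<integral>\<^sup>+Q. coeff Q * (pavg \<mu> p0 F' Q * emeasure \<mu> Q) * (pavg \<nu> q0' G' Q * emeasure \<nu> Q) \<partial>count_space S)"
  proof (intro nn_integral_mono)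
    fix Q assume "Q \<in> space (count_space S)"
    then have Q: "Q \<in> S" by simp
    note cQ = cube[OF Q]
    have "(\<integral>\<^sup>+x\<in>Q. F x \<partial>\<mu>) = (\<integral>\<^sup>+x\<in>Q. F' x \<partial>\<mu>)"
      using ae(1) by (intro nn_integral_cong_AE) auto
    also have "\<dots> = avg \<mu> F' Q * emeasure \<mu> Q" by (rule avg_times_emeasure[OF cQ(4,5), symmetric])
    also have "\<dots> \<le> pavg \<mu> p0 F' Q * emeasure \<mu> Q"
      using cQ by (intro mult_right_mono avg_le_pavg meas p0) auto
    finally have 1: "(\<integral>\<^sup>+x\<in>Q. F x \<partial>\<mu>) \<le> pavg \<mu> p0 F' Q * emeasure \<mu> Q" .
    have "(\<integral>\<^sup>+x\<in>Q. G x \<partial>\<nu>) = (\<integral>\<^sup>+x\<in>Q. G' x \<partial>\<nu>)"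
      using ae(2) by (intro nn_integral_cong_AE) auto
    also have "\<dots> = avg \<nu> G' Q * emeasure \<nu> Q" by (rule avg_times_emeasure[OF cQ(6,7), symmetric])
    also have "\<dots> \<le> pavg \<nu> q0' G' Q * emeasure \<nu> Q"
      using cQ by (intro mult_right_mono avg_le_pavg meas q0') auto
    finally have 2: "(\<integral>\<^sup>+x\<in>Q. G x \<partial>\<nu>) \<le> pavg \<nu> q0' G' Q * emeasure \<nu> Q" .
    show "coeff Q * (\<integral>\<^sup>+x\<in>Q. F x \<partial>\<mu>) * (\<integral>\<^sup>+x\<in>Q. G x \<partial>\<nu>)
        \<le> coeff Q * (pavg \<mu> p0 F' Q * emeasure \<mu> Q) * (pavg \<nu> q0' G' Q * emeasure \<nu> Q)"
      by (intro mult_mono 1 2 order_refl) auto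
  qed
  also have "\<dots> = sparse_form M p0 q0 S lam f g"
    by (rule sparse_form_eq[OF fm F'_def G'_def, symmetric])
  also have "\<dots> \<le> N * Lp_norm \<mu> p F * Lp_norm \<nu> q' G"
  proof -
    have "f \<in> Lp_space (wmeasure M w) p" "g \<in> Lp_space (wmeasure M \<sigma>) q'"
      using FG(5,6) norms by (auto simp: Lp_space_def)
    then show ?thesis using N norms by metis
  qed
  finally show "(\<integral>\<^sup>+Q. coeff Q * (\<integral>\<^sup>+x\<in>Q. F x \<partial>\<mu>) * (\<integral>\<^sup>+x\<in>Q. G x \<partial>\<nu>) \<partial>count_space S)
      \<le> N * (Lp_norm \<mu> p F * Lp_norm \<nu> q' G)" by (simp add: mult.assoc)
qed

text \<open>
  An infinite constant \<open>N\<close> must be treated apart in the second estimate, since the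
  absorption arguments require \<open>N < \<infinity>\<close>.
\<close>

theorem best_const_bounds:
  assumes s: "inverse s = ennreal (max (1 / q - 1 / p) 0)"
  defines "T \<equiv> testing \<mu> \<nu> S coeff s p q + testing \<nu> \<mu> S coeff s q' p'"
  shows "best_const M p0 q0 p q S lam w \<sigma> \<le> ennreal (upper_const p0 q0' p q') * T"
    and "T \<le> ennreal (lower_const p' + lower_const q) * best_const M p0 q0 p q S lam w \<sigma>"
proof -
  have q': "enn2real (conj_exp (ennreal q)) = q'"
  proof -
    have "q' = q / (q - 1)" using pq by (simp add: field_simps)
    then show ?thesis using pq by (simp add: conj_exp_real)
  qed
  let ?N = "{N. \<forall>f\<in>Lp_space (wmeasure M w) p. \<forall>g\<in>Lp_space (wmeasure M \<sigma>) q'.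
      sparse_form M p0 q0 S lam f g \<le> N * Lp_norm (wmeasure M w) p (\<lambda>x. ennreal \<bar>f x\<bar>)
         * Lp_norm (wmeasure M \<sigma>) q' (\<lambda>x. ennreal \<bar>g x\<bar>)}"
  have best: "best_const M p0 q0 p q S lam w \<sigma> = Inf ?N"
    unfolding best_const_def q' Let_def ..
  show "best_const M p0 q0 p q S lam w \<sigma> \<le> ennreal (upper_const p0 q0' p q') * T"
    unfolding best
  proof (rule Inf_lower, unfold mem_Collect_eq, intro ballI)
    fix f g assume "f \<in> Lp_space (wmeasure M w) p" "g \<in> Lp_space (wmeasure M \<sigma>) q'"
    then have "f \<in> borel_measurable M" "g \<in> borel_measurable M" by (auto simp: Lp_space_def)
    then show "sparse_form M p0 q0 S lam f g \<le> ennreal (upper_const p0 q0' p q') * T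
        * Lp_norm (wmeasure M w) p (\<lambda>x. ennreal \<bar>f x\<bar>) * Lp_norm (wmeasure M \<sigma>) q' (\<lambda>x. ennreal \<bar>g x\<bar>)"
      unfolding T_def using s by (rule sparse_form_le)
  qed
  have low: "1 \<le> lower_const t" for t by (simp add: lower_const_def)
  have le: "T \<le> ennreal (lower_const p' + lower_const q) * N" if N: "N \<in> ?N" for N
  proof (cases "N = top")
    case True
    have "0 < lower_const p' + lower_const q" using low[of p'] low[of q] by linarith
    then show ?thesis using True by (simp add: ennreal_mult_top ennreal_eq_0_iff)
  next
    case False
    then have fin: "N < top" using less_top by blast
    have fb: "form_bounded \<mu> \<nu> S coeff p q' N"
      by (rule form_bounded_of_sparse_form) (use N in blast)
    have s': "inverse s = ennreal (max (1 / p' - 1 / q') 0)"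
    proof -
      have "1 / p' - 1 / q' = 1 / q - 1 / p" using pq by linarith
      then show ?thesis using s by simp
    qed
    have "testing \<mu> \<nu> S coeff s p q \<le> ennreal (lower_const p') * N"
      by (rule testing_necessary[OF countable_S cube_families coeff_finite pq s fb fin])
    moreover have "testing \<nu> \<mu> S coeff s q' p' \<le> ennreal (lower_const q) * N"
      by (rule testing_necessary[OF countable_S cube_families(2,1) coeff_finite pq(5,4) _ pq(2,1) _ s'
            form_bounded_swap[OF fb] fin]) (use pq in \<open>simp_all add: add.commute\<close>)
    ultimately have "T \<le> ennreal (lower_const p') * N + ennreal (lower_const q) * N"
      unfolding T_def by (rule add_mono)
    also have "\<dots> = ennreal (lower_const p' + lower_const q) * N"
      using low[of p'] low[of q] by (simp add: distrib_right)
    finally show ?thesis .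
  qed
  let ?c = "lower_const p' + lower_const q"
  have c: "0 < ?c" using low[of p'] low[of q] by linarith
  then have cc: "ennreal (1 / ?c) * ennreal ?c = 1" by (simp flip: ennreal_mult)
  have "ennreal (1 / ?c) * T \<le> Inf ?N"
  proof (rule Inf_greatest)
    fix N assume "N \<in> ?N"
    then have "ennreal (1 / ?c) * T \<le> ennreal (1 / ?c) * (ennreal ?c * N)"
      by (intro mult_left_mono le) auto
    then show "ennreal (1 / ?c) * T \<le> N" by (simp only: mult.assoc[symmetric] cc mult_1)
  qed
  then have "ennreal ?c * (ennreal (1 / ?c) * T) \<le> ennreal ?c * Inf ?N"
    by (intro mult_left_mono) auto
  then show "T \<le> ennreal ?c * best_const M p0 q0 p q S lam w \<sigma>"
    unfolding best by (simp only: mult.assoc[symmetric] mult.commute[of "ennreal ?c" "ennreal (1 / ?c)"] cc mult_1)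
qed

end

theorem theorem1p2:
  fixes M :: "'a::metric_space measure"
    and D :: "int \<Rightarrow> 'a set set"
    and p0 p q :: real
    and q0 s :: ennreal
  assumes "doubling_space M"
    and "dyadic_system D"
    and "1 \<le> p0" and "ennreal p0 < q0"
    and "p0 < p" and "ennreal p < q0"
    and "p0 < q" and "ennreal q < q0"
    and "inverse s = ennreal (max (1 / q - 1 / p) 0)"
  shows "\<exists>C::real. 0 < C \<and>
    (\<forall>(S :: 'a set set) (lam :: 'a set \<Rightarrow> real) (w :: 'a \<Rightarrow> real) (\<sigma> :: 'a \<Rightarrow> real).
      S \<subseteq> (\<Union>k. D k) \<longrightarrow> sparse_family M S \<longrightarrow> (\<forall>Q\<in>S. 0 \<le> lam Q) \<longrightarrow> weight M w \<longrightarrow> weight M \<sigma> \<longrightarrow>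
      (let p' = enn2real (conj_exp (ennreal p));
           q' = enn2real (conj_exp (ennreal q));
           q0' = enn2real (conj_exp q0);
           u = (\<lambda>x. w x powr (p0 / (p0 - p)));
           v = (\<lambda>x. \<sigma> x powr (q0' / (q0' - q')));
           N = best_const M p0 q0 p q S lam w \<sigma>;
           t = tau M p0 q0 lam u v;
           T = testing_const M S t s p q u v;
           T' = testing_const M S t s q' p' v u
       in weight M u \<longrightarrow> weight M v \<longrightarrow>
          ennreal (1 / C) * (T + T') \<le> N \<and> N \<le> ennreal C * (T + T')))"
proof -
  have "1 < p" "1 < q" using assms by auto
  define p' where "p' = enn2real (conj_exp (ennreal p))"
  define q' where "q' = enn2real (conj_exp (ennreal q))"
  define q0' where "q0' = enn2real (conj_exp q0)"
  note exps = conj_exp_enn2real(1,2)[OF \<open>1 < p\<close>, folded p'_def] conj_exp_enn2real[OF \<open>1 < q\<close>, folded q'_def]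
  note q0s = conj_exp_bounds[OF \<open>1 < q\<close> assms(8), folded q0'_def]
  define C where "C = max (upper_const p0 q0' p q') (lower_const p' + lower_const q)"
  have low: "1 \<le> lower_const t" for t by (simp add: lower_const_def)
  have C: "0 < C" "lower_const p' + lower_const q \<le> C" "upper_const p0 q0' p q' \<le> C"
    unfolding C_def using low[of p'] low[of q] by linarith+
  have "ennreal (1 / C) * (testing_const M S (tau M p0 q0 lam u v) s p q u v
            + testing_const M S (tau M p0 q0 lam u v) s q' p' v u) \<le> best_const M p0 q0 p q S lam w \<sigma>
      \<and> best_const M p0 q0 p q S lam w \<sigma> \<le> ennreal C * (testing_const M S (tau M p0 q0 lam u v) s p q u v
            + testing_const M S (tau M p0 q0 lam u v) s q' p' v u)"
    if S: "S \<subseteq> (\<Union>k. D k)" and w: "weight M w" "weight M \<sigma>" and uv: "weight M u" "weight M v"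
      and u: "u = (\<lambda>x. w x powr (p0 / (p0 - p)))" and v: "v = (\<lambda>x. \<sigma> x powr (q0' / (q0' - q')))"
    for S :: "'a set set" and lam w \<sigma> u v
  proof -
    interpret weighted_sparse_form M D S lam w \<sigma> u v p0 p p' q q' q0' q0
      by unfold_locales
        (use assms S w uv u v exps q0s \<open>1 < p\<close> \<open>1 < q\<close> q0'_def inverse_conj_exp_real[OF assms(3)] in simp_all)
    have Ss: "S \<subseteq> sets M" using cube(1) by blast
    let ?T = "testing \<mu> \<nu> S coeff s p q + testing \<nu> \<mu> S coeff s q' p'"
    let ?N = "best_const M p0 q0 p q S lam w \<sigma>"
    have eq: "testing_const M S (tau M p0 q0 lam u v) s p q u v
        + testing_const M S (tau M p0 q0 lam u v) s q' p' v u = ?T"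
      unfolding testing_const_eq_testing[OF measurable_weights(3) Ss]
        testing_const_eq_testing[OF measurable_weights(4) Ss] coeff_def[abs_def] ..
    have "?N \<le> ennreal C * ?T"
      by (rule order_trans[OF best_const_bounds(1)[OF assms(9)]]) (intro mult_right_mono ennreal_leI C, simp)
    moreover have "ennreal (1 / C) * ?T \<le> ?N"
    proof -
      have "?T \<le> ennreal C * ?N"
        by (rule order_trans[OF best_const_bounds(2)[OF assms(9)]]) (intro mult_right_mono ennreal_leI C, simp)
      then have "ennreal (1 / C) * ?T \<le> ennreal (1 / C) * (ennreal C * ?N)"
        by (intro mult_left_mono) auto
      moreover have "ennreal (1 / C) * ennreal C = 1" using C(1) by (simp flip: ennreal_mult)
      ultimately show ?thesis by (simp only: mult.assoc[symmetric] mult_1)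
    qed
    ultimately show ?thesis unfolding eq by blast
  qed
  then show ?thesis
    unfolding Let_def p'_def[symmetric] q'_def[symmetric] q0'_def[symmetric]
    using C(1) by (intro exI[of _ C] conjI allI impI) blast+
qed

end
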